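(* Let $k$ be a non-negative integer, and let $(X,d)$ be a metric space with $\mathcal{H}_k(X)\not\cong 0$. Then $$\lim_{\epsilon\in\boldsymbol{(0,\infty)}} H_k\big(CN(X)\otimes_{\boldsymbol{(0,\infty)}}A_\epsilon\big)\;\not\cong\;\lim_{\epsilon\in\boldsymbol{(0,\infty)}} H_k\big(CN(X)\otimes_{\boldsymbol{(0,\infty)}}A_{(0,\epsilon]}\big).$$ That is, under the limit, the $k$th ordinary and blurred magnitude homology of $X$ are not isomorphic. In particular, for any finite metric space the limits differ for $k=0$.
   Context: Let $\boldsymbol{[0,\infty)}$ (respectively $\boldsymbol{(0,\infty)}$) be the category whose objects are the non-negative (respectively positive) real numbers, with exactly one morphism $\epsilon\to\epsilon'$ whenever $\epsilon\le\epsilon'$ (and no others). $\mathrm{Ab}$ is the category of abelian groups, $\mathrm{ch}_{\mathrm{Ab}}$ the category of chain complexes of abelian groups, $\boxtimes$ the tensor product of abelian groups and the induced tensor product of chain complexes; abelian groups are regarded as chain complexes concentrated in degree $0$. Limits are categorical limits in $\mathrm{Ab}$. Simplicial sets: for $\epsilon\ge 0$, $$N(X)(\epsilon)_n=\Big\{(x_0,\dots,x_n)\in X^{n+1}\ \Big|\ \sum_{i=0}^{n-1} d(x_i,x_{i+1})\le\epsilon\Big\},\qquad V^{\mathrm{sing}}(X)(\epsilon)_n=\big\{(x_0,\dots,x_n)\in X^{n+1}\ \big|\ d(x_i,x_j)\le\epsilon\ \forall i,j\big\},$$ with face maps deleting an entry, degeneracy maps repeating an entry, and inclusions for $\epsilon\le\epsilon'$.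 $CN(X)$ and $CV^{\mathrm{sing}}(X)$ denote the resulting functors to $\mathrm{ch}_{\mathrm{Ab}}$ obtained by applying the free abelian group functor levelwise and then taking the unnormalised chain complex (boundary map equal to the alternating sum of face maps). The Vietoris homology of $X$ is $\mathcal{H}_k(X)=\lim_{\epsilon\in\boldsymbol{(0,\infty)}}H_k(CV^{\mathrm{sing}}(X)(\epsilon))$. Coends: for $A\colon \boldsymbol{[0,\infty)}^{\mathrm{op}}\to \mathrm{Ab}\hookrightarrow\mathrm{ch}_{\mathrm{Ab}}$, $CN(X)\otimes_{\boldsymbol{[0,\infty)}}A$ is the coequaliser of the two maps $$\bigoplus_{\ell\le\ell'} CN(X)(\ell)\boxtimes A(\ell')\rightrightarrows \bigoplus_{\ell\in[0,\infty)} CN(X)(\ell)\boxtimes A(\ell)$$ induced by $CN(X)(\ell\le\ell')\boxtimes 1$ and $1\boxtimes A(\ell\le\ell')$. Coefficient functors $\boldsymbol{[0,\infty)}^{\mathrm{op}}\to\mathrm{Ab}$: $A_\epsilon$ sends $\ell$ to $\mathbb{Z}$ if $\ell=\epsilon$ and to $0$ otherwise, and sends $\ell\ge\ell'$ to $\mathrm{id}_{\mathbb{Z}}$ if $\ell=\ell'=\epsilon$ and to $0$ otherwise. $A_{[0,\epsilon]}$ sends $\ell$ to $\mathbb{Z}$ if $\ell\in[0,\epsilon]$ and to $0$ otherwise, and sends $\ell\ge\ell'$ to $\mathrm{id}_{\mathbb{Z}}$ if $\ell,\ell'\in[0,\epsilon]$ and to $0$ otherwise. For $\epsilon\le\epsilon'$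 there are natural transformations $A_\epsilon\Rightarrow A_{\epsilon'}$ (component at $\ell$ the identity if $\ell=\epsilon=\epsilon'$, zero otherwise) and $A_{[0,\epsilon]}\Rightarrow A_{[0,\epsilon']}$ (component at $\ell$ the identity if $\ell\in[0,\epsilon]$, zero otherwise); these induce chain maps on coends and so make $\epsilon\mapsto CN(X)\otimes_{\boldsymbol{[0,\infty)}}A_\epsilon$ and $\epsilon\mapsto CN(X)\otimes_{\boldsymbol{[0,\infty)}}A_{[0,\epsilon]}$ into functors $\boldsymbol{[0,\infty)}\to\mathrm{ch}_{\mathrm{Ab}}$, whose homologies are the (ordinary) magnitude homology and the blurred magnitude homology of $X$, respectively. $H_k(CN(X)\otimes_{\boldsymbol{(0,\infty)}}A_\epsilon)$ and $H_k(CN(X)\otimes_{\boldsymbol{(0,\infty)}}A_{(0,\epsilon]})$ denote the functors $\boldsymbol{(0,\infty)}\to\mathrm{Ab}$ obtained from $\epsilon\mapsto H_k(CN(X)\otimes_{\boldsymbol{[0,\infty)}}A_\epsilon)$ and $\epsilon\mapsto H_k(CN(X)\otimes_{\boldsymbol{[0,\infty)}}A_{[0,\epsilon]})$, respectively, by precomposition with the inclusion $\boldsymbol{(0,\infty)}\hookrightarrow\boldsymbol{[0,\infty)}$.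
   Formalization: The final sentence, that the limits differ for k = 0 for any finite metric space, is stated for nonempty finite metric spaces: for the empty space both limits are 0 and hence isomorphic. *)

theory Defs
  imports "HOL-Algebra.Free_Abelian_Groups" "HOL-Analysis.Abstract_Metric_Spaces"
begin

text \<open>Complexes are concentrated in non-negative degrees; \<open>bd C n\<close> is the boundary map from degree
  \<open>n + 1\<close> to degree \<open>n\<close>, and the boundary map out of degree 0 is zero. A chain map is a
  degree-indexed family of functions. Maps only matter on carriers.\<close>

record 'a chain_cpx =
  grp :: "nat \<Rightarrow> 'a monoid"
  bd :: "nat \<Rightarrow> 'a \<Rightarrow> 'a"

text \<open>The map into \<open>H Mod N\<close> induced by \<open>f\<close> on cosets. If \<open>f\<close> respects the subgroups involved,
  all the cosets in the union agree.\<close>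

definition coset_map :: "'b monoid \<Rightarrow> 'b set \<Rightarrow> ('a \<Rightarrow> 'b) \<Rightarrow> 'a set \<Rightarrow> 'b set" where
  "coset_map H N f S = (\<Union>x\<in>S. N #>\<^bsub>H\<^esub> f x)"

definition cycles :: "'a chain_cpx \<Rightarrow> nat \<Rightarrow> 'a set" where
  "cycles C k = (case k of 0 \<Rightarrow> carrier (grp C 0)
                 | Suc n \<Rightarrow> kernel (grp C (Suc n)) (grp C n) (bd C n))"

definition boundaries :: "'a chain_cpx \<Rightarrow> nat \<Rightarrow> 'a set" where
  "boundaries C k = bd C k ` carrier (grp C (Suc k))"

definition homology :: "nat \<Rightarrow> 'a chain_cpx \<Rightarrow> 'a set monoid" where
  "homology k C = (grp C k)\<lparr>carrier := cycles C k\<rparr> Mod boundaries C k"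

definition homology_map :: "nat \<Rightarrow> 'b chain_cpx \<Rightarrow> (nat \<Rightarrow> 'a \<Rightarrow> 'b) \<Rightarrow> 'a set \<Rightarrow> 'b set" where
  "homology_map k D f = coset_map (grp D k) (boundaries D k) (f k)"

definition dsum_cpx :: "'i set \<Rightarrow> ('i \<Rightarrow> 'a chain_cpx) \<Rightarrow> ('i \<Rightarrow> 'a) chain_cpx" where
  "dsum_cpx I C = \<lparr>grp = (\<lambda>n. sum_group I (\<lambda>i. grp (C i) n)),
                   bd = (\<lambda>n x. \<lambda>i\<in>I. bd (C i) n (x i))\<rparr>"

definition dsum_incl :: "'i set \<Rightarrow> ('i \<Rightarrow> 'a chain_cpx) \<Rightarrow> 'i \<Rightarrow> nat \<Rightarrow> 'a \<Rightarrow> ('i \<Rightarrow> 'a)" where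
  "dsum_incl I C i n c = (\<lambda>j\<in>I. if j = i then c else \<one>\<^bsub>grp (C j) n\<^esub>)"

definition dsum_copair :: "'i set \<Rightarrow> 'b chain_cpx \<Rightarrow> ('i \<Rightarrow> nat \<Rightarrow> 'a \<Rightarrow> 'b) \<Rightarrow> nat \<Rightarrow> ('i \<Rightarrow> 'a) \<Rightarrow> 'b" where
  "dsum_copair I D f n x = gfinprod (grp D n) (\<lambda>i. f i n (x i)) I"

definition dsum_map :: "'i set \<Rightarrow> ('i \<Rightarrow> nat \<Rightarrow> 'a \<Rightarrow> 'b) \<Rightarrow> nat \<Rightarrow> ('i \<Rightarrow> 'a) \<Rightarrow> ('i \<Rightarrow> 'b)" where
  "dsum_map I f n x = (\<lambda>i\<in>I. f i n (x i))"

text \<open>The coequaliser of chain maps \<open>f, g : C \<rightarrow> D\<close> is the quotient of \<open>D\<close> by the image of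
  \<open>f - g\<close>.\<close>

definition diff_image ::
    "'a chain_cpx \<Rightarrow> 'b chain_cpx \<Rightarrow> (nat \<Rightarrow> 'a \<Rightarrow> 'b) \<Rightarrow> (nat \<Rightarrow> 'a \<Rightarrow> 'b) \<Rightarrow> nat \<Rightarrow> 'b set" where
  "diff_image C D f g n = (\<lambda>x. f n x \<otimes>\<^bsub>grp D n\<^esub> inv\<^bsub>grp D n\<^esub> g n x) ` carrier (grp C n)"

definition coequaliser ::
    "'a chain_cpx \<Rightarrow> 'b chain_cpx \<Rightarrow> (nat \<Rightarrow> 'a \<Rightarrow> 'b) \<Rightarrow> (nat \<Rightarrow> 'a \<Rightarrow> 'b) \<Rightarrow> 'b set chain_cpx" where
  "coequaliser C D f g =
     \<lparr>grp = (\<lambda>n. grp D n Mod diff_image C D f g n),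
      bd = (\<lambda>n. coset_map (grp D n) (diff_image C D f g n) (bd D n))\<rparr>"

definition bilinear_relations ::
    "'a monoid \<Rightarrow> 'b monoid \<Rightarrow> (('a \<times> 'b) \<Rightarrow>\<^sub>0 int) set" where
  "bilinear_relations G H = generate (free_Abelian_group (carrier G \<times> carrier H))
     ({frag_of (x \<otimes>\<^bsub>G\<^esub> x', y) - frag_of (x, y) - frag_of (x', y) | x x' y.
         x \<in> carrier G \<and> x' \<in> carrier G \<and> y \<in> carrier H} \<union>
      {frag_of (x, y \<otimes>\<^bsub>H\<^esub> y') - frag_of (x, y) - frag_of (x, y') | x y y'.
         x \<in> carrier G \<and> y \<in> carrier H \<and> y' \<in> carrier H})"

definition tensor_group ::
    "'a monoid \<Rightarrow> 'b monoid \<Rightarrow> (('a \<times> 'b) \<Rightarrow>\<^sub>0 int) set monoid" where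
  "tensor_group G H =
     free_Abelian_group (carrier G \<times> carrier H) Mod bilinear_relations G H"

definition tensor_hom ::
    "'c monoid \<Rightarrow> 'd monoid \<Rightarrow> ('a \<Rightarrow> 'c) \<Rightarrow> ('b \<Rightarrow> 'd) \<Rightarrow>
     (('a \<times> 'b) \<Rightarrow>\<^sub>0 int) set \<Rightarrow> (('c \<times> 'd) \<Rightarrow>\<^sub>0 int) set" where
  "tensor_hom G' H' f g =
     coset_map (free_Abelian_group (carrier G' \<times> carrier H')) (bilinear_relations G' H')
       (frag_extend (\<lambda>(x, y). frag_of (f x, g y)))"

text \<open>The boundary map is \<open>\<partial>(x \<otimes> y) = \<partial>x \<otimes> y + (-1)\<^sup>i x \<otimes> \<partial>y\<close> for \<open>x\<close> of degree \<open>i\<close>. It is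
  given below by its components: the \<open>(i, j)\<close> component of the result receives contributions from
  the \<open>(i + 1, j)\<close> and \<open>(i, j + 1)\<close> components of the argument.\<close>

definition tensor_cpx ::
    "'a chain_cpx \<Rightarrow> 'b chain_cpx \<Rightarrow> (nat \<times> nat \<Rightarrow> (('a \<times> 'b) \<Rightarrow>\<^sub>0 int) set) chain_cpx"
    (infixr \<open>\<boxtimes>\<close> 70) where
  "C \<boxtimes> D =
     \<lparr>grp = (\<lambda>n. sum_group {(i, j). i + j = n} (\<lambda>(i, j). tensor_group (grp C i) (grp D j))),
      bd = (\<lambda>n x. \<lambda>(i, j)\<in>{(i, j). i + j = n}.
        tensor_hom (grp C i) (grp D j) (bd C i) (\<lambda>y. y) (x (Suc i, j))
        \<otimes>\<^bsub>tensor_group (grp C i) (grp D j)\<^esub>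
        (tensor_hom (grp C i) (grp D j) (\<lambda>y. y) (bd D j) (x (i, Suc j))
           [^]\<^bsub>tensor_group (grp C i) (grp D j)\<^esub> ((-1) ^ i :: int)))\<rparr>"

definition tensor_cpx_map ::
    "'c chain_cpx \<Rightarrow> 'd chain_cpx \<Rightarrow> (nat \<Rightarrow> 'a \<Rightarrow> 'c) \<Rightarrow> (nat \<Rightarrow> 'b \<Rightarrow> 'd) \<Rightarrow> nat \<Rightarrow>
     (nat \<times> nat \<Rightarrow> (('a \<times> 'b) \<Rightarrow>\<^sub>0 int) set) \<Rightarrow> (nat \<times> nat \<Rightarrow> (('c \<times> 'd) \<Rightarrow>\<^sub>0 int) set)" where
  "tensor_cpx_map C' D' f g n x =
     (\<lambda>(i, j)\<in>{(i, j). i + j = n}. tensor_hom (grp C' i) (grp D' j) (f i) (g j) (x (i, j)))"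

definition conc :: "'a monoid \<Rightarrow> 'a chain_cpx" where
  "conc A = \<lparr>grp = (\<lambda>n. if n = 0 then A else singleton_group \<one>\<^bsub>A\<^esub>), bd = (\<lambda>n x. \<one>\<^bsub>A\<^esub>)\<rparr>"

definition conc_map :: "'b monoid \<Rightarrow> ('a \<Rightarrow> 'b) \<Rightarrow> nat \<Rightarrow> 'a \<Rightarrow> 'b" where
  "conc_map B f n = (if n = 0 then f else (\<lambda>x. \<one>\<^bsub>B\<^esub>))"

text \<open>The data of a functor defined on \<open>[0,\<infinity>)\<close> or on its opposite. For \<open>s \<le> t\<close>, \<open>arr F s t\<close> is
  the map \<open>ob F s \<rightarrow> ob F t\<close> if \<open>F\<close> is covariant, and the map \<open>ob F t \<rightarrow> ob F s\<close> if \<open>F\<close> is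
  contravariant. Values at negative numbers are irrelevant. The functor restricted along
  \<open>(0,\<infinity>) \<rightarrow> [0,\<infinity>)\<close> is given by the same data.\<close>

record ('o, 'm) line_functor =
  ob :: "real \<Rightarrow> 'o"
  arr :: "real \<Rightarrow> real \<Rightarrow> 'm"

type_synonym 'a ab_functor = "('a monoid, 'a \<Rightarrow> 'a) line_functor"
type_synonym 'a ch_functor = "('a chain_cpx, nat \<Rightarrow> 'a \<Rightarrow> 'a) line_functor"

definition homology_functor :: "nat \<Rightarrow> 'a ch_functor \<Rightarrow> 'a set ab_functor" where
  "homology_functor k F =
     \<lparr>ob = (\<lambda>s. homology k (ob F s)), arr = (\<lambda>s t. homology_map k (ob F t) (arr F s t))\<rparr>"

text \<open>The limit over \<open>(0,\<infinity>)\<close> of a covariant functor: the group of compatible families.\<close>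

definition lim_pos :: "'a ab_functor \<Rightarrow> (real \<Rightarrow> 'a) monoid" where
  "lim_pos F = (product_group {0<..} (ob F))
     \<lparr>carrier := {x \<in> carrier (product_group {0<..} (ob F)).
                   \<forall>s t. 0 < s \<and> s \<le> t \<longrightarrow> arr F s t (x s) = x t}\<rparr>"

abbreviation le_pairs :: "(real \<times> real) set" where
  "le_pairs \<equiv> {(l, l'). 0 \<le> l \<and> l \<le> l'}"

definition coend_source :: "'a ch_functor \<Rightarrow> 'b ab_functor \<Rightarrow>
    (real \<times> real \<Rightarrow> nat \<times> nat \<Rightarrow> (('a \<times> 'b) \<Rightarrow>\<^sub>0 int) set) chain_cpx" where
  "coend_source F A = dsum_cpx le_pairs (\<lambda>(l, l'). ob F l \<boxtimes> conc (ob A l'))"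

definition coend_target :: "'a ch_functor \<Rightarrow> 'b ab_functor \<Rightarrow>
    (real \<Rightarrow> nat \<times> nat \<Rightarrow> (('a \<times> 'b) \<Rightarrow>\<^sub>0 int) set) chain_cpx" where
  "coend_target F A = dsum_cpx {0..} (\<lambda>l. ob F l \<boxtimes> conc (ob A l))"

definition coend_left where
  "coend_left F A = dsum_copair le_pairs (coend_target F A) (\<lambda>(l, l') n x.
     dsum_incl {0..} (\<lambda>l. ob F l \<boxtimes> conc (ob A l)) l' n
       (tensor_cpx_map (ob F l') (conc (ob A l')) (arr F l l') (\<lambda>_ y. y) n x))"

definition coend_right where
  "coend_right F A = dsum_copair le_pairs (coend_target F A) (\<lambda>(l, l') n x.
     dsum_incl {0..} (\<lambda>l. ob F l \<boxtimes> conc (ob A l)) l n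
       (tensor_cpx_map (ob F l) (conc (ob A l)) (\<lambda>_ y. y)
          (conc_map (ob A l) (arr A l l')) n x))"

definition coend :: "'a ch_functor \<Rightarrow> 'b ab_functor \<Rightarrow>
    (real \<Rightarrow> nat \<times> nat \<Rightarrow> (('a \<times> 'b) \<Rightarrow>\<^sub>0 int) set) set chain_cpx" where
  "coend F A =
     coequaliser (coend_source F A) (coend_target F A) (coend_left F A) (coend_right F A)"

text \<open>The map from the coend with some \<open>A\<close> to the coend with \<open>B\<close> induced by a natural
  transformation \<open>\<alpha> : A \<Rightarrow> B\<close>.\<close>

definition coend_map where
  "coend_map F B \<alpha> n =
     coset_map (grp (coend_target F B) n)
       (diff_image (coend_source F B) (coend_target F B) (coend_left F B) (coend_right F B) n)
       (dsum_map {0..} (\<lambda>l. tensor_cpx_map (ob F l) (conc (ob B l)) (\<lambda>_ y. y)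
                               (conc_map (ob B l) (\<alpha> l))) n)"

text \<open>A functor \<open>\<A>\<close> from \<open>[0,\<infinity>)\<close> to coefficient functors, with transition transformations \<open>\<tau>\<close>,
  yields a functor from \<open>[0,\<infinity>)\<close> to chain complexes.\<close>

definition coend_functor where
  "coend_functor F \<A> \<tau> =
     \<lparr>ob = (\<lambda>\<epsilon>. coend F (\<A> \<epsilon>)), arr = (\<lambda>\<epsilon> \<epsilon>'. coend_map F (\<A> \<epsilon>') (\<tau> \<epsilon> \<epsilon>'))\<rparr>"

definition A_point :: "real \<Rightarrow> int ab_functor" where
  "A_point \<epsilon> =
     \<lparr>ob = (\<lambda>l. if l = \<epsilon> then integer_group else singleton_group 0),
      arr = (\<lambda>l l'. if l = \<epsilon> \<and> l' = \<epsilon> then (\<lambda>z. z) else (\<lambda>z. 0))\<rparr>"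

definition A_point_trans :: "real \<Rightarrow> real \<Rightarrow> real \<Rightarrow> int \<Rightarrow> int" where
  "A_point_trans \<epsilon> \<epsilon>' l = (if l = \<epsilon> \<and> \<epsilon> = \<epsilon>' then (\<lambda>z. z) else (\<lambda>z. 0))"

definition A_interval :: "real \<Rightarrow> int ab_functor" where
  "A_interval \<epsilon> =
     \<lparr>ob = (\<lambda>l. if l \<in> {0..\<epsilon>} then integer_group else singleton_group 0),
      arr = (\<lambda>l l'. if l \<in> {0..\<epsilon>} \<and> l' \<in> {0..\<epsilon>} then (\<lambda>z. z) else (\<lambda>z. 0))\<rparr>"

definition A_interval_trans :: "real \<Rightarrow> real \<Rightarrow> real \<Rightarrow> int \<Rightarrow> int" where
  "A_interval_trans \<epsilon> \<epsilon>' l = (if l \<in> {0..\<epsilon>} then (\<lambda>z. z) else (\<lambda>z. 0))"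

text \<open>\<open>face S n i\<close> maps degree \<open>n\<close> to degree \<open>n - 1\<close>, and \<open>degen S n i\<close> maps degree \<open>n\<close> to
  degree \<open>n + 1\<close>. The unnormalised chain complex does not use the degeneracies.\<close>

record 'a sset =
  simplices :: "nat \<Rightarrow> 'a set"
  face :: "nat \<Rightarrow> nat \<Rightarrow> 'a \<Rightarrow> 'a"
  degen :: "nat \<Rightarrow> nat \<Rightarrow> 'a \<Rightarrow> 'a"

definition chains :: "'a sset \<Rightarrow> ('a \<Rightarrow>\<^sub>0 int) chain_cpx" where
  "chains S =
     \<lparr>grp = (\<lambda>n. free_Abelian_group (simplices S n)),
      bd = (\<lambda>n. frag_extend (\<lambda>x. \<Sum>i\<le>Suc n. frag_cmul ((-1) ^ i) (frag_of (face S (Suc n) i x))))\<rparr>"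

definition chains_map :: "(nat \<Rightarrow> 'a \<Rightarrow> 'b) \<Rightarrow> nat \<Rightarrow> ('a \<Rightarrow>\<^sub>0 int) \<Rightarrow> ('b \<Rightarrow>\<^sub>0 int)" where
  "chains_map f n = frag_extend (\<lambda>x. frag_of (f n x))"

text \<open>Tuples \<open>(x\<^sub>0, \<dots>, x\<^sub>n)\<close> are lists of length \<open>n + 1\<close>.\<close>

definition tuple_sset :: "(nat \<Rightarrow> 'a list set) \<Rightarrow> 'a list sset" where
  "tuple_sset T =
     \<lparr>simplices = T,
      face = (\<lambda>n i x. take i x @ drop (Suc i) x),
      degen = (\<lambda>n i x. take (Suc i) x @ drop i x)\<rparr>"

definition nerve :: "'a set \<Rightarrow> ('a \<Rightarrow> 'a \<Rightarrow> real) \<Rightarrow> real \<Rightarrow> 'a list sset" where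
  "nerve X d \<epsilon> = tuple_sset (\<lambda>n. {x. length x = Suc n \<and> set x \<subseteq> X \<and>
     (\<Sum>i<n. d (x ! i) (x ! Suc i)) \<le> \<epsilon>})"

definition vietoris :: "'a set \<Rightarrow> ('a \<Rightarrow> 'a \<Rightarrow> real) \<Rightarrow> real \<Rightarrow> 'a list sset" where
  "vietoris X d \<epsilon> = tuple_sset (\<lambda>n. {x. length x = Suc n \<and> set x \<subseteq> X \<and>
     (\<forall>i\<le>n. \<forall>j\<le>n. d (x ! i) (x ! j) \<le> \<epsilon>)})"

definition CN :: "'a set \<Rightarrow> ('a \<Rightarrow> 'a \<Rightarrow> real) \<Rightarrow> ('a list \<Rightarrow>\<^sub>0 int) ch_functor" where
  "CN X d = \<lparr>ob = (\<lambda>\<epsilon>. chains (nerve X d \<epsilon>)), arr = (\<lambda>\<epsilon> \<epsilon>'. chains_map (\<lambda>_ x. x))\<rparr>"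

definition CV :: "'a set \<Rightarrow> ('a \<Rightarrow> 'a \<Rightarrow> real) \<Rightarrow> ('a list \<Rightarrow>\<^sub>0 int) ch_functor" where
  "CV X d = \<lparr>ob = (\<lambda>\<epsilon>. chains (vietoris X d \<epsilon>)), arr = (\<lambda>\<epsilon> \<epsilon>'. chains_map (\<lambda>_ x. x))\<rparr>"

definition vietoris_homology where
  "vietoris_homology k X d = lim_pos (homology_functor k (CV X d))"

definition magnitude_homology where
  "magnitude_homology k X d =
     homology_functor k (coend_functor (CN X d) A_point A_point_trans)"

definition blurred_magnitude_homology where
  "blurred_magnitude_homology k X d =
     homology_functor k (coend_functor (CN X d) A_interval A_interval_trans)"

end

theory Submission
  imports Defs
begin

text \<open>For \<open>s < t\<close> the transition map from \<open>A\<^sub>s\<close> to \<open>A\<^sub>t\<close> is zero. In a compatible family of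
  magnitude homology classes the class at \<open>t\<close> is the image of the class at \<open>t/2\<close>, hence zero, and so
  the limit of magnitude homology has at most one element (\<open>lim_magnitude_subset\<close>).

  The limit of blurred magnitude homology, in contrast, contains the Vietoris homology. The
  coefficients \<open>A\<^bsub>[0,\<epsilon>]\<^esub>\<close> identify a chain of \<open>CN(X)(l)\<close> with its image in \<open>CN(X)(\<epsilon>)\<close> when
  \<open>l \<le> \<epsilon>\<close> and kill the chains with \<open>l > \<epsilon>\<close>, so that the coend is a copy of \<open>CN(X)(\<epsilon>)\<close>. Moreover the
  nerve and the Vietoris complex are interleaved in bounded degrees: a path of length at most \<open>\<epsilon>\<close>
  has diameter at most \<open>\<epsilon>\<close>, and a path of at most \<open>k + 1\<close> steps within a set of diameter
  \<open>\<epsilon>/(k + 1)\<close> has length at most \<open>\<epsilon>\<close>. The interleaving changes the parameter only by a factor,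
  which disappears in the limit.

  Groups of different cardinality are not isomorphic, so it suffices to embed the Vietoris limit, as
  a set, into the blurred one (\<open>lim_vietoris_to_blurred\<close>). The embedding is induced by
  \<open>CV(\<epsilon>/(k + 1)) \<rightarrow> CN(\<epsilon>) \<rightarrow> coend\<close> with second map \<open>c \<mapsto> c \<otimes> 1\<close>. It is injective because the map
  \<open>coend \<rightarrow> CV(\<epsilon>)\<close> that sums up the evaluations \<open>c \<otimes> a \<mapsto> a c\<close> completes it to the transition map
  \<open>CV(\<epsilon>/(k + 1)) \<rightarrow> CV(\<epsilon>)\<close>. If the Vietoris limit is not trivial it has two elements, and so has
  the blurred limit. For \<open>k = 0\<close> and \<open>X\<close> nonempty, the class of a point is a nonzero element of the
  Vietoris limit, since its augmentation is \<open>1\<close>.\<close>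

section \<open>Maps induced on quotients\<close>

lemma r_coset_mult_left:
  assumes "group G" "subgroup N G" "n \<in> N" "x \<in> carrier G"
  shows "N #>\<^bsub>G\<^esub> (n \<otimes>\<^bsub>G\<^esub> x) = N #>\<^bsub>G\<^esub> x"
proof -
  interpret group G by fact
  have "N #>\<^bsub>G\<^esub> (n \<otimes>\<^bsub>G\<^esub> x) = (N #>\<^bsub>G\<^esub> n) #>\<^bsub>G\<^esub> x"
    using assms subgroup.subset[OF assms(2)] by (intro coset_mult_assoc[symmetric]) auto
  also have "N #>\<^bsub>G\<^esub> n = N"
    using assms by (metis coset_join2 subgroup.mem_carrier)
  finally show ?thesis .
qed

lemma coset_map_r_coset:
  assumes "group G" "group H" "subgroup N G" "subgroup M H" "f \<in> hom G H" "f ` N \<subseteq> M"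
    and x: "x \<in> carrier G"
  shows "coset_map H M f (N #>\<^bsub>G\<^esub> x) = M #>\<^bsub>H\<^esub> f x"
proof -
  have "M #>\<^bsub>H\<^esub> f (n \<otimes>\<^bsub>G\<^esub> x) = M #>\<^bsub>H\<^esub> f x" if n: "n \<in> N" for n
  proof -
    have "n \<in> carrier G"
      using n assms(3) subgroup.mem_carrier by metis
    then have "f (n \<otimes>\<^bsub>G\<^esub> x) = f n \<otimes>\<^bsub>H\<^esub> f x"
      using assms by (simp add: hom_mult)
    then show ?thesis
      using r_coset_mult_left[OF assms(2,4)] n assms(6) hom_in_carrier[OF assms(5) x] by auto
  qed
  then show ?thesis
    using subgroup.one_closed[OF assms(3)] by (auto simp: coset_map_def r_coset_def[of G])
qed

lemma coset_map_hom:
  assumes "group G" "group H" "N \<lhd> G" "M \<lhd> H" "f \<in> hom G H" "f ` N \<subseteq> M"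
  shows "coset_map H M f \<in> hom (G Mod N) (H Mod M)"
proof (rule homI)
  have sub: "subgroup N G" "subgroup M H"
    using assms by (auto intro: normal_imp_subgroup)
  note cm = coset_map_r_coset[OF assms(1,2) sub assms(5,6)]
  show "coset_map H M f S \<in> carrier (H Mod M)" if "S \<in> carrier (G Mod N)" for S
    using that cm hom_in_carrier[OF assms(5)] by (auto simp: carrier_FactGroup)
  fix S T assume "S \<in> carrier (G Mod N)" "T \<in> carrier (G Mod N)"
  then obtain x y where xy: "x \<in> carrier G" "S = N #>\<^bsub>G\<^esub> x" "y \<in> carrier G" "T = N #>\<^bsub>G\<^esub> y"
    by (auto simp: carrier_FactGroup)
  have "x \<otimes>\<^bsub>G\<^esub> y \<in> carrier G"
    using xy assms(1) by (simp add: group.subgroup_self subgroup.m_closed)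
  then show "coset_map H M f (S \<otimes>\<^bsub>G Mod N\<^esub> T) = coset_map H M f S \<otimes>\<^bsub>H Mod M\<^esub> coset_map H M f T"
    using xy cm hom_in_carrier[OF assms(5)] hom_mult[OF assms(5)]
      normal.rcos_sum[OF assms(3)] normal.rcos_sum[OF assms(4)] by auto
qed

lemma coset_map_eq_one:
  assumes "group G" "group H" "subgroup N G" "subgroup M H"
    and f: "\<And>x. x \<in> carrier G \<Longrightarrow> f x \<in> M" and S: "S \<in> carrier (G Mod N)"
  shows "coset_map H M f S = M"
proof -
  obtain x where x: "x \<in> carrier G" "S = N #>\<^bsub>G\<^esub> x"
    using S by (auto simp: carrier_FactGroup)
  have "M #>\<^bsub>H\<^esub> f y = M" if "y \<in> S" for y
  proof -
    have "y \<in> carrier G"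
      using x that monoid.r_coset_subset_G[OF group.is_monoid[OF assms(1)] subgroup.subset[OF assms(3)]] by auto
    then show ?thesis
      using f assms(2,4) by (metis group.coset_join2 subgroup.mem_carrier)
  qed
  moreover have "x \<in> S"
    using x assms(1,3) by (simp add: group.rcos_self)
  ultimately show ?thesis
    by (auto simp: coset_map_def)
qed

text \<open>The factorisation of \<open>f\<close> through a quotient by a subgroup on which \<open>f\<close> is trivial. Unlike
  \<^const>\<open>coset_map\<close>, its values are elements and not cosets.\<close>

definition quotient_lift :: "('a \<Rightarrow> 'b) \<Rightarrow> 'a set \<Rightarrow> 'b" where
  "quotient_lift f S = the_elem (f ` S)"

lemma quotient_lift_r_coset:
  assumes "group G" "group H" "subgroup N G" "f \<in> hom G H" "f ` N \<subseteq> {\<one>\<^bsub>H\<^esub>}"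
    and x: "x \<in> carrier G"
  shows "quotient_lift f (N #>\<^bsub>G\<^esub> x) = f x"
proof -
  have "f (n \<otimes>\<^bsub>G\<^esub> x) = f x" if n: "n \<in> N" for n
  proof -
    have "n \<in> carrier G"
      using n assms(3) subgroup.mem_carrier by metis
    then have "f (n \<otimes>\<^bsub>G\<^esub> x) = f n \<otimes>\<^bsub>H\<^esub> f x"
      using assms by (simp add: hom_mult)
    then show ?thesis
      using n assms hom_in_carrier[OF assms(4) x] by (auto simp: group.is_monoid image_subset_iff)
  qed
  moreover have "x \<in> N #>\<^bsub>G\<^esub> x"
    using x assms(1,3) by (simp add: group.rcos_self)
  ultimately have "f ` (N #>\<^bsub>G\<^esub> x) = {f x}"
    by (auto simp: r_coset_def)
  then show ?thesis
    by (simp add: quotient_lift_def)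
qed

lemma quotient_lift_hom:
  assumes "group G" "group H" "N \<lhd> G" "f \<in> hom G H" "f ` N \<subseteq> {\<one>\<^bsub>H\<^esub>}"
  shows "quotient_lift f \<in> hom (G Mod N) H"
proof (rule homI)
  note ql = quotient_lift_r_coset[OF assms(1,2) normal_imp_subgroup[OF assms(3)] assms(4,5)]
  show "quotient_lift f S \<in> carrier H" if "S \<in> carrier (G Mod N)" for S
    using that ql hom_in_carrier[OF assms(4)] by (auto simp: carrier_FactGroup)
  fix S T assume "S \<in> carrier (G Mod N)" "T \<in> carrier (G Mod N)"
  then obtain x y where xy: "x \<in> carrier G" "S = N #>\<^bsub>G\<^esub> x" "y \<in> carrier G" "T = N #>\<^bsub>G\<^esub> y"
    by (auto simp: carrier_FactGroup)
  have "x \<otimes>\<^bsub>G\<^esub> y \<in> carrier G"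
    using xy assms(1) by (simp add: group.subgroup_self subgroup.m_closed)
  then show "quotient_lift f (S \<otimes>\<^bsub>G Mod N\<^esub> T) = quotient_lift f S \<otimes>\<^bsub>H\<^esub> quotient_lift f T"
    using xy ql hom_mult[OF assms(4)] normal.rcos_sum[OF assms(3)] by auto
qed

lemma comm_group_normal: "comm_group G \<Longrightarrow> subgroup N G \<Longrightarrow> N \<lhd> G"
  by (simp add: comm_group.normal_iff_subgroup)

lemma hom_image_generate_subset:
  assumes "group G" "group H" "f \<in> hom G H" "S \<subseteq> carrier G" "subgroup M H" "f ` S \<subseteq> M"
  shows "f ` generate G S \<subseteq> M"
proof -
  have gh: "group_hom G H f"
    using assms by (simp add: group_hom_def group_hom_axioms_def)
  show ?thesis
    using group_hom.generate_img[OF gh assms(4)] group.generate_subgroup_incl[OF assms(2,6,5)] by simp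
qed

section \<open>Tensor products\<close>

definition pure_tensor :: "'a monoid \<Rightarrow> 'b monoid \<Rightarrow> 'a \<Rightarrow> 'b \<Rightarrow> (('a \<times> 'b) \<Rightarrow>\<^sub>0 int) set" where
  "pure_tensor G H x y =
     bilinear_relations G H #>\<^bsub>free_Abelian_group (carrier G \<times> carrier H)\<^esub> frag_of (x, y)"

lemma keys_frag_of_diff:
  assumes "a \<in> S" "b \<in> S" "c \<in> S"
  shows "Poly_Mapping.keys (frag_of a - frag_of b - frag_of c :: _ \<Rightarrow>\<^sub>0 int) \<subseteq> S"
  using assms keys_diff[of "frag_of a - frag_of b" "frag_of c"] keys_diff[of "frag_of a" "frag_of b"]
  by auto

lemma bilinear_gens_carrier:
  assumes "group G" "group H"
  shows "{frag_of (x \<otimes>\<^bsub>G\<^esub> x', y) - frag_of (x, y) - frag_of (x', y) | x x' y.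
         x \<in> carrier G \<and> x' \<in> carrier G \<and> y \<in> carrier H} \<union>
      {frag_of (x, y \<otimes>\<^bsub>H\<^esub> y') - frag_of (x, y) - frag_of (x, y') | x y y'.
         x \<in> carrier G \<and> y \<in> carrier H \<and> y' \<in> carrier H}
    \<subseteq> carrier (free_Abelian_group (carrier G \<times> carrier H))"
proof -
  interpret G: group G by fact
  interpret H: group H by fact
  let ?S = "carrier G \<times> carrier H"
  have "frag_of (x \<otimes>\<^bsub>G\<^esub> x', y) - frag_of (x, y) - frag_of (x', y) \<in> carrier (free_Abelian_group ?S)"
    if "x \<in> carrier G" "x' \<in> carrier G" "y \<in> carrier H" for x x' y
    unfolding carrier_free_Abelian_group_iff by (rule keys_frag_of_diff) (use that in simp_all)
  moreover have "frag_of (x, y \<otimes>\<^bsub>H\<^esub> y') - frag_of (x, y) - frag_of (x, y') \<in> carrier (free_Abelian_group ?S)"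
    if "x \<in> carrier G" "y \<in> carrier H" "y' \<in> carrier H" for x y y'
    unfolding carrier_free_Abelian_group_iff by (rule keys_frag_of_diff) (use that in simp_all)
  ultimately show ?thesis by blast
qed

lemma subgroup_bilinear_relations:
  assumes "group G" "group H"
  shows "subgroup (bilinear_relations G H) (free_Abelian_group (carrier G \<times> carrier H))"
  unfolding bilinear_relations_def
  by (rule group.generate_is_subgroup[OF group_free_Abelian_group bilinear_gens_carrier[OF assms]])

lemma normal_bilinear_relations:
  assumes "group G" "group H"
  shows "bilinear_relations G H \<lhd> free_Abelian_group (carrier G \<times> carrier H)"
  using comm_group_normal[OF abelian_free_Abelian_group subgroup_bilinear_relations[OF assms]] .

lemma comm_group_tensor_group: "group G \<Longrightarrow> group H \<Longrightarrow> comm_group (tensor_group G H)"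
  unfolding tensor_group_def
  by (intro comm_group.abelian_FactGroup abelian_free_Abelian_group subgroup_bilinear_relations)

lemma group_tensor_group: "group G \<Longrightarrow> group H \<Longrightarrow> group (tensor_group G H)"
  using comm_group_tensor_group comm_group.axioms(2) by blast

lemma pure_tensor_carrier:
  assumes "x \<in> carrier G" "y \<in> carrier H"
  shows "pure_tensor G H x y \<in> carrier (tensor_group G H)"
  using assms by (auto simp: pure_tensor_def tensor_group_def carrier_FactGroup)

lemma frag_of_diff_r_coset:
  assumes "group G" "group H"
    and abc: "a \<in> carrier G \<times> carrier H" "b \<in> carrier G \<times> carrier H" "c \<in> carrier G \<times> carrier H"
    and rel: "frag_of a - frag_of b - frag_of c \<in> bilinear_relations G H"
  shows "bilinear_relations G H #>\<^bsub>free_Abelian_group (carrier G \<times> carrier H)\<^esub> frag_of a =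
    (bilinear_relations G H #>\<^bsub>free_Abelian_group (carrier G \<times> carrier H)\<^esub> frag_of b)
    \<otimes>\<^bsub>tensor_group G H\<^esub>
    (bilinear_relations G H #>\<^bsub>free_Abelian_group (carrier G \<times> carrier H)\<^esub> frag_of c)"
    (is "?N #>\<^bsub>?F\<^esub> _ = _")
proof -
  have bc: "Poly_Mapping.keys (frag_of b + frag_of c) \<subseteq> carrier G \<times> carrier H"
    using abc keys_add[of "frag_of b" "frag_of c"] by auto
  have "?N #>\<^bsub>?F\<^esub> frag_of a = ?N #>\<^bsub>?F\<^esub> (frag_of b + frag_of c)"
    using r_coset_mult_left[OF _ subgroup_bilinear_relations[OF assms(1,2)] rel, of "frag_of b + frag_of c"] bc
    by simp
  also have "\<dots> = (?N #>\<^bsub>?F\<^esub> frag_of b) \<otimes>\<^bsub>tensor_group G H\<^esub> (?N #>\<^bsub>?F\<^esub> frag_of c)"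
    using normal.rcos_sum[OF normal_bilinear_relations[OF assms(1,2)], of "frag_of b" "frag_of c"] abc
    by (simp add: tensor_group_def)
  finally show ?thesis .
qed

lemma pure_tensor_mult_left:
  assumes "group G" "group H" "x \<in> carrier G" "x' \<in> carrier G" "y \<in> carrier H"
  shows "pure_tensor G H (x \<otimes>\<^bsub>G\<^esub> x') y = pure_tensor G H x y \<otimes>\<^bsub>tensor_group G H\<^esub> pure_tensor G H x' y"
  unfolding pure_tensor_def
proof (rule frag_of_diff_r_coset[OF assms(1,2)])
  show "frag_of (x \<otimes>\<^bsub>G\<^esub> x', y) - frag_of (x, y) - frag_of (x', y) \<in> bilinear_relations G H"
    unfolding bilinear_relations_def using assms by (intro generate.incl) blast
qed (use assms in \<open>auto simp: group.subgroup_self subgroup.m_closed\<close>)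

lemma pure_tensor_mult_right:
  assumes "group G" "group H" "x \<in> carrier G" "y \<in> carrier H" "y' \<in> carrier H"
  shows "pure_tensor G H x (y \<otimes>\<^bsub>H\<^esub> y') = pure_tensor G H x y \<otimes>\<^bsub>tensor_group G H\<^esub> pure_tensor G H x y'"
  unfolding pure_tensor_def
proof (rule frag_of_diff_r_coset[OF assms(1,2)])
  show "frag_of (x, y \<otimes>\<^bsub>H\<^esub> y') - frag_of (x, y) - frag_of (x, y') \<in> bilinear_relations G H"
    unfolding bilinear_relations_def using assms by (intro generate.incl) blast
qed (use assms in \<open>auto simp: group.subgroup_self subgroup.m_closed\<close>)

lemma pure_tensor_one_right:
  assumes "group G" "group H" "x \<in> carrier G"
  shows "pure_tensor G H x \<one>\<^bsub>H\<^esub> = \<one>\<^bsub>tensor_group G H\<^esub>"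
proof -
  interpret T: group "tensor_group G H" by (rule group_tensor_group[OF assms(1,2)])
  interpret H: group H by fact
  have "pure_tensor G H x \<one>\<^bsub>H\<^esub> = pure_tensor G H x \<one>\<^bsub>H\<^esub> \<otimes>\<^bsub>tensor_group G H\<^esub> pure_tensor G H x \<one>\<^bsub>H\<^esub>"
    using pure_tensor_mult_right[OF assms(1,2,3), of "\<one>\<^bsub>H\<^esub>" "\<one>\<^bsub>H\<^esub>"] by simp
  then show ?thesis
    using pure_tensor_carrier[OF assms(3) H.one_closed] by simp
qed

text \<open>Pure tensors generate, so homomorphisms out of a tensor product are compared on them.\<close>

lemma tensor_hom_ext:
  assumes "group G" "group H" "group K"
    and h: "h \<in> hom (tensor_group G H) K" and h': "h' \<in> hom (tensor_group G H) K"
    and eq: "\<And>x y. x \<in> carrier G \<Longrightarrow> y \<in> carrier H \<Longrightarrow> h (pure_tensor G H x y) = h' (pure_tensor G H x y)"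
    and t: "t \<in> carrier (tensor_group G H)"
  shows "h t = h' t"
proof -
  let ?F = "free_Abelian_group (carrier G \<times> carrier H)" and ?N = "bilinear_relations G H"
  have T: "group (tensor_group G H)" by (rule group_tensor_group[OF assms(1,2)])
  have p: "(\<lambda>c. ?N #>\<^bsub>?F\<^esub> c) \<in> hom ?F (tensor_group G H)"
    unfolding tensor_group_def by (rule normal.r_coset_hom_Mod[OF normal_bilinear_relations[OF assms(1,2)]])
  have gh: "group_hom ?F K (h \<circ> (\<lambda>c. ?N #>\<^bsub>?F\<^esub> c))" "group_hom ?F K (h' \<circ> (\<lambda>c. ?N #>\<^bsub>?F\<^esub> c))"
    using hom_compose[OF p h] hom_compose[OF p h'] assms(3)
    by (simp_all add: group_hom_def group_hom_axioms_def)
  have "(h \<circ> (\<lambda>c. ?N #>\<^bsub>?F\<^esub> c)) c = (h' \<circ> (\<lambda>c. ?N #>\<^bsub>?F\<^esub> c)) c"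
    if "Poly_Mapping.keys c \<subseteq> carrier G \<times> carrier H" for c
    using that
  proof (induction c rule: free_Abelian_group_induct[consumes 1, case_names zero diff one])
    case zero
    then show ?case
      using group_hom.hom_one[OF gh(1)] group_hom.hom_one[OF gh(2)] by simp
  next
    case (diff x y)
    have eq: "x - y = x \<otimes>\<^bsub>?F\<^esub> inv\<^bsub>?F\<^esub> y"
      using diff by simp
    have c: "x \<in> carrier ?F" "y \<in> carrier ?F" "inv\<^bsub>?F\<^esub> y \<in> carrier ?F"
      using diff by (auto simp: keys_minus)
    show ?case
      unfolding eq group_hom.hom_mult[OF gh(1) c(1,3)] group_hom.hom_mult[OF gh(2) c(1,3)]
        group_hom.hom_inv[OF gh(1) c(2)] group_hom.hom_inv[OF gh(2) c(2)] diff ..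
  next
    case (one a)
    then show ?case
      using eq by (auto simp: pure_tensor_def)
  qed
  moreover obtain c where "Poly_Mapping.keys c \<subseteq> carrier G \<times> carrier H" "t = ?N #>\<^bsub>?F\<^esub> c"
    using t by (auto simp: tensor_group_def carrier_FactGroup)
  ultimately show ?thesis by simp
qed

lemma frag_extend_hom:
  assumes "\<And>x. x \<in> S \<Longrightarrow> Poly_Mapping.keys (b x) \<subseteq> T"
  shows "frag_extend b \<in> hom (free_Abelian_group S) (free_Abelian_group T)"
  using assms by (intro homI) (auto simp: frag_extend_add dest!: subsetD[OF keys_frag_extend])

lemma tensor_hom_relations:
  assumes "group G" "group H" "group G'" "group H'" "f \<in> hom G G'" "g \<in> hom H H'"
  shows "frag_extend (\<lambda>(x, y). frag_of (f x, g y)) ` bilinear_relations G H \<subseteq> bilinear_relations G' H'"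
  unfolding bilinear_relations_def[of G H]
proof (rule hom_image_generate_subset[OF group_free_Abelian_group group_free_Abelian_group
      frag_extend_hom bilinear_gens_carrier[OF assms(1,2)] subgroup_bilinear_relations[OF assms(3,4)]])
  show "Poly_Mapping.keys (case x of (x, y) \<Rightarrow> frag_of (f x, g y)) \<subseteq> carrier G' \<times> carrier H'"
    if "x \<in> carrier G \<times> carrier H" for x
    using that assms(5,6) by (auto simp: hom_in_carrier)
  show "frag_extend (\<lambda>(x, y). frag_of (f x, g y)) `
    ({frag_of (x \<otimes>\<^bsub>G\<^esub> x', y) - frag_of (x, y) - frag_of (x', y) |x x' y.
       x \<in> carrier G \<and> x' \<in> carrier G \<and> y \<in> carrier H} \<union>
     {frag_of (x, y \<otimes>\<^bsub>H\<^esub> y') - frag_of (x, y) - frag_of (x, y') |x y y'.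
       x \<in> carrier G \<and> y \<in> carrier H \<and> y' \<in> carrier H})
    \<subseteq> bilinear_relations G' H'"
    unfolding bilinear_relations_def
    using assms(5,6)
    by (auto simp: frag_extend_diff hom_mult intro!: generate.incl) (blast intro: hom_in_carrier)+
qed

lemma
  assumes "group G" "group H" "group G'" "group H'" "f \<in> hom G G'" "g \<in> hom H H'"
  shows tensor_hom_hom: "tensor_hom G' H' f g \<in> hom (tensor_group G H) (tensor_group G' H')"
    and tensor_hom_pure: "x \<in> carrier G \<Longrightarrow> y \<in> carrier H \<Longrightarrow>
      tensor_hom G' H' f g (pure_tensor G H x y) = pure_tensor G' H' (f x) (g y)"
proof -
  have fe: "frag_extend (\<lambda>(x, y). frag_of (f x, g y))
    \<in> hom (free_Abelian_group (carrier G \<times> carrier H)) (free_Abelian_group (carrier G' \<times> carrier H'))"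
    using assms(5,6) by (intro frag_extend_hom) (auto simp: hom_in_carrier)
  show "tensor_hom G' H' f g \<in> hom (tensor_group G H) (tensor_group G' H')"
    unfolding tensor_hom_def tensor_group_def
    by (intro coset_map_hom fe tensor_hom_relations normal_bilinear_relations group_free_Abelian_group assms)
  show "tensor_hom G' H' f g (pure_tensor G H x y) = pure_tensor G' H' (f x) (g y)"
    if "x \<in> carrier G" "y \<in> carrier H"
    using coset_map_r_coset[OF group_free_Abelian_group group_free_Abelian_group
        subgroup_bilinear_relations[OF assms(1,2)] subgroup_bilinear_relations[OF assms(3,4)]
        fe tensor_hom_relations[OF assms], of "frag_of (x, y)"] that
    by (simp add: tensor_hom_def pure_tensor_def)
qed

lemma tensor_hom_carrier:
  assumes "group G" "group H" "group G'" "group H'" "f \<in> hom G G'" "g \<in> hom H H'"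
    and "t \<in> carrier (tensor_group G H)"
  shows "tensor_hom G' H' f g t \<in> carrier (tensor_group G' H')"
  using hom_in_carrier[OF tensor_hom_hom[OF assms(1-6)] assms(7)] .

lemma tensor_hom_square:
  assumes grp: "group G" "group H" "group G1" "group H1" "group G2" "group H2" "group G3" "group H3"
    and hom: "f1 \<in> hom G G1" "g1 \<in> hom H H1" "f2 \<in> hom G1 G3" "g2 \<in> hom H1 H3"
      "f3 \<in> hom G G2" "g3 \<in> hom H H2" "f4 \<in> hom G2 G3" "g4 \<in> hom H2 H3"
    and eq: "\<And>x. x \<in> carrier G \<Longrightarrow> f2 (f1 x) = f4 (f3 x)" "\<And>y. y \<in> carrier H \<Longrightarrow> g2 (g1 y) = g4 (g3 y)"
    and t: "t \<in> carrier (tensor_group G H)"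
  shows "tensor_hom G3 H3 f2 g2 (tensor_hom G1 H1 f1 g1 t) = tensor_hom G3 H3 f4 g4 (tensor_hom G2 H2 f3 g3 t)"
proof -
  note homs = tensor_hom_hom[OF grp(1-4) hom(1,2)] tensor_hom_hom[OF grp(3,4,7,8) hom(3,4)]
    tensor_hom_hom[OF grp(1,2,5,6) hom(5,6)] tensor_hom_hom[OF grp(5-8) hom(7,8)]
  have "(tensor_hom G3 H3 f2 g2 \<circ> tensor_hom G1 H1 f1 g1) t = (tensor_hom G3 H3 f4 g4 \<circ> tensor_hom G2 H2 f3 g3) t"
    by (rule tensor_hom_ext[OF grp(1,2) _ hom_compose[OF homs(1,2)] hom_compose[OF homs(3,4)] _ t])
      (use grp hom in \<open>simp_all add: group_tensor_group tensor_hom_pure[OF grp(1-4)]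
        tensor_hom_pure[OF grp(3,4,7,8)] tensor_hom_pure[OF grp(1,2,5,6)] tensor_hom_pure[OF grp(5-8)]
        hom_in_carrier[OF hom(1)] hom_in_carrier[OF hom(2)] hom_in_carrier[OF hom(5)]
        hom_in_carrier[OF hom(6)] eq\<close>)
  then show ?thesis by simp
qed

lemma tensor_hom_one_right:
  assumes "group G" "group H" "group G'" "group H'" "f \<in> hom G G'"
    and t: "t \<in> carrier (tensor_group G H)"
  shows "tensor_hom G' H' f (\<lambda>y. \<one>\<^bsub>H'\<^esub>) t = \<one>\<^bsub>tensor_group G' H'\<^esub>"
proof (rule tensor_hom_ext[OF assms(1,2) _ _ _ _ t])
  interpret T: group "tensor_group G' H'" by (rule group_tensor_group[OF assms(3,4)])
  interpret H': group H' by fact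
  have h: "(\<lambda>y. \<one>\<^bsub>H'\<^esub>) \<in> hom H H'"
    by (simp add: hom_def)
  show "tensor_hom G' H' f (\<lambda>y. \<one>\<^bsub>H'\<^esub>) \<in> hom (tensor_group G H) (tensor_group G' H')"
    by (rule tensor_hom_hom[OF assms(1-5) h])
  show "(\<lambda>_. \<one>\<^bsub>tensor_group G' H'\<^esub>) \<in> hom (tensor_group G H) (tensor_group G' H')"
    by (simp add: hom_def)
  show "tensor_hom G' H' f (\<lambda>y. \<one>\<^bsub>H'\<^esub>) (pure_tensor G H x y) = \<one>\<^bsub>tensor_group G' H'\<^esub>"
    if "x \<in> carrier G" "y \<in> carrier H" for x y
    using that assms by (simp add: tensor_hom_pure[OF assms(1-5) h] pure_tensor_one_right hom_in_carrier)
qed (rule group_tensor_group[OF assms(3,4)])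

definition bilinear :: "'a monoid \<Rightarrow> 'b monoid \<Rightarrow> 'c monoid \<Rightarrow> ('a \<Rightarrow> 'b \<Rightarrow> 'c) \<Rightarrow> bool" where
  "bilinear G H K b \<longleftrightarrow>
     (\<forall>x\<in>carrier G. \<forall>y\<in>carrier H. b x y \<in> carrier K) \<and>
     (\<forall>x\<in>carrier G. \<forall>x'\<in>carrier G. \<forall>y\<in>carrier H. b (x \<otimes>\<^bsub>G\<^esub> x') y = b x y \<otimes>\<^bsub>K\<^esub> b x' y) \<and>
     (\<forall>x\<in>carrier G. \<forall>y\<in>carrier H. \<forall>y'\<in>carrier H. b x (y \<otimes>\<^bsub>H\<^esub> y') = b x y \<otimes>\<^bsub>K\<^esub> b x y')"

definition tensor_lift :: "('a \<Rightarrow> 'b \<Rightarrow> 'c \<Rightarrow>\<^sub>0 int) \<Rightarrow> (('a \<times> 'b) \<Rightarrow>\<^sub>0 int) set \<Rightarrow> 'c \<Rightarrow>\<^sub>0 int" where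
  "tensor_lift b = quotient_lift (frag_extend (\<lambda>(x, y). b x y))"

lemma
  assumes "group G" "group H" "bilinear G H (free_Abelian_group T) b"
  shows tensor_lift_hom: "tensor_lift b \<in> hom (tensor_group G H) (free_Abelian_group T)"
    and tensor_lift_pure: "x \<in> carrier G \<Longrightarrow> y \<in> carrier H \<Longrightarrow> tensor_lift b (pure_tensor G H x y) = b x y"
proof -
  have fe: "frag_extend (\<lambda>(x, y). b x y)
    \<in> hom (free_Abelian_group (carrier G \<times> carrier H)) (free_Abelian_group T)"
    using assms(3) unfolding bilinear_def by (intro frag_extend_hom) force
  have rel: "frag_extend (\<lambda>(x, y). b x y) ` bilinear_relations G H \<subseteq> {\<one>\<^bsub>free_Abelian_group T\<^esub>}"
    unfolding bilinear_relations_def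
    by (rule hom_image_generate_subset[OF group_free_Abelian_group group_free_Abelian_group
          fe bilinear_gens_carrier[OF assms(1,2)] group.triv_subgroup])
      (use assms(3) in \<open>auto simp: bilinear_def frag_extend_diff\<close>)
  show "tensor_lift b \<in> hom (tensor_group G H) (free_Abelian_group T)"
    unfolding tensor_lift_def tensor_group_def
    by (intro quotient_lift_hom[OF _ _ _ fe rel] normal_bilinear_relations assms group_free_Abelian_group)
  show "tensor_lift b (pure_tensor G H x y) = b x y" if "x \<in> carrier G" "y \<in> carrier H"
    using quotient_lift_r_coset[OF group_free_Abelian_group group_free_Abelian_group
        subgroup_bilinear_relations[OF assms(1,2)] fe rel, of "frag_of (x, y)"] that
    by (simp add: tensor_lift_def pure_tensor_def)
qed

section \<open>Chain maps and homology\<close>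

text \<open>The constructions below act degreewise, on sequences of abelian groups and homomorphisms. The
  bound on the degree in a chain map is needed for the inclusion of a Vietoris complex into a nerve,
  which in general exists only in bounded degrees.\<close>

definition additive_cpx :: "'a chain_cpx \<Rightarrow> bool" where
  "additive_cpx C \<longleftrightarrow> (\<forall>n. comm_group (grp C n) \<and> bd C n \<in> hom (grp C (Suc n)) (grp C n))"

definition chain_map_upto :: "nat \<Rightarrow> 'a chain_cpx \<Rightarrow> 'b chain_cpx \<Rightarrow> (nat \<Rightarrow> 'a \<Rightarrow> 'b) \<Rightarrow> bool" where
  "chain_map_upto m C D f \<longleftrightarrow>
     (\<forall>n\<le>m. f n \<in> hom (grp C n) (grp D n)) \<and>
     (\<forall>n<m. \<forall>x\<in>carrier (grp C (Suc n)). f n (bd C n x) = bd D n (f (Suc n) x))"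

lemma additive_cpxD:
  assumes "additive_cpx C"
  shows "comm_group (grp C n)" "group (grp C n)" "bd C n \<in> hom (grp C (Suc n)) (grp C n)"
  using assms by (simp_all add: additive_cpx_def comm_group.axioms(2))

lemma chain_map_uptoD:
  assumes "chain_map_upto m C D f"
  shows "n \<le> m \<Longrightarrow> f n \<in> hom (grp C n) (grp D n)"
    and "n < m \<Longrightarrow> x \<in> carrier (grp C (Suc n)) \<Longrightarrow> f n (bd C n x) = bd D n (f (Suc n) x)"
    and "n \<le> m \<Longrightarrow> y \<in> carrier (grp C n) \<Longrightarrow> f n y \<in> carrier (grp D n)"
  using assms by (auto simp: chain_map_upto_def intro: hom_in_carrier)

lemma chain_map_upto_id: "chain_map_upto m C C (\<lambda>_ x. x)"
  by (simp add: chain_map_upto_def hom_def)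

lemma chain_map_upto_comp:
  assumes f: "chain_map_upto m C D f" and g: "chain_map_upto m D E g"
  shows "chain_map_upto m C E (\<lambda>n x. g n (f n x))"
  unfolding chain_map_upto_def
proof (intro conjI allI impI ballI)
  show "(\<lambda>x. g n (f n x)) \<in> hom (grp C n) (grp E n)" if "n \<le> m" for n
    using hom_compose[OF chain_map_uptoD(1)[OF f that] chain_map_uptoD(1)[OF g that]]
    by (simp add: comp_def)
  show "g n (f n (bd C n x)) = bd E n (g (Suc n) (f (Suc n) x))"
    if "n < m" "x \<in> carrier (grp C (Suc n))" for n x
    using that chain_map_uptoD[OF f] chain_map_uptoD[OF g] by simp
qed

lemma one_in_carrier_cpx: "additive_cpx C \<Longrightarrow> \<one>\<^bsub>grp C n\<^esub> \<in> carrier (grp C n)"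
  by (rule monoid.one_closed[OF group.is_monoid[OF additive_cpxD(2)]])

lemma chain_map_upto_one:
  assumes "additive_cpx C" "additive_cpx D" "chain_map_upto m C D f" "n \<le> m"
  shows "f n \<one>\<^bsub>grp C n\<^esub> = \<one>\<^bsub>grp D n\<^esub>"
  by (rule hom_one[OF chain_map_uptoD(1)[OF assms(3,4)] additive_cpxD(2)[OF assms(1)] additive_cpxD(2)[OF assms(2)]])

lemma bd_one: "additive_cpx C \<Longrightarrow> bd C n \<one>\<^bsub>grp C (Suc n)\<^esub> = \<one>\<^bsub>grp C n\<^esub>"
  by (rule hom_one[OF additive_cpxD(3) additive_cpxD(2) additive_cpxD(2)])

lemma subgroup_hom_image:
  assumes "group G" "group H" "f \<in> hom G H"
  shows "subgroup (f ` carrier G) H"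
  by (intro group_hom.img_is_subgroup group_hom.intro group_hom_axioms.intro assms)

lemma subgroup_boundaries: "additive_cpx C \<Longrightarrow> subgroup (boundaries C k) (grp C k)"
  unfolding boundaries_def by (intro subgroup_hom_image additive_cpxD)

lemma cycles_subset: "cycles C k \<subseteq> carrier (grp C k)"
  by (auto simp: cycles_def kernel_def split: nat.split)

lemma one_in_cycles: "additive_cpx C \<Longrightarrow> \<one>\<^bsub>grp C k\<^esub> \<in> cycles C k"
  by (auto simp: cycles_def kernel_def one_in_carrier_cpx bd_one split: nat.split)

lemma carrier_homology:
  "carrier (homology k C) = (\<lambda>z. boundaries C k #>\<^bsub>grp C k\<^esub> z) ` cycles C k"
  by (simp add: homology_def carrier_FactGroup r_coset_def)

lemma boundaries_r_coset_one:
  "additive_cpx C \<Longrightarrow> boundaries C k #>\<^bsub>grp C k\<^esub> \<one>\<^bsub>grp C k\<^esub> = boundaries C k"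
  by (rule group.coset_mult_one[OF additive_cpxD(2) subgroup.subset[OF subgroup_boundaries]])

lemma boundaries_in_homology: "additive_cpx C \<Longrightarrow> boundaries C k \<in> carrier (homology k C)"
  unfolding carrier_homology
  by (rule image_eqI[where x = "\<one>\<^bsub>grp C k\<^esub>"]) (simp_all add: boundaries_r_coset_one one_in_cycles)

lemma homology_class_subset:
  assumes "additive_cpx C" "x \<in> carrier (homology k C)"
  shows "x \<subseteq> carrier (grp C k)"
proof -
  obtain z where "z \<in> carrier (grp C k)" "x = boundaries C k #>\<^bsub>grp C k\<^esub> z"
    using assms(2) subsetD[OF cycles_subset[of C k]] by (auto simp: carrier_homology)
  then show ?thesis
    using monoid.r_coset_subset_G[OF group.is_monoid[OF additive_cpxD(2)[OF assms(1)]]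
      subgroup.subset[OF subgroup_boundaries[OF assms(1)]]] by simp
qed

lemma homology_map_cong:
  assumes "additive_cpx C" "x \<in> carrier (homology k C)"
    and "\<And>z. z \<in> carrier (grp C k) \<Longrightarrow> f k z = g k z"
  shows "homology_map k D f x = homology_map k D g x"
  using homology_class_subset[OF assms(1,2)] assms(3)
  unfolding homology_map_def coset_map_def by (intro SUP_cong) auto

text \<open>Cycles in degree \<open>k\<close> are detected in degree \<open>k - 1\<close> and boundaries come from degree \<open>k + 1\<close>,
  so a chain map up to degree \<open>k + 1\<close> induces a map on homology in degree \<open>k\<close>.\<close>

lemma
  assumes C: "additive_cpx C" and D: "additive_cpx D" and f: "chain_map_upto (Suc k) C D f" and z: "z \<in> cycles C k"
  shows chain_map_cycle: "f k z \<in> cycles D k"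
    and homology_map_class:
      "homology_map k D f (boundaries C k #>\<^bsub>grp C k\<^esub> z) = boundaries D k #>\<^bsub>grp D k\<^esub> f k z"
proof -
  note fD = chain_map_uptoD[OF f]
  have zc: "z \<in> carrier (grp C k)"
    by (rule subsetD[OF cycles_subset z])
  show "f k z \<in> cycles D k"
  proof (cases k)
    case 0
    then show ?thesis using fD(3)[of 0 z] zc by (simp add: cycles_def)
  next
    case (Suc n)
    then have "bd D n (f k z) = f n (bd C n z)"
      using fD(2)[of n z] zc by simp
    also have "bd C n z = \<one>\<^bsub>grp C n\<^esub>"
      using z Suc by (simp add: cycles_def kernel_def)
    also have "f n \<one>\<^bsub>grp C n\<^esub> = \<one>\<^bsub>grp D n\<^esub>"
      using chain_map_upto_one[OF C D f] Suc by simp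
    finally show ?thesis
      using Suc fD(3)[of k z] zc by (simp add: cycles_def kernel_def)
  qed
  have "f k (bd C k c) \<in> boundaries D k" if "c \<in> carrier (grp C (Suc k))" for c
    using fD(2)[of k c] fD(3)[of "Suc k" c] that by (simp add: boundaries_def)
  then have "f k ` boundaries C k \<subseteq> boundaries D k"
    by (auto simp: boundaries_def[of C])
  then show "homology_map k D f (boundaries C k #>\<^bsub>grp C k\<^esub> z) = boundaries D k #>\<^bsub>grp D k\<^esub> f k z"
    unfolding homology_map_def
    by (intro coset_map_r_coset additive_cpxD subgroup_boundaries C D fD(1) zc) auto
qed

lemma homology_map_carrier:
  assumes "additive_cpx C" "additive_cpx D" "chain_map_upto (Suc k) C D f" "x \<in> carrier (homology k C)"
  shows "homology_map k D f x \<in> carrier (homology k D)"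
  using assms(4) homology_map_class[OF assms(1-3)] chain_map_cycle[OF assms(1-3)]
  unfolding carrier_homology by auto

lemma homology_map_boundaries:
  assumes "additive_cpx C" "additive_cpx D" "chain_map_upto (Suc k) C D f"
  shows "homology_map k D f (boundaries C k) = boundaries D k"
  using homology_map_class[OF assms one_in_cycles[OF assms(1)]] chain_map_upto_one[OF assms, of k]
  by (simp add: boundaries_r_coset_one assms(1,2))

lemma homology_map_comp:
  assumes "additive_cpx C" "additive_cpx D" "additive_cpx E"
    and f: "chain_map_upto (Suc k) C D f" and g: "chain_map_upto (Suc k) D E g"
    and x: "x \<in> carrier (homology k C)"
    and h: "\<And>z. z \<in> carrier (grp C k) \<Longrightarrow> h k z = g k (f k z)"
  shows "homology_map k E g (homology_map k D f x) = homology_map k E h x"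
proof -
  obtain z where z: "z \<in> cycles C k" "x = boundaries C k #>\<^bsub>grp C k\<^esub> z"
    using x by (auto simp: carrier_homology)
  have "homology_map k E g (homology_map k D f x) = homology_map k E (\<lambda>n x. g n (f n x)) x"
    using z homology_map_class[OF assms(1,2) f] homology_map_class[OF assms(2,3) g]
      homology_map_class[OF assms(1,3) chain_map_upto_comp[OF f g]] chain_map_cycle[OF assms(1,2) f]
    by simp
  also have "\<dots> = homology_map k E h x"
    by (rule homology_map_cong[OF assms(1) x]) (simp add: h)
  finally show ?thesis .
qed

lemma homology_map_trivial:
  assumes "additive_cpx C" "additive_cpx D" "x \<in> carrier (homology k C)"
    and f: "\<And>z. z \<in> carrier (grp C k) \<Longrightarrow> f k z = \<one>\<^bsub>grp D k\<^esub>"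
  shows "homology_map k D f x = boundaries D k"
  unfolding homology_map_def
proof (rule coset_map_eq_one[OF additive_cpxD(2)[OF assms(1)] additive_cpxD(2)[OF assms(2)]
      subgroup_boundaries[OF assms(1)] subgroup_boundaries[OF assms(2)]])
  show "f k z \<in> boundaries D k" if "z \<in> carrier (grp C k)" for z
    using f[OF that] subgroup.one_closed[OF subgroup_boundaries[OF assms(2)]] by simp
  show "x \<in> carrier (grp C k Mod boundaries C k)"
    using assms(3) subsetD[OF cycles_subset[of C k]] by (auto simp: carrier_homology carrier_FactGroup)
qed

section \<open>Direct sums of complexes\<close>

lemma comm_group_sum_group:
  assumes "\<And>i. i \<in> I \<Longrightarrow> comm_group (G i)"
  shows "comm_group (sum_group I G)"
proof (rule group.group_comm_groupI)
  have grp: "group (G i)" if "i \<in> I" for i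
    by (rule comm_group.axioms(2)[OF assms[OF that]])
  then show "group (sum_group I G)" by simp
  show "x \<otimes>\<^bsub>sum_group I G\<^esub> y = y \<otimes>\<^bsub>sum_group I G\<^esub> x"
    if "x \<in> carrier (sum_group I G)" "y \<in> carrier (sum_group I G)" for x y
    using that assms
    by (auto simp: carrier_sum_group[OF grp] PiE_iff comm_group_def comm_monoid.m_comm intro!: restrict_ext)
qed

lemma sum_group_component:
  assumes "\<And>i. i \<in> I \<Longrightarrow> group (G i)" "i \<in> I"
  shows "(\<lambda>x. x i) \<in> hom (sum_group I G) (G i)"
  using assms(2) by (intro homI) (auto simp: carrier_sum_group[OF assms(1)])

lemma sum_group_map_hom:
  assumes G: "\<And>i. i \<in> I \<Longrightarrow> group (G i)" and H: "\<And>i. i \<in> I \<Longrightarrow> group (H i)"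
    and f: "\<And>i. i \<in> I \<Longrightarrow> f i \<in> hom (G i) (H i)"
  shows "(\<lambda>x. \<lambda>i\<in>I. f i (x i)) \<in> hom (sum_group I G) (sum_group I H)"
proof (rule homI)
  fix x assume x: "x \<in> carrier (sum_group I G)"
  have "{i \<in> I. f i (x i) \<noteq> \<one>\<^bsub>H i\<^esub>} \<subseteq> {i \<in> I. x i \<noteq> \<one>\<^bsub>G i\<^esub>}"
    using hom_one[OF f G H] by auto
  then have "finite {i \<in> I. f i (x i) \<noteq> \<one>\<^bsub>H i\<^esub>}"
    using x by (auto simp: carrier_sum_group[OF G] intro: finite_subset)
  then show "(\<lambda>i\<in>I. f i (x i)) \<in> carrier (sum_group I H)"
    using x by (auto simp: carrier_sum_group[OF G] carrier_sum_group[OF H] hom_in_carrier[OF f] PiE_iff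
        cong: conj_cong)
next
  fix x y assume "x \<in> carrier (sum_group I G)" "y \<in> carrier (sum_group I G)"
  then show "(\<lambda>i\<in>I. f i ((x \<otimes>\<^bsub>sum_group I G\<^esub> y) i))
      = (\<lambda>i\<in>I. f i (x i)) \<otimes>\<^bsub>sum_group I H\<^esub> (\<lambda>i\<in>I. f i (y i))"
    by (auto simp: carrier_sum_group[OF G] PiE_iff hom_mult[OF f] intro!: restrict_ext)
qed

lemma grp_dsum: "grp (dsum_cpx I C) n = sum_group I (\<lambda>i. grp (C i) n)"
  and bd_dsum: "bd (dsum_cpx I C) n x = (\<lambda>i\<in>I. bd (C i) n (x i))"
  by (simp_all add: dsum_cpx_def)

lemma carrier_dsum:
  assumes "\<And>i. i \<in> I \<Longrightarrow> additive_cpx (C i)"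
  shows "carrier (grp (dsum_cpx I C) n) =
    {x \<in> \<Pi>\<^sub>E i\<in>I. carrier (grp (C i) n). finite {i \<in> I. x i \<noteq> \<one>\<^bsub>grp (C i) n\<^esub>}}"
  unfolding grp_dsum by (rule carrier_sum_group) (rule additive_cpxD(2)[OF assms])

lemma dsum_component_carrier:
  assumes "\<And>i. i \<in> I \<Longrightarrow> additive_cpx (C i)" "x \<in> carrier (grp (dsum_cpx I C) n)" "i \<in> I"
  shows "x i \<in> carrier (grp (C i) n)"
  using assms(2,3) by (auto simp: carrier_dsum[of I C, OF assms(1)])

lemma additive_cpx_dsum:
  assumes "\<And>i. i \<in> I \<Longrightarrow> additive_cpx (C i)"
  shows "additive_cpx (dsum_cpx I C)"
proof -
  have "bd (dsum_cpx I C) n \<in> hom (grp (dsum_cpx I C) (Suc n)) (grp (dsum_cpx I C) n)" for n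
    using sum_group_map_hom[OF additive_cpxD(2)[OF assms] additive_cpxD(2)[OF assms] additive_cpxD(3)[OF assms]]
    by (simp add: dsum_cpx_def)
  moreover have "comm_group (grp (dsum_cpx I C) n)" for n
    unfolding grp_dsum by (rule comm_group_sum_group) (rule additive_cpxD(1)[OF assms])
  ultimately show ?thesis
    by (simp add: additive_cpx_def)
qed

lemma dsum_incl_chain_map:
  assumes C: "\<And>i. i \<in> I \<Longrightarrow> additive_cpx (C i)" and i: "i \<in> I"
  shows "chain_map_upto m (C i) (dsum_cpx I C) (dsum_incl I C i)"
  unfolding chain_map_upto_def
proof (intro conjI allI impI ballI)
  fix n
  show "dsum_incl I C i n \<in> hom (grp (C i) n) (grp (dsum_cpx I C) n)"
  proof (rule homI)
    fix x assume x: "x \<in> carrier (grp (C i) n)"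
    have "finite {j \<in> I. (if j = i then x else \<one>\<^bsub>grp (C j) n\<^esub>) \<noteq> \<one>\<^bsub>grp (C j) n\<^esub>}"
      by (rule finite_subset[of _ "{i}"]) auto
    then show "dsum_incl I C i n x \<in> carrier (grp (dsum_cpx I C) n)"
      using x one_in_carrier_cpx[OF C]
      by (auto simp: carrier_dsum[of I C, OF C] dsum_incl_def cong: conj_cong)
  next
    fix x y
    have "\<one>\<^bsub>grp (C j) n\<^esub> \<otimes>\<^bsub>grp (C j) n\<^esub> \<one>\<^bsub>grp (C j) n\<^esub> = \<one>\<^bsub>grp (C j) n\<^esub>" if "j \<in> I" for j
      using additive_cpxD(2)[OF C[OF that]] by (simp add: group.is_monoid)
    then show "dsum_incl I C i n (x \<otimes>\<^bsub>grp (C i) n\<^esub> y)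
        = dsum_incl I C i n x \<otimes>\<^bsub>grp (dsum_cpx I C) n\<^esub> dsum_incl I C i n y"
      by (auto simp: dsum_incl_def grp_dsum intro!: restrict_ext)
  qed
  show "dsum_incl I C i n (bd (C i) n x) = bd (dsum_cpx I C) n (dsum_incl I C i (Suc n) x)" for x
    by (auto simp: dsum_incl_def bd_dsum bd_one[OF C] intro!: restrict_ext)
qed

text \<open>Elements of a direct sum have finite support, so homomorphisms out of it are compared on
  the summands.\<close>

lemma dsum_ext:
  assumes C: "\<And>i. i \<in> I \<Longrightarrow> additive_cpx (C i)" and K: "group K"
    and h: "h \<in> hom (grp (dsum_cpx I C) n) K" and h': "h' \<in> hom (grp (dsum_cpx I C) n) K"
    and eq: "\<And>i c. i \<in> I \<Longrightarrow> c \<in> carrier (grp (C i) n) \<Longrightarrow> h (dsum_incl I C i n c) = h' (dsum_incl I C i n c)"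
    and x: "x \<in> carrier (grp (dsum_cpx I C) n)"
  shows "h x = h' x"
proof -
  note D = additive_cpxD(2)[OF additive_cpx_dsum[OF C]]
  have "h x = h' x" if "finite S" "S \<subseteq> I" "x \<in> carrier (grp (dsum_cpx I C) n)"
    "{i \<in> I. x i \<noteq> \<one>\<^bsub>grp (C i) n\<^esub>} \<subseteq> S" for S x
    using that
  proof (induction S arbitrary: x rule: finite_induct)
    case empty
    then have "x \<in> extensional I" "\<And>i. i \<in> I \<Longrightarrow> x i = \<one>\<^bsub>grp (C i) n\<^esub>"
      by (auto simp: carrier_dsum[of I C, OF C] PiE_def)
    then have "x = \<one>\<^bsub>grp (dsum_cpx I C) n\<^esub>"
      by (auto simp: grp_dsum fun_eq_iff extensional_def)
    then show ?case
      using hom_one[OF h D K] hom_one[OF h' D K] by simp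
  next
    case (insert i S)
    have i: "i \<in> I" using insert by simp
    have xe: "x \<in> extensional I"
      using insert.prems(2) by (auto simp: carrier_dsum[of I C, OF C] PiE_def)
    \<comment> \<open>split off the component at \<open>i\<close>; the rest \<open>y\<close> has smaller support\<close>
    define y where "y = (\<lambda>j\<in>I. if j = i then \<one>\<^bsub>grp (C j) n\<^esub> else x j)"
    have xi: "x j \<in> carrier (grp (C j) n)" if "j \<in> I" for j
      using dsum_component_carrier[OF C insert.prems(2) that] .
    have "{j \<in> I. y j \<noteq> \<one>\<^bsub>grp (C j) n\<^esub>} \<subseteq> {j \<in> I. x j \<noteq> \<one>\<^bsub>grp (C j) n\<^esub>}"
      by (auto simp: y_def)
    then have "finite {j \<in> I. y j \<noteq> \<one>\<^bsub>grp (C j) n\<^esub>}"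
      using insert.prems by (auto simp: carrier_dsum[of I C, OF C] intro: finite_subset)
    then have y: "y \<in> carrier (grp (dsum_cpx I C) n)"
      using xi one_in_carrier_cpx[OF C] by (auto simp: carrier_dsum[of I C, OF C] y_def)
    have "{j \<in> I. y j \<noteq> \<one>\<^bsub>grp (C j) n\<^esub>} \<subseteq> S"
      using insert.prems by (auto simp: y_def)
    then have "h y = h' y"
      by (intro insert.IH) (use insert.prems y in simp_all)
    moreover have "x = dsum_incl I C i n (x i) \<otimes>\<^bsub>grp (dsum_cpx I C) n\<^esub> y"
      using xe xi additive_cpxD(2)[OF C] i
      by (auto simp: grp_dsum dsum_incl_def y_def fun_eq_iff extensional_def group.is_monoid)
    moreover have "dsum_incl I C i n (x i) \<in> carrier (grp (dsum_cpx I C) n)"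
      using chain_map_uptoD(3)[OF dsum_incl_chain_map[of I C, OF C i] order_refl xi[OF i]] .
    ultimately show ?case
      using eq[OF i xi[OF i]] y hom_mult[OF h] hom_mult[OF h'] by metis
  qed
  from this[OF _ _ x, of "{i \<in> I. x i \<noteq> \<one>\<^bsub>grp (C i) n\<^esub>}"] show ?thesis
    using x by (auto simp: carrier_dsum[of I C, OF C])
qed

lemma dsum_copair_incl:
  assumes C: "\<And>i. i \<in> I \<Longrightarrow> additive_cpx (C i)" and D: "additive_cpx D"
    and f: "\<And>i. i \<in> I \<Longrightarrow> chain_map_upto m (C i) D (f i)"
    and n: "n \<le> m" and i: "i \<in> I" and c: "c \<in> carrier (grp (C i) n)"
  shows "dsum_copair I D f n (dsum_incl I C i n c) = f i n c"
proof -
  interpret D: comm_group "grp D n" by (rule additive_cpxD(1)[OF D])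
  have fc: "f i n c \<in> carrier (grp D n)"
    by (rule chain_map_uptoD(3)[OF f[OF i] n c])
  have "gfinprod (grp D n) (\<lambda>j. f j n (dsum_incl I C i n c j)) I = gfinprod (grp D n) (\<lambda>j. f i n c) {i}"
  proof (rule D.gfinprod_mono_neutral_cong_right)
    show "(\<lambda>j. f j n (dsum_incl I C i n c j)) \<in> I \<rightarrow> carrier (grp D n)"
      using chain_map_uptoD(3)[OF f n one_in_carrier_cpx[OF C]] fc
      by (auto simp: dsum_incl_def)
  qed (use i chain_map_upto_one[OF C D f n] in \<open>auto simp: dsum_incl_def\<close>)
  also have "\<dots> = f i n c"
    using fc by (simp add: D.finprod_singleton)
  finally show ?thesis by (simp add: dsum_copair_def)
qed

lemma dsum_copair_chain_map:
  assumes C: "\<And>i. i \<in> I \<Longrightarrow> additive_cpx (C i)" and D: "additive_cpx D"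
    and f: "\<And>i. i \<in> I \<Longrightarrow> chain_map_upto m (C i) D (f i)"
  shows "chain_map_upto m (dsum_cpx I C) D (dsum_copair I D f)"
proof -
  have h: "dsum_copair I D f n \<in> hom (grp (dsum_cpx I C) n) (grp D n)" if "n \<le> m" for n
    using comm_group.hom_group_sum[OF additive_cpxD(1)[OF D] chain_map_uptoD(1)[OF f that] additive_cpxD(2)[OF C]]
    unfolding grp_dsum by (simp add: dsum_copair_def[abs_def])
  moreover have "dsum_copair I D f n (bd (dsum_cpx I C) n x) = bd D n (dsum_copair I D f (Suc n) x)"
    if n: "n < m" and x: "x \<in> carrier (grp (dsum_cpx I C) (Suc n))" for n x
  proof -
    have n': "n \<le> m" "Suc n \<le> m" using n by auto
    have "(dsum_copair I D f n \<circ> bd (dsum_cpx I C) n) x = (bd D n \<circ> dsum_copair I D f (Suc n)) x"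
    proof (rule dsum_ext[OF C _ hom_compose[OF additive_cpxD(3)[OF additive_cpx_dsum[OF C]] h[OF n'(1)]]
          hom_compose[OF h[OF n'(2)] additive_cpxD(3)[OF D]] _ x])
      fix i c assume i: "i \<in> I" and c: "c \<in> carrier (grp (C i) (Suc n))"
      have bc: "bd (C i) n c \<in> carrier (grp (C i) n)"
        by (rule hom_in_carrier[OF additive_cpxD(3)[OF C[OF i]] c])
      have "bd (dsum_cpx I C) n (dsum_incl I C i (Suc n) c) = dsum_incl I C i n (bd (C i) n c)"
        using chain_map_uptoD(2)[OF dsum_incl_chain_map[of I C, OF C i] lessI c] by simp
      then show "(dsum_copair I D f n \<circ> bd (dsum_cpx I C) n) (dsum_incl I C i (Suc n) c)
          = (bd D n \<circ> dsum_copair I D f (Suc n)) (dsum_incl I C i (Suc n) c)"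
        using dsum_copair_incl[of I C, OF C D f n'(1) i bc] dsum_copair_incl[of I C, OF C D f n'(2) i c]
          chain_map_uptoD(2)[OF f[OF i] n c] by simp
    qed (simp_all add: additive_cpxD(2)[OF D])
    then show ?thesis by simp
  qed
  ultimately show ?thesis
    by (simp add: chain_map_upto_def)
qed

lemma dsum_map_incl:
  assumes "\<And>i. i \<in> I \<Longrightarrow> additive_cpx (C i)" "\<And>i. i \<in> I \<Longrightarrow> additive_cpx (D i)"
    and "\<And>i. i \<in> I \<Longrightarrow> chain_map_upto m (C i) (D i) (f i)" "n \<le> m"
  shows "dsum_map I f n (dsum_incl I C i n c) = dsum_incl I D i n (f i n c)"
  using chain_map_upto_one[OF assms] by (auto simp: dsum_map_def dsum_incl_def intro!: restrict_ext)

lemma dsum_map_chain_map: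
  assumes C: "\<And>i. i \<in> I \<Longrightarrow> additive_cpx (C i)" and D: "\<And>i. i \<in> I \<Longrightarrow> additive_cpx (D i)"
    and f: "\<And>i. i \<in> I \<Longrightarrow> chain_map_upto m (C i) (D i) (f i)"
  shows "chain_map_upto m (dsum_cpx I C) (dsum_cpx I D) (dsum_map I f)"
  unfolding chain_map_upto_def
proof (intro conjI allI impI ballI)
  show "dsum_map I f n \<in> hom (grp (dsum_cpx I C) n) (grp (dsum_cpx I D) n)" if "n \<le> m" for n
    using sum_group_map_hom[OF additive_cpxD(2)[OF C] additive_cpxD(2)[OF D] chain_map_uptoD(1)[OF f that]]
    unfolding grp_dsum by (simp add: dsum_map_def[abs_def])
  show "dsum_map I f n (bd (dsum_cpx I C) n x) = bd (dsum_cpx I D) n (dsum_map I f (Suc n) x)"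
    if "n < m" "x \<in> carrier (grp (dsum_cpx I C) (Suc n))" for n x
    using dsum_component_carrier[OF C that(2)] chain_map_uptoD(2)[OF f that(1)]
    by (auto simp: dsum_map_def bd_dsum intro!: restrict_ext)
qed

section \<open>Tensor products of complexes\<close>

lemma hom_mult_int_pow:
  assumes "comm_group H" "group G" "f \<in> hom G H" "g \<in> hom G H"
  shows "(\<lambda>x. f x \<otimes>\<^bsub>H\<^esub> (g x [^]\<^bsub>H\<^esub> (e :: int))) \<in> hom G H"
proof -
  interpret H: comm_group H by fact
  show ?thesis
  proof (rule homI)
    fix x y assume "x \<in> carrier G" "y \<in> carrier G"
    then have c: "f x \<in> carrier H" "f y \<in> carrier H" "g x \<in> carrier H" "g y \<in> carrier H"
      using assms(3,4) by (simp_all add: hom_in_carrier)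
    show "f (x \<otimes>\<^bsub>G\<^esub> y) \<otimes>\<^bsub>H\<^esub> g (x \<otimes>\<^bsub>G\<^esub> y) [^]\<^bsub>H\<^esub> e
      = (f x \<otimes>\<^bsub>H\<^esub> g x [^]\<^bsub>H\<^esub> e) \<otimes>\<^bsub>H\<^esub> (f y \<otimes>\<^bsub>H\<^esub> g y [^]\<^bsub>H\<^esub> e)"
      using c \<open>x \<in> carrier G\<close> \<open>y \<in> carrier G\<close> assms(3,4)
      by (simp add: hom_mult H.int_pow_distrib H.m_ac)
  qed (use assms(3,4) in \<open>simp add: hom_in_carrier\<close>)
qed

lemma hom_into_finite_sum_group:
  assumes "finite I" and G: "\<And>i. i \<in> I \<Longrightarrow> group (G i)" and f: "\<And>i. i \<in> I \<Longrightarrow> f i \<in> hom K (G i)"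
  shows "(\<lambda>x. \<lambda>i\<in>I. f i x) \<in> hom K (sum_group I G)"
proof (rule homI)
  show "(\<lambda>i\<in>I. f i x) \<in> carrier (sum_group I G)" if "x \<in> carrier K" for x
    using that hom_in_carrier[OF f] \<open>finite I\<close> by (auto simp: carrier_sum_group[of I G, OF G])
  show "(\<lambda>i\<in>I. f i (x \<otimes>\<^bsub>K\<^esub> y)) = (\<lambda>i\<in>I. f i x) \<otimes>\<^bsub>sum_group I G\<^esub> (\<lambda>i\<in>I. f i y)"
    if "x \<in> carrier K" "y \<in> carrier K" for x y
    using that hom_mult[OF f] by (auto intro!: restrict_ext)
qed

lemma finite_bidegrees: "finite {(i, j). i + j = (n::nat)}"
  by (rule finite_subset[of _ "{..n} \<times> {..n}"]) auto

lemma grp_tensor: "grp (C \<boxtimes> D) n = sum_group {(i, j). i + j = n} (\<lambda>(i, j). tensor_group (grp C i) (grp D j))"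
  and bd_tensor: "bd (C \<boxtimes> D) n x = (\<lambda>(i, j)\<in>{(i, j). i + j = n}.
        tensor_hom (grp C i) (grp D j) (bd C i) (\<lambda>y. y) (x (Suc i, j))
        \<otimes>\<^bsub>tensor_group (grp C i) (grp D j)\<^esub>
        (tensor_hom (grp C i) (grp D j) (\<lambda>y. y) (bd D j) (x (i, Suc j))
           [^]\<^bsub>tensor_group (grp C i) (grp D j)\<^esub> ((-1) ^ i :: int)))"
  by (simp_all add: tensor_cpx_def)

lemma id_hom: "(\<lambda>x. x) \<in> hom G G"
  by (simp add: hom_def)

context
  fixes C :: "'a chain_cpx" and D :: "'b chain_cpx"
  assumes C: "additive_cpx C" and D: "additive_cpx D"
begin

lemma group_bidegree: "group (case p of (i, j) \<Rightarrow> tensor_group (grp C i) (grp D j))"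
  by (cases p) (simp add: group_tensor_group additive_cpxD[OF C] additive_cpxD[OF D])

lemma tensor_cpx_component:
  assumes "x \<in> carrier (grp (C \<boxtimes> D) n)" "i + j = n"
  shows "x (i, j) \<in> carrier (tensor_group (grp C i) (grp D j))"
  using assms group_bidegree unfolding grp_tensor
  by (auto simp: carrier_sum_group PiE_iff)

lemma tensor_cpx_component_hom:
  "i + j = n \<Longrightarrow> (\<lambda>x. x (i, j)) \<in> hom (grp (C \<boxtimes> D) n) (tensor_group (grp C i) (grp D j))"
  using sum_group_component[of "{(i, j). i + j = n}" "\<lambda>(i, j). tensor_group (grp C i) (grp D j)" "(i, j)",
      OF group_bidegree]
  by (simp add: grp_tensor)

lemma additive_cpx_tensor: "additive_cpx (C \<boxtimes> D)"
  unfolding additive_cpx_def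
proof (intro allI conjI)
  fix n
  note Cn = additive_cpxD[OF C] and Dn = additive_cpxD[OF D]
  show cg: "comm_group (grp (C \<boxtimes> D) n)" for n
    unfolding grp_tensor
    by (rule comm_group_sum_group) (auto simp: comm_group_tensor_group Cn Dn)
  have "(\<lambda>x. \<lambda>p\<in>{(i, j). i + j = n}. case p of (i, j) \<Rightarrow>
        tensor_hom (grp C i) (grp D j) (bd C i) (\<lambda>y. y) (x (Suc i, j))
        \<otimes>\<^bsub>tensor_group (grp C i) (grp D j)\<^esub>
        (tensor_hom (grp C i) (grp D j) (\<lambda>y. y) (bd D j) (x (i, Suc j))
           [^]\<^bsub>tensor_group (grp C i) (grp D j)\<^esub> ((-1) ^ i :: int)))
     \<in> hom (grp (C \<boxtimes> D) (Suc n)) (sum_group {(i, j). i + j = n} (\<lambda>(i, j). tensor_group (grp C i) (grp D j)))"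
  proof (rule hom_into_finite_sum_group[OF finite_bidegrees group_bidegree])
    fix p :: "nat \<times> nat" assume "p \<in> {(i, j). i + j = n}"
    then obtain i j where p: "p = (i, j)" "i + j = n" by auto
    have 1: "(\<lambda>x. tensor_hom (grp C i) (grp D j) (bd C i) (\<lambda>y. y) (x (Suc i, j)))
        \<in> hom (grp (C \<boxtimes> D) (Suc n)) (tensor_group (grp C i) (grp D j))"
      using hom_compose[OF tensor_cpx_component_hom[of "Suc i" j "Suc n"]
          tensor_hom_hom[OF Cn(2) Dn(2) Cn(2) Dn(2) Cn(3) id_hom]] p
      by (simp add: comp_def)
    have 2: "(\<lambda>x. tensor_hom (grp C i) (grp D j) (\<lambda>y. y) (bd D j) (x (i, Suc j)))
        \<in> hom (grp (C \<boxtimes> D) (Suc n)) (tensor_group (grp C i) (grp D j))"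
      using hom_compose[OF tensor_cpx_component_hom[of i "Suc j" "Suc n"]
          tensor_hom_hom[OF Cn(2) Dn(2) Cn(2) Dn(2) id_hom Dn(3)]] p
      by (simp add: comp_def)
    show "(\<lambda>x. case p of (i, j) \<Rightarrow>
        tensor_hom (grp C i) (grp D j) (bd C i) (\<lambda>y. y) (x (Suc i, j))
        \<otimes>\<^bsub>tensor_group (grp C i) (grp D j)\<^esub>
        (tensor_hom (grp C i) (grp D j) (\<lambda>y. y) (bd D j) (x (i, Suc j))
           [^]\<^bsub>tensor_group (grp C i) (grp D j)\<^esub> ((-1) ^ i :: int)))
      \<in> hom (grp (C \<boxtimes> D) (Suc n)) (case p of (i, j) \<Rightarrow> tensor_group (grp C i) (grp D j))"
      unfolding p(1) prod.case
      by (rule hom_mult_int_pow[OF comm_group_tensor_group[OF Cn(2) Dn(2)] comm_group.axioms(2)[OF cg] 1 2])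
  qed
  then show "bd (C \<boxtimes> D) n \<in> hom (grp (C \<boxtimes> D) (Suc n)) (grp (C \<boxtimes> D) n)"
    by (simp add: grp_tensor bd_tensor[abs_def])
qed

end

lemma tensor_cpx_map_chain_map:
  assumes C: "additive_cpx C" and D: "additive_cpx D" and C': "additive_cpx C'" and D': "additive_cpx D'"
    and f: "chain_map_upto m C C' f" and g: "chain_map_upto m D D' g"
  shows "chain_map_upto m (C \<boxtimes> D) (C' \<boxtimes> D') (tensor_cpx_map C' D' f g)"
  unfolding chain_map_upto_def
proof (intro conjI allI impI ballI)
  note grps = additive_cpxD(2)[OF C] additive_cpxD(2)[OF D] additive_cpxD(2)[OF C'] additive_cpxD(2)[OF D']
  note th = tensor_hom_hom[OF grps chain_map_uptoD(1)[OF f] chain_map_uptoD(1)[OF g]]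
  show "tensor_cpx_map C' D' f g n \<in> hom (grp (C \<boxtimes> D) n) (grp (C' \<boxtimes> D') n)" if "n \<le> m" for n
  proof -
    have "(\<lambda>x. \<lambda>p\<in>{(i, j). i + j = n}. (case p of (i, j) \<Rightarrow> tensor_hom (grp C' i) (grp D' j) (f i) (g j)) (x p))
        \<in> hom (grp (C \<boxtimes> D) n) (grp (C' \<boxtimes> D') n)"
      unfolding grp_tensor
      using th that
      by (intro sum_group_map_hom group_bidegree C D C' D') (auto split: prod.split)
    also have "(\<lambda>x. \<lambda>p\<in>{(i, j). i + j = n}. (case p of (i, j) \<Rightarrow> tensor_hom (grp C' i) (grp D' j) (f i) (g j)) (x p))
        = tensor_cpx_map C' D' f g n"
      by (auto simp: tensor_cpx_map_def[abs_def] fun_eq_iff)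
    finally show ?thesis .
  qed
  fix n x assume n: "n < m" and x: "x \<in> carrier (grp (C \<boxtimes> D) (Suc n))"
  have "tensor_cpx_map C' D' f g n (bd (C \<boxtimes> D) n x) (i, j) = bd (C' \<boxtimes> D') n (tensor_cpx_map C' D' f g (Suc n) x) (i, j)"
    if ij: "i + j = n" for i j
  proof -
    have m: "i \<le> m" "j \<le> m" "i < m" "j < m" "Suc i \<le> m" "Suc j \<le> m"
      using n ij by auto
    let ?T = "tensor_group (grp C i) (grp D j)" and ?T' = "tensor_group (grp C' i) (grp D' j)"
    let ?h = "tensor_hom (grp C' i) (grp D' j) (f i) (g j)"
    let ?a = "tensor_hom (grp C i) (grp D j) (bd C i) (\<lambda>y. y) (x (Suc i, j))"
    let ?b = "tensor_hom (grp C i) (grp D j) (\<lambda>y. y) (bd D j) (x (i, Suc j))"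
    have x1: "x (Suc i, j) \<in> carrier (tensor_group (grp C (Suc i)) (grp D j))"
      and x2: "x (i, Suc j) \<in> carrier (tensor_group (grp C i) (grp D (Suc j)))"
      using tensor_cpx_component[OF C D x] ij by auto
    have a: "?a \<in> carrier ?T" and b: "?b \<in> carrier ?T"
      by (rule tensor_hom_carrier[OF grps(1,2,1,2) additive_cpxD(3)[OF C] id_hom x1]
          tensor_hom_carrier[OF grps(1,2,1,2) id_hom additive_cpxD(3)[OF D] x2])+
    interpret T: group ?T by (rule group_tensor_group[OF grps(1,2)])
    interpret T': group ?T' by (rule group_tensor_group[OF grps(3,4)])
    have "?h (?a \<otimes>\<^bsub>?T\<^esub> ?b [^]\<^bsub>?T\<^esub> ((-1) ^ i :: int)) = ?h ?a \<otimes>\<^bsub>?T'\<^esub> ?h ?b [^]\<^bsub>?T'\<^esub> ((-1) ^ i :: int)"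
      using hom_mult[OF th[OF m(1,2)] a T.int_pow_closed[OF b]]
        hom_int_pow[OF th[OF m(1,2)] b T.group_axioms T'.group_axioms] by simp
    also have "?h ?a = tensor_hom (grp C' i) (grp D' j) (bd C' i) (\<lambda>y. y)
        (tensor_hom (grp C' (Suc i)) (grp D' j) (f (Suc i)) (g j) (x (Suc i, j)))"
      by (rule tensor_hom_square[OF grps(1,2,1,2,3,4,3,4) additive_cpxD(3)[OF C] id_hom
            chain_map_uptoD(1)[OF f m(1)] chain_map_uptoD(1)[OF g m(2)]
            chain_map_uptoD(1)[OF f m(5)] chain_map_uptoD(1)[OF g m(2)] additive_cpxD(3)[OF C'] id_hom _ _ x1])
        (simp_all add: chain_map_uptoD(2)[OF f m(3)])
    also have "?h ?b = tensor_hom (grp C' i) (grp D' j) (\<lambda>y. y) (bd D' j)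
        (tensor_hom (grp C' i) (grp D' (Suc j)) (f i) (g (Suc j)) (x (i, Suc j)))"
      by (rule tensor_hom_square[OF grps(1,2,1,2,3,4,3,4) id_hom additive_cpxD(3)[OF D]
            chain_map_uptoD(1)[OF f m(1)] chain_map_uptoD(1)[OF g m(2)]
            chain_map_uptoD(1)[OF f m(1)] chain_map_uptoD(1)[OF g m(6)] id_hom additive_cpxD(3)[OF D'] _ _ x2])
        (simp_all add: chain_map_uptoD(2)[OF g m(4)])
    finally show ?thesis
      using ij by (simp add: tensor_cpx_map_def bd_tensor)
  qed
  then show "tensor_cpx_map C' D' f g n (bd (C \<boxtimes> D) n x) = bd (C' \<boxtimes> D') n (tensor_cpx_map C' D' f g (Suc n) x)"
    by (auto simp: tensor_cpx_map_def bd_tensor fun_eq_iff)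
qed

lemma tensor_cpx_map_square:
  assumes cpx: "additive_cpx C" "additive_cpx D" "additive_cpx C1" "additive_cpx D1" "additive_cpx C2" "additive_cpx D2" "additive_cpx C3" "additive_cpx D3"
    and f: "chain_map_upto m C C1 f1" "chain_map_upto m D D1 g1" "chain_map_upto m C1 C3 f2" "chain_map_upto m D1 D3 g2"
      "chain_map_upto m C C2 f3" "chain_map_upto m D D2 g3" "chain_map_upto m C2 C3 f4" "chain_map_upto m D2 D3 g4"
    and eq: "\<And>n x. x \<in> carrier (grp C n) \<Longrightarrow> f2 n (f1 n x) = f4 n (f3 n x)"
      "\<And>n y. y \<in> carrier (grp D n) \<Longrightarrow> g2 n (g1 n y) = g4 n (g3 n y)"
    and n: "n \<le> m" and x: "x \<in> carrier (grp (C \<boxtimes> D) n)"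
  shows "tensor_cpx_map C3 D3 f2 g2 n (tensor_cpx_map C1 D1 f1 g1 n x) =
    tensor_cpx_map C3 D3 f4 g4 n (tensor_cpx_map C2 D2 f3 g3 n x)"
proof -
  note grps = cpx[THEN additive_cpxD(2)]
  have "tensor_hom (grp C3 i) (grp D3 j) (f2 i) (g2 j) (tensor_hom (grp C1 i) (grp D1 j) (f1 i) (g1 j) (x (i, j)))
    = tensor_hom (grp C3 i) (grp D3 j) (f4 i) (g4 j) (tensor_hom (grp C2 i) (grp D2 j) (f3 i) (g3 j) (x (i, j)))"
    if ij: "i + j = n" for i j
  proof -
    have m: "i \<le> m" "j \<le> m" using ij n by auto
    show ?thesis
      by (rule tensor_hom_square[OF grps f(1)[THEN chain_map_uptoD(1), OF m(1)]
            f(2)[THEN chain_map_uptoD(1), OF m(2)] f(3)[THEN chain_map_uptoD(1), OF m(1)]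
            f(4)[THEN chain_map_uptoD(1), OF m(2)] f(5)[THEN chain_map_uptoD(1), OF m(1)]
            f(6)[THEN chain_map_uptoD(1), OF m(2)] f(7)[THEN chain_map_uptoD(1), OF m(1)]
            f(8)[THEN chain_map_uptoD(1), OF m(2)] eq tensor_cpx_component[OF cpx(1,2) x ij]])
  qed
  then show ?thesis
    by (auto simp: tensor_cpx_map_def fun_eq_iff)
qed

section \<open>Coefficients in degree zero\<close>

lemma grp_conc_0 [simp]: "grp (conc A) 0 = A"
  and grp_conc_Suc [simp]: "grp (conc A) (Suc n) = singleton_group \<one>\<^bsub>A\<^esub>"
  and bd_conc [simp]: "bd (conc A) n = (\<lambda>x. \<one>\<^bsub>A\<^esub>)"
  by (simp_all add: conc_def)

lemma one_singleton_group [simp]: "\<one>\<^bsub>singleton_group a\<^esub> = a"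
  and mult_singleton_group [simp]: "x \<otimes>\<^bsub>singleton_group a\<^esub> y = a"
  by (simp_all add: singleton_group_def)

lemma one_grp_conc [simp]: "\<one>\<^bsub>grp (conc A) n\<^esub> = \<one>\<^bsub>A\<^esub>"
  by (cases n) simp_all

lemma additive_cpx_conc:
  assumes "comm_group A"
  shows "additive_cpx (conc A)"
proof -
  have A: "group A" using assms comm_group.axioms(2) by blast
  have "comm_group (grp (conc A) n)" for n
    using assms by (cases n) simp_all
  moreover have "bd (conc A) n \<in> hom (grp (conc A) (Suc n)) (grp (conc A) n)" for n
    using A by (cases n) (auto simp: hom_def group.is_monoid)
  ultimately show ?thesis by (simp add: additive_cpx_def)
qed

lemma conc_map_chain_map:
  assumes "group A" "group B" "f \<in> hom A B"
  shows "chain_map_upto m (conc A) (conc B) (conc_map B f)"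
proof -
  have "conc_map B f n \<in> hom (grp (conc A) n) (grp (conc B) n)" for n
    using assms(3) by (cases n) (auto simp: conc_map_def hom_def)
  then show ?thesis
    using hom_one[OF assms(3,1,2)] by (simp add: chain_map_upto_def conc_map_def)
qed

lemma group_tensor_conc:
  "additive_cpx C \<Longrightarrow> comm_group A \<Longrightarrow> group (tensor_group (grp C i) (grp (conc A) j))"
  by (intro group_tensor_group additive_cpxD additive_cpx_conc)

text \<open>The chain \<open>c \<otimes> a\<close> of degree \<open>n\<close>, for \<open>a\<close> in degree zero.\<close>

definition tensor_with :: "'a chain_cpx \<Rightarrow> 'b monoid \<Rightarrow> 'b \<Rightarrow> nat \<Rightarrow> 'a \<Rightarrow> (nat \<times> nat \<Rightarrow> (('a \<times> 'b) \<Rightarrow>\<^sub>0 int) set)"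
  where "tensor_with C A a n c = (\<lambda>(i, j)\<in>{(i, j). i + j = n}.
     if j = 0 then pure_tensor (grp C i) (grp (conc A) j) c a else \<one>\<^bsub>tensor_group (grp C i) (grp (conc A) j)\<^esub>)"

lemma tensor_with_chain_map:
  assumes C: "additive_cpx C" and A: "comm_group A" and a: "a \<in> carrier A"
  shows "chain_map_upto m C (C \<boxtimes> conc A) (tensor_with C A a)"
  unfolding chain_map_upto_def
proof (intro conjI allI impI ballI)
  have gA: "group A" using A comm_group.axioms(2) by blast
  note gC = additive_cpxD(2)[OF C] and cA = additive_cpx_conc[OF A]
  note tg = group_tensor_conc[OF C A]
  have "(\<lambda>c. pure_tensor (grp C n) A c a) \<in> hom (grp C n) (tensor_group (grp C n) A)" for n
    using a by (intro homI) (simp_all add: pure_tensor_carrier pure_tensor_mult_left[OF gC gA])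
  moreover have "(\<lambda>c. \<one>\<^bsub>tensor_group (grp C i) (grp (conc A) j)\<^esub>) \<in> hom (grp C n) (tensor_group (grp C i) (grp (conc A) j))"
    for n i j
    using group.is_monoid[OF tg[of i j]] by (intro homI) simp_all
  ultimately have "(\<lambda>c. case p of (i, j) \<Rightarrow>
      if j = 0 then pure_tensor (grp C i) (grp (conc A) j) c a else \<one>\<^bsub>tensor_group (grp C i) (grp (conc A) j)\<^esub>)
      \<in> hom (grp C n) (case p of (i, j) \<Rightarrow> tensor_group (grp C i) (grp (conc A) j))"
    if "p \<in> {(i, j). i + j = n}" for p n
    using that by (cases "snd p = 0") (auto split: prod.splits)
  from hom_into_finite_sum_group[OF finite_bidegrees group_bidegree[OF C cA] this]
  show "tensor_with C A a n \<in> hom (grp C n) (grp (C \<boxtimes> conc A) n)" for n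
    unfolding grp_tensor by (simp add: tensor_with_def[abs_def])
  fix n c assume c: "c \<in> carrier (grp C (Suc n))"
  have bc: "bd C n c \<in> carrier (grp C n)"
    by (rule hom_in_carrier[OF additive_cpxD(3)[OF C] c])
  note thD = tensor_hom_hom[OF gC additive_cpxD(2)[OF cA] gC additive_cpxD(2)[OF cA] id_hom additive_cpxD(3)[OF cA]]
  note thC = tensor_hom_hom[OF gC additive_cpxD(2)[OF cA] gC additive_cpxD(2)[OF cA] additive_cpxD(3)[OF C] id_hom]
  have one1: "tensor_hom (grp C i) (grp (conc A) j) (bd C i) (\<lambda>y. y) \<one>\<^bsub>tensor_group (grp C (Suc i)) (grp (conc A) j)\<^esub>
      = \<one>\<^bsub>tensor_group (grp C i) (grp (conc A) j)\<^esub>" for i j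
    by (rule hom_one[OF thC tg tg])
  have one2: "tensor_hom (grp C i) (grp (conc A) j) (\<lambda>y. y) (bd (conc A) j) \<one>\<^bsub>tensor_group (grp C i) (grp (conc A) (Suc j))\<^esub>
      = \<one>\<^bsub>tensor_group (grp C i) (grp (conc A) j)\<^esub>" for i j
    by (rule hom_one[OF thD tg tg])
  have "tensor_with C A a n (bd C n c) (i, j) = bd (C \<boxtimes> conc A) n (tensor_with C A a (Suc n) c) (i, j)"
    if ij: "i + j = n" for i j
  proof (cases j)
    case 0
    have p: "tensor_hom (grp C n) A (bd C n) (\<lambda>y. y) (pure_tensor (grp C (Suc n)) A c a) = pure_tensor (grp C n) A (bd C n c) a"
      by (rule tensor_hom_pure[OF gC gA gC gA additive_cpxD(3)[OF C] id_hom c a])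
    have q: "pure_tensor (grp C n) A (bd C n c) a \<in> carrier (tensor_group (grp C n) A)"
      by (rule pure_tensor_carrier[OF bc a])
    show ?thesis
      using 0 ij p q one2[of n 0] group.is_monoid[OF group_tensor_group[OF gC gA, of n]]
        group.int_pow_one[OF group_tensor_group[OF gC gA, of n]]
      by (simp add: tensor_with_def bd_tensor)
  next
    case (Suc j')
    then show ?thesis
      using ij one1[of i j] one2[of i j] group.is_monoid[OF tg[of i j]] group.int_pow_one[OF tg[of i j]]
      by (simp add: tensor_with_def bd_tensor del: bd_conc grp_conc_Suc)
  qed
  then show "tensor_with C A a n (bd C n c) = bd (C \<boxtimes> conc A) n (tensor_with C A a (Suc n) c)"
    by (auto simp: tensor_with_def bd_tensor fun_eq_iff)
qed

lemma tensor_cpx_map_tensor_with: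
  assumes C: "additive_cpx C" and A: "comm_group A" and C': "additive_cpx C'" and B: "comm_group B"
    and f: "chain_map_upto m C C' f" and g: "g \<in> hom A B" and n: "n \<le> m"
    and h: "h 0 = g" "\<And>j. h (Suc j) \<one>\<^bsub>A\<^esub> = \<one>\<^bsub>B\<^esub>"
    and c: "c \<in> carrier (grp C n)" and a: "a \<in> carrier A"
  shows "tensor_cpx_map C' (conc B) f h n (tensor_with C A a n c) = tensor_with C' B (g a) n (f n c)"
proof -
  have gA: "group A" and gB: "group B" using A B comm_group.axioms(2) by blast+
  have hh: "h j \<in> hom (grp (conc A) j) (grp (conc B) j)" for j
    using g h by (cases j) (auto simp: hom_def)
  note grps = additive_cpxD(2)[OF C] additive_cpxD(2)[OF additive_cpx_conc[OF A]] additive_cpxD(2)[OF C'] additive_cpxD(2)[OF additive_cpx_conc[OF B]]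
  have "tensor_hom (grp C' i) (grp (conc B) j) (f i) (h j) \<one>\<^bsub>tensor_group (grp C i) (grp (conc A) j)\<^esub>
      = \<one>\<^bsub>tensor_group (grp C' i) (grp (conc B) j)\<^esub>" if "i \<le> m" for i j
    by (rule hom_one[OF tensor_hom_hom[OF grps chain_map_uptoD(1)[OF f that] hh]
          group_tensor_conc[OF C A] group_tensor_conc[OF C' B]])
  moreover have "tensor_hom (grp C' n) B (f n) g (pure_tensor (grp C n) A c a) = pure_tensor (grp C' n) B (f n c) (g a)"
    by (rule tensor_hom_pure[OF grps(1) gA grps(3) gB chain_map_uptoD(1)[OF f n] g c a])
  ultimately show ?thesis
    using n by (auto simp: tensor_cpx_map_def tensor_with_def h(1) intro!: restrict_ext)
qed

text \<open>Only the bidegree \<open>(n, 0)\<close> is read: the coefficients are trivial in positive degrees, and so are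
  the other components.\<close>

definition tensor_eval :: "('a \<Rightarrow> 'b \<Rightarrow> 'c \<Rightarrow>\<^sub>0 int) \<Rightarrow> nat \<Rightarrow> (nat \<times> nat \<Rightarrow> (('a \<times> 'b) \<Rightarrow>\<^sub>0 int) set) \<Rightarrow> 'c \<Rightarrow>\<^sub>0 int" where
  "tensor_eval b n x = tensor_lift b (x (n, 0))"

lemma tensor_eval_chain_map:
  assumes C: "additive_cpx C" and A: "comm_group A" and D: "additive_cpx D"
    and T: "\<And>n. grp D n = free_Abelian_group (T n)"
    and b: "\<And>n. bilinear (grp C n) A (grp D n) b"
    and bdb: "\<And>n c a. c \<in> carrier (grp C (Suc n)) \<Longrightarrow> a \<in> carrier A \<Longrightarrow> b (bd C n c) a = bd D n (b c a)"
  shows "chain_map_upto m (C \<boxtimes> conc A) D (tensor_eval b)"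
  unfolding chain_map_upto_def
proof (intro conjI allI impI ballI)
  have gA: "group A" using A comm_group.axioms(2) by blast
  note gC = additive_cpxD(2)[OF C] and cA = additive_cpx_conc[OF A]
  have lift: "tensor_lift b \<in> hom (tensor_group (grp C n) A) (grp D n)" for n
    using tensor_lift_hom[OF gC gA] b unfolding T by blast
  have comp: "(\<lambda>x. x (n, 0)) \<in> hom (grp (C \<boxtimes> conc A) n) (tensor_group (grp C n) A)" for n
    using tensor_cpx_component_hom[OF C cA, of n 0 n] by simp
  show "tensor_eval b n \<in> hom (grp (C \<boxtimes> conc A) n) (grp D n)" for n
    using hom_compose[OF comp lift] by (simp add: tensor_eval_def[abs_def] comp_def)
  fix n x assume x: "x \<in> carrier (grp (C \<boxtimes> conc A) (Suc n))"
  let ?t = "x (Suc n, 0)"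
  have t: "?t \<in> carrier (tensor_group (grp C (Suc n)) A)"
    using hom_in_carrier[OF comp x] .
  have th: "tensor_hom (grp C n) A (bd C n) (\<lambda>y. y) \<in> hom (tensor_group (grp C (Suc n)) A) (tensor_group (grp C n) A)"
    by (rule tensor_hom_hom[OF gC gA gC gA additive_cpxD(3)[OF C] id_hom])
  have x1: "x (n, Suc 0) \<in> carrier (tensor_group (grp C n) (grp (conc A) (Suc 0)))"
    by (rule tensor_cpx_component[OF C cA x]) simp
  have "tensor_hom (grp C n) A (\<lambda>y. y) (\<lambda>y. \<one>\<^bsub>A\<^esub>) (x (n, Suc 0)) = \<one>\<^bsub>tensor_group (grp C n) A\<^esub>"
    by (rule tensor_hom_one_right[OF gC additive_cpxD(2)[OF cA] gC gA id_hom x1])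
  then have "bd (C \<boxtimes> conc A) n x (n, 0) = tensor_hom (grp C n) A (bd C n) (\<lambda>y. y) ?t"
    using hom_in_carrier[OF th t] group_tensor_group[OF gC gA, of n]
    by (simp add: bd_tensor group.int_pow_one group.is_monoid)
  moreover have "tensor_lift b (tensor_hom (grp C n) A (bd C n) (\<lambda>y. y) ?t) = bd D n (tensor_lift b ?t)"
  proof -
    have "(tensor_lift b \<circ> tensor_hom (grp C n) A (bd C n) (\<lambda>y. y)) ?t = (bd D n \<circ> tensor_lift b) ?t"
    proof (rule tensor_hom_ext[OF gC gA additive_cpxD(2)[OF D] hom_compose[OF th lift]
          hom_compose[OF lift additive_cpxD(3)[OF D]] _ t])
      fix c a assume ca: "c \<in> carrier (grp C (Suc n))" "a \<in> carrier A"
      note lp = tensor_lift_pure[OF gC gA b[unfolded T]]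
      show "(tensor_lift b \<circ> tensor_hom (grp C n) A (bd C n) (\<lambda>y. y)) (pure_tensor (grp C (Suc n)) A c a)
          = (bd D n \<circ> tensor_lift b) (pure_tensor (grp C (Suc n)) A c a)"
        using ca bdb lp[OF ca] lp[OF hom_in_carrier[OF additive_cpxD(3)[OF C] ca(1)] ca(2)]
        by (simp add: tensor_hom_pure[OF gC gA gC gA additive_cpxD(3)[OF C] id_hom ca])
    qed
    then show ?thesis by simp
  qed
  ultimately show "tensor_eval b n (bd (C \<boxtimes> conc A) n x) = bd D n (tensor_eval b (Suc n) x)"
    by (simp add: tensor_eval_def)
qed

lemma tensor_eval_tensor_with:
  assumes "additive_cpx C" "comm_group A" "bilinear (grp C n) A (free_Abelian_group T) b"
    "c \<in> carrier (grp C n)" "a \<in> carrier A"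
  shows "tensor_eval b n (tensor_with C A a n c) = b c a"
  using tensor_lift_pure[OF additive_cpxD(2)[OF assms(1)] comm_group.axioms(2)[OF assms(2)] assms(3-5)]
  by (simp add: tensor_eval_def tensor_with_def)

section \<open>Coequalisers\<close>

lemma hom_diff:
  assumes "group G" "comm_group H" "f \<in> hom G H" "g \<in> hom G H"
  shows "(\<lambda>x. f x \<otimes>\<^bsub>H\<^esub> inv\<^bsub>H\<^esub> g x) \<in> hom G H"
proof -
  interpret H: comm_group H by fact
  show ?thesis
    using assms(3,4)
    by (intro homI) (simp_all add: hom_in_carrier hom_mult H.inv_mult H.m_ac)
qed

context
  fixes C :: "'a chain_cpx" and D :: "'b chain_cpx" and f g :: "nat \<Rightarrow> 'a \<Rightarrow> 'b"
  assumes C: "additive_cpx C" and D: "additive_cpx D"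
    and f: "\<And>m. chain_map_upto m C D f" and g: "\<And>m. chain_map_upto m C D g"
begin

lemma subgroup_diff_image: "subgroup (diff_image C D f g n) (grp D n)"
  unfolding diff_image_def
  by (intro subgroup_hom_image hom_diff additive_cpxD[OF C] additive_cpxD[OF D]
      chain_map_uptoD(1)[OF f order_refl] chain_map_uptoD(1)[OF g order_refl])

lemma normal_diff_image: "diff_image C D f g n \<lhd> grp D n"
  by (rule comm_group_normal[OF additive_cpxD(1)[OF D] subgroup_diff_image])

lemma bd_diff_image: "bd D n ` diff_image C D f g (Suc n) \<subseteq> diff_image C D f g n"
proof clarify
  fix y assume "y \<in> diff_image C D f g (Suc n)"
  then obtain x where x: "x \<in> carrier (grp C (Suc n))"
    and y: "y = f (Suc n) x \<otimes>\<^bsub>grp D (Suc n)\<^esub> inv\<^bsub>grp D (Suc n)\<^esub> g (Suc n) x"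
    by (auto simp: diff_image_def)
  interpret D0: group "grp D n" by (rule additive_cpxD(2)[OF D])
  interpret D1: group "grp D (Suc n)" by (rule additive_cpxD(2)[OF D])
  interpret bd: group_hom "grp D (Suc n)" "grp D n" "bd D n"
    by unfold_locales (rule additive_cpxD(3)[OF D])
  have fx: "f (Suc n) x \<in> carrier (grp D (Suc n))" and gx: "g (Suc n) x \<in> carrier (grp D (Suc n))"
    using chain_map_uptoD(3)[OF f order_refl x] chain_map_uptoD(3)[OF g order_refl x] .
  have "bd D n y = f n (bd C n x) \<otimes>\<^bsub>grp D n\<^esub> inv\<^bsub>grp D n\<^esub> g n (bd C n x)"
    using fx gx chain_map_uptoD(2)[OF f lessI x] chain_map_uptoD(2)[OF g lessI x] by (simp add: y)
  then show "bd D n y \<in> diff_image C D f g n"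
    using hom_in_carrier[OF additive_cpxD(3)[OF C] x] by (auto simp: diff_image_def)
qed

lemma grp_coequaliser: "grp (coequaliser C D f g) n = grp D n Mod diff_image C D f g n"
  and bd_coequaliser: "bd (coequaliser C D f g) n =
    coset_map (grp D n) (diff_image C D f g n) (bd D n)"
  by (simp_all add: coequaliser_def)

lemma additive_cpx_coequaliser: "additive_cpx (coequaliser C D f g)"
proof -
  have "bd (coequaliser C D f g) n \<in> hom (grp (coequaliser C D f g) (Suc n)) (grp (coequaliser C D f g) n)" for n
    unfolding grp_coequaliser bd_coequaliser
    by (intro coset_map_hom normal_diff_image additive_cpxD[OF D] bd_diff_image)
  moreover have "comm_group (grp (coequaliser C D f g) n)" for n
    unfolding grp_coequaliser
    by (intro comm_group.abelian_FactGroup additive_cpxD[OF D] subgroup_diff_image)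
  ultimately show ?thesis by (simp add: additive_cpx_def)
qed

lemma coequaliser_proj_chain_map:
  "chain_map_upto m D (coequaliser C D f g) (\<lambda>n x. diff_image C D f g n #>\<^bsub>grp D n\<^esub> x)"
  unfolding chain_map_upto_def
proof (intro conjI allI impI ballI)
  show "(\<lambda>x. diff_image C D f g n #>\<^bsub>grp D n\<^esub> x) \<in> hom (grp D n) (grp (coequaliser C D f g) n)" for n
    unfolding grp_coequaliser by (rule normal.r_coset_hom_Mod[OF normal_diff_image])
  show "diff_image C D f g n #>\<^bsub>grp D n\<^esub> bd D n x
      = bd (coequaliser C D f g) n (diff_image C D f g (Suc n) #>\<^bsub>grp D (Suc n)\<^esub> x)"
    if "x \<in> carrier (grp D (Suc n))" for n x
    unfolding bd_coequaliser
    by (rule coset_map_r_coset[symmetric, OF additive_cpxD(2)[OF D] additive_cpxD(2)[OF D] subgroup_diff_image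
          subgroup_diff_image additive_cpxD(3)[OF D] bd_diff_image that])
qed

lemma carrier_coequaliser:
  "carrier (grp (coequaliser C D f g) n) = (\<lambda>x. diff_image C D f g n #>\<^bsub>grp D n\<^esub> x) ` carrier (grp D n)"
  by (simp add: grp_coequaliser carrier_FactGroup)

text \<open>The two values differ by an element of the subgroup that is divided out.\<close>

lemma coequaliser_relation:
  assumes x: "x \<in> carrier (grp C n)"
  shows "diff_image C D f g n #>\<^bsub>grp D n\<^esub> f n x = diff_image C D f g n #>\<^bsub>grp D n\<^esub> g n x"
proof -
  interpret D: group "grp D n" by (rule additive_cpxD(2)[OF D])
  have fx: "f n x \<in> carrier (grp D n)" and gx: "g n x \<in> carrier (grp D n)"
    using chain_map_uptoD(3)[OF f order_refl x] chain_map_uptoD(3)[OF g order_refl x] .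
  have "f n x \<otimes>\<^bsub>grp D n\<^esub> inv\<^bsub>grp D n\<^esub> g n x \<in> diff_image C D f g n"
    using x by (auto simp: diff_image_def)
  from r_coset_mult_left[OF D.group_axioms subgroup_diff_image this gx]
  show ?thesis
    using fx gx by (simp add: D.m_assoc)
qed

lemma
  assumes E: "additive_cpx E" and h: "\<And>m. chain_map_upto m D E h"
    and hfg: "\<And>n x. x \<in> carrier (grp C n) \<Longrightarrow> h n (f n x) = h n (g n x)"
  shows coequaliser_lift_chain_map: "chain_map_upto m (coequaliser C D f g) E (\<lambda>n. quotient_lift (h n))"
    and coequaliser_lift_proj: "y \<in> carrier (grp D n) \<Longrightarrow>
      quotient_lift (h n) (diff_image C D f g n #>\<^bsub>grp D n\<^esub> y) = h n y"
proof -
  have ker: "h n ` diff_image C D f g n \<subseteq> {\<one>\<^bsub>grp E n\<^esub>}" for n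
  proof clarify
    fix y assume "y \<in> diff_image C D f g n"
    then obtain x where x: "x \<in> carrier (grp C n)"
      and y: "y = f n x \<otimes>\<^bsub>grp D n\<^esub> inv\<^bsub>grp D n\<^esub> g n x"
      by (auto simp: diff_image_def)
    interpret h: group_hom "grp D n" "grp E n" "h n"
      by (intro group_hom.intro group_hom_axioms.intro additive_cpxD[OF D] additive_cpxD[OF E] chain_map_uptoD(1)[OF h order_refl])
    have fx: "f n x \<in> carrier (grp D n)" and gx: "g n x \<in> carrier (grp D n)"
      using chain_map_uptoD(3)[OF f order_refl x] chain_map_uptoD(3)[OF g order_refl x] .
    then show "h n y = \<one>\<^bsub>grp E n\<^esub>"
      by (simp add: y hfg[OF x])
  qed
  have lift: "quotient_lift (h n) (diff_image C D f g n #>\<^bsub>grp D n\<^esub> y) = h n y"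
    if "y \<in> carrier (grp D n)" for n y
    by (rule quotient_lift_r_coset[OF additive_cpxD(2)[OF D] additive_cpxD(2)[OF E] subgroup_diff_image
          chain_map_uptoD(1)[OF h order_refl] ker that])
  then show "y \<in> carrier (grp D n) \<Longrightarrow>
      quotient_lift (h n) (diff_image C D f g n #>\<^bsub>grp D n\<^esub> y) = h n y" .
  show "chain_map_upto m (coequaliser C D f g) E (\<lambda>n. quotient_lift (h n))"
    unfolding chain_map_upto_def
  proof (intro conjI allI impI ballI)
    show "quotient_lift (h n) \<in> hom (grp (coequaliser C D f g) n) (grp E n)" for n
      unfolding grp_coequaliser
      by (rule quotient_lift_hom[OF additive_cpxD(2)[OF D] additive_cpxD(2)[OF E] normal_diff_image
            chain_map_uptoD(1)[OF h order_refl] ker])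
    fix n x assume "x \<in> carrier (grp (coequaliser C D f g) (Suc n))"
    then obtain y where y: "y \<in> carrier (grp D (Suc n))"
      and x: "x = diff_image C D f g (Suc n) #>\<^bsub>grp D (Suc n)\<^esub> y"
      unfolding carrier_coequaliser by auto
    show "quotient_lift (h n) (bd (coequaliser C D f g) n x) = bd E n (quotient_lift (h (Suc n)) x)"
      using lift[OF y] lift[OF hom_in_carrier[OF additive_cpxD(3)[OF D] y]]
        chain_map_uptoD(2)[OF coequaliser_proj_chain_map lessI y, symmetric] chain_map_uptoD(2)[OF h lessI y]
      by (simp add: x)
  qed
qed

lemma
  assumes C': "additive_cpx C'" and D': "additive_cpx D'"
    and f': "\<And>m. chain_map_upto m C' D' f'" and g': "\<And>m. chain_map_upto m C' D' g'"
    and e: "\<And>m. chain_map_upto m C C' e" and h: "\<And>m. chain_map_upto m D D' h"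
    and he: "\<And>n x. x \<in> carrier (grp C n) \<Longrightarrow> h n (f n x) = f' n (e n x)"
      "\<And>n x. x \<in> carrier (grp C n) \<Longrightarrow> h n (g n x) = g' n (e n x)"
    and N': "\<And>n. subgroup (diff_image C' D' f' g' n) (grp D' n)"
    and proj': "\<And>m. chain_map_upto m D' (coequaliser C' D' f' g') (\<lambda>n x. diff_image C' D' f' g' n #>\<^bsub>grp D' n\<^esub> x)"
  shows coequaliser_map_chain_map: "chain_map_upto m (coequaliser C D f g) (coequaliser C' D' f' g')
      (\<lambda>n. coset_map (grp D' n) (diff_image C' D' f' g' n) (h n))"
    and coequaliser_map_proj: "y \<in> carrier (grp D n) \<Longrightarrow>
      coset_map (grp D' n) (diff_image C' D' f' g' n) (h n) (diff_image C D f g n #>\<^bsub>grp D n\<^esub> y)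
        = diff_image C' D' f' g' n #>\<^bsub>grp D' n\<^esub> h n y"
proof -
  have img: "h n ` diff_image C D f g n \<subseteq> diff_image C' D' f' g' n" for n
  proof clarify
    fix y assume "y \<in> diff_image C D f g n"
    then obtain x where x: "x \<in> carrier (grp C n)"
      and y: "y = f n x \<otimes>\<^bsub>grp D n\<^esub> inv\<^bsub>grp D n\<^esub> g n x"
      by (auto simp: diff_image_def)
    interpret h: group_hom "grp D n" "grp D' n" "h n"
      by (intro group_hom.intro group_hom_axioms.intro additive_cpxD[OF D] additive_cpxD[OF D'] chain_map_uptoD(1)[OF h order_refl])
    have "f n x \<in> carrier (grp D n)" "g n x \<in> carrier (grp D n)"
      using chain_map_uptoD(3)[OF f order_refl x] chain_map_uptoD(3)[OF g order_refl x] .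
    then have "h n y = f' n (e n x) \<otimes>\<^bsub>grp D' n\<^esub> inv\<^bsub>grp D' n\<^esub> g' n (e n x)"
      by (simp add: y he[OF x])
    then show "h n y \<in> diff_image C' D' f' g' n"
      using chain_map_uptoD(3)[OF e order_refl x] by (auto simp: diff_image_def)
  qed
  have cm: "coset_map (grp D' n) (diff_image C' D' f' g' n) (h n) (diff_image C D f g n #>\<^bsub>grp D n\<^esub> y)
        = diff_image C' D' f' g' n #>\<^bsub>grp D' n\<^esub> h n y" if "y \<in> carrier (grp D n)" for n y
    by (rule coset_map_r_coset[OF additive_cpxD(2)[OF D] additive_cpxD(2)[OF D'] subgroup_diff_image N'
          chain_map_uptoD(1)[OF h order_refl] img that])
  then show "y \<in> carrier (grp D n) \<Longrightarrow>
      coset_map (grp D' n) (diff_image C' D' f' g' n) (h n) (diff_image C D f g n #>\<^bsub>grp D n\<^esub> y)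
        = diff_image C' D' f' g' n #>\<^bsub>grp D' n\<^esub> h n y" .
  show "chain_map_upto m (coequaliser C D f g) (coequaliser C' D' f' g')
      (\<lambda>n. coset_map (grp D' n) (diff_image C' D' f' g' n) (h n))"
    unfolding chain_map_upto_def
  proof (intro conjI allI impI ballI)
    show "coset_map (grp D' n) (diff_image C' D' f' g' n) (h n)
        \<in> hom (grp (coequaliser C D f g) n) (grp (coequaliser C' D' f' g') n)" for n
      unfolding coequaliser_def chain_cpx.simps
      by (intro coset_map_hom normal_diff_image comm_group_normal N' additive_cpxD[OF D] additive_cpxD[OF D']
          chain_map_uptoD(1)[OF h order_refl] img)
    fix n x assume "x \<in> carrier (grp (coequaliser C D f g) (Suc n))"
    then obtain y where y: "y \<in> carrier (grp D (Suc n))"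
      and x: "x = diff_image C D f g (Suc n) #>\<^bsub>grp D (Suc n)\<^esub> y"
      unfolding carrier_coequaliser by auto
    have hy: "h (Suc n) y \<in> carrier (grp D' (Suc n))"
      by (rule chain_map_uptoD(3)[OF h order_refl y])
    show "coset_map (grp D' n) (diff_image C' D' f' g' n) (h n) (bd (coequaliser C D f g) n x)
        = bd (coequaliser C' D' f' g') n (coset_map (grp D' (Suc n)) (diff_image C' D' f' g' (Suc n)) (h (Suc n)) x)"
      using cm[OF y] cm[OF hom_in_carrier[OF additive_cpxD(3)[OF D] y]]
        chain_map_uptoD(2)[OF coequaliser_proj_chain_map lessI y, symmetric]
        chain_map_uptoD(2)[OF proj' lessI hy, symmetric] chain_map_uptoD(2)[OF h lessI y]
      by (simp add: x)
  qed
qed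

end

section \<open>Coends\<close>

definition ch_diagram :: "'a ch_functor \<Rightarrow> bool" where
  "ch_diagram F \<longleftrightarrow> (\<forall>l\<ge>0. additive_cpx (ob F l)) \<and>
     (\<forall>l l' m. 0 \<le> l \<and> l \<le> l' \<longrightarrow> chain_map_upto m (ob F l) (ob F l') (arr F l l'))"

definition coefficients :: "'b ab_functor \<Rightarrow> bool" where
  "coefficients A \<longleftrightarrow> (\<forall>l\<ge>0. comm_group (ob A l)) \<and>
     (\<forall>l l'. 0 \<le> l \<and> l \<le> l' \<longrightarrow> arr A l l' \<in> hom (ob A l') (ob A l))"

definition coefficient_map :: "'b ab_functor \<Rightarrow> 'b ab_functor \<Rightarrow> (real \<Rightarrow> 'b \<Rightarrow> 'b) \<Rightarrow> bool" where
  "coefficient_map A B \<alpha> \<longleftrightarrow> (\<forall>l\<ge>0. \<alpha> l \<in> hom (ob A l) (ob B l)) \<and>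
     (\<forall>l l'. 0 \<le> l \<and> l \<le> l' \<longrightarrow> (\<forall>a\<in>carrier (ob A l'). arr B l l' (\<alpha> l' a) = \<alpha> l (arr A l l' a)))"

text \<open>The legs of the universal cowedge.\<close>

definition coend_incl where
  "coend_incl F A l n x =
     diff_image (coend_source F A) (coend_target F A) (coend_left F A) (coend_right F A) n
       #>\<^bsub>grp (coend_target F A) n\<^esub> dsum_incl {0..} (\<lambda>l. ob F l \<boxtimes> conc (ob A l)) l n x"

lemma ch_diagramD:
  assumes "ch_diagram F"
  shows "0 \<le> l \<Longrightarrow> additive_cpx (ob F l)"
    and "0 \<le> l \<Longrightarrow> l \<le> l' \<Longrightarrow> chain_map_upto m (ob F l) (ob F l') (arr F l l')"
  using assms by (auto simp: ch_diagram_def)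

lemma coefficientsD:
  assumes "coefficients A"
  shows "0 \<le> l \<Longrightarrow> comm_group (ob A l)" and "0 \<le> l \<Longrightarrow> group (ob A l)"
    and "0 \<le> l \<Longrightarrow> l \<le> l' \<Longrightarrow> arr A l l' \<in> hom (ob A l') (ob A l)"
  using assms by (auto simp: coefficients_def intro: comm_group.axioms(2))

definition coend_lift ::
    "'c chain_cpx \<Rightarrow> (real \<Rightarrow> nat \<Rightarrow> 'a \<Rightarrow> 'c) \<Rightarrow> nat \<Rightarrow> (real \<Rightarrow> 'a) set \<Rightarrow> 'c" where
  "coend_lift D h n = quotient_lift (dsum_copair {0..} D h n)"

context
  fixes F :: "'a ch_functor" and A :: "'b ab_functor"
  assumes F: "ch_diagram F" and A: "coefficients A"
begin

private lemmas FD = ch_diagramD[OF F]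
private lemmas AD = coefficientsD[OF A]

lemma additive_cpx_coend_summand: "0 \<le> l \<Longrightarrow> 0 \<le> l' \<Longrightarrow> additive_cpx (ob F l \<boxtimes> conc (ob A l'))"
  by (intro additive_cpx_tensor additive_cpx_conc FD AD)

lemma additive_cpx_target_summand: "l \<in> {0..} \<Longrightarrow> additive_cpx (ob F l \<boxtimes> conc (ob A l))"
  by (simp add: additive_cpx_coend_summand)

lemma additive_cpx_source_summand: "p \<in> le_pairs \<Longrightarrow> additive_cpx (case p of (l, l') \<Rightarrow> ob F l \<boxtimes> conc (ob A l'))"
  by (auto intro: additive_cpx_coend_summand)

lemma additive_cpx_coend_target: "additive_cpx (coend_target F A)"
  unfolding coend_target_def by (rule additive_cpx_dsum) (rule additive_cpx_target_summand)

lemma additive_cpx_coend_source: "additive_cpx (coend_source F A)"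
  unfolding coend_source_def by (rule additive_cpx_dsum) (rule additive_cpx_source_summand)

lemma target_incl_chain_map:
  "0 \<le> l \<Longrightarrow> chain_map_upto m (ob F l \<boxtimes> conc (ob A l)) (coend_target F A)
     (dsum_incl {0..} (\<lambda>l. ob F l \<boxtimes> conc (ob A l)) l)"
  unfolding coend_target_def
  using dsum_incl_chain_map[of "{0..}" "\<lambda>l. ob F l \<boxtimes> conc (ob A l)" l, OF additive_cpx_target_summand] by simp

lemma left_component_chain_map:
  "0 \<le> l \<Longrightarrow> l \<le> l' \<Longrightarrow> chain_map_upto m (ob F l \<boxtimes> conc (ob A l')) (ob F l' \<boxtimes> conc (ob A l'))
     (tensor_cpx_map (ob F l') (conc (ob A l')) (arr F l l') (\<lambda>_ y. y))"
  by (intro tensor_cpx_map_chain_map FD additive_cpx_conc AD chain_map_upto_id) simp_all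

lemma right_component_chain_map:
  "0 \<le> l \<Longrightarrow> l \<le> l' \<Longrightarrow> chain_map_upto m (ob F l \<boxtimes> conc (ob A l')) (ob F l \<boxtimes> conc (ob A l))
     (tensor_cpx_map (ob F l) (conc (ob A l)) (\<lambda>_ y. y) (conc_map (ob A l) (arr A l l')))"
  by (intro tensor_cpx_map_chain_map FD additive_cpx_conc AD chain_map_upto_id
      conc_map_chain_map) simp_all

lemma left_summand_chain_map:
  assumes "p \<in> le_pairs"
  shows "chain_map_upto m (case p of (l, l') \<Rightarrow> ob F l \<boxtimes> conc (ob A l')) (coend_target F A)
    ((\<lambda>(l, l') n x. dsum_incl {0..} (\<lambda>l. ob F l \<boxtimes> conc (ob A l)) l' n
       (tensor_cpx_map (ob F l') (conc (ob A l')) (arr F l l') (\<lambda>_ y. y) n x)) p)"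
  using assms chain_map_upto_comp[OF left_component_chain_map target_incl_chain_map]
  by (auto split: prod.split)

lemma right_summand_chain_map:
  assumes "p \<in> le_pairs"
  shows "chain_map_upto m (case p of (l, l') \<Rightarrow> ob F l \<boxtimes> conc (ob A l')) (coend_target F A)
    ((\<lambda>(l, l') n x. dsum_incl {0..} (\<lambda>l. ob F l \<boxtimes> conc (ob A l)) l n
       (tensor_cpx_map (ob F l) (conc (ob A l)) (\<lambda>_ y. y)
          (conc_map (ob A l) (arr A l l')) n x)) p)"
  using assms chain_map_upto_comp[OF right_component_chain_map target_incl_chain_map]
  by (auto split: prod.split)

lemma coend_left_chain_map: "chain_map_upto m (coend_source F A) (coend_target F A) (coend_left F A)"
  unfolding coend_source_def coend_left_def
  by (rule dsum_copair_chain_map[OF additive_cpx_source_summand additive_cpx_coend_target left_summand_chain_map])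

lemma coend_right_chain_map: "chain_map_upto m (coend_source F A) (coend_target F A) (coend_right F A)"
  unfolding coend_source_def coend_right_def
  by (rule dsum_copair_chain_map[OF additive_cpx_source_summand additive_cpx_coend_target right_summand_chain_map])

lemma coend_left_incl:
  assumes "0 \<le> l" "l \<le> l'" "x \<in> carrier (grp (ob F l \<boxtimes> conc (ob A l')) n)"
  shows "coend_left F A n (dsum_incl le_pairs (\<lambda>(l, l'). ob F l \<boxtimes> conc (ob A l')) (l, l') n x) =
    dsum_incl {0..} (\<lambda>l. ob F l \<boxtimes> conc (ob A l)) l' n
      (tensor_cpx_map (ob F l') (conc (ob A l')) (arr F l l') (\<lambda>_ y. y) n x)"
  unfolding coend_left_def
  by (subst dsum_copair_incl[OF additive_cpx_source_summand additive_cpx_coend_target left_summand_chain_map order_refl])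
    (use assms in auto)

lemma coend_right_incl:
  assumes "0 \<le> l" "l \<le> l'" "x \<in> carrier (grp (ob F l \<boxtimes> conc (ob A l')) n)"
  shows "coend_right F A n (dsum_incl le_pairs (\<lambda>(l, l'). ob F l \<boxtimes> conc (ob A l')) (l, l') n x) =
    dsum_incl {0..} (\<lambda>l. ob F l \<boxtimes> conc (ob A l)) l n
      (tensor_cpx_map (ob F l) (conc (ob A l)) (\<lambda>_ y. y) (conc_map (ob A l) (arr A l l')) n x)"
  unfolding coend_right_def
  by (subst dsum_copair_incl[OF additive_cpx_source_summand additive_cpx_coend_target right_summand_chain_map order_refl])
    (use assms in auto)

lemma additive_cpx_coend: "additive_cpx (coend F A)"
  unfolding coend_def
  by (rule additive_cpx_coequaliser[OF additive_cpx_coend_source additive_cpx_coend_target coend_left_chain_map coend_right_chain_map])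

lemma coend_proj_chain_map:
  "chain_map_upto m (coend_target F A) (coend F A)
    (\<lambda>n x. diff_image (coend_source F A) (coend_target F A) (coend_left F A) (coend_right F A) n
       #>\<^bsub>grp (coend_target F A) n\<^esub> x)"
  unfolding coend_def
  by (rule coequaliser_proj_chain_map[OF additive_cpx_coend_source additive_cpx_coend_target coend_left_chain_map coend_right_chain_map])

lemma coend_incl_chain_map:
  "0 \<le> l \<Longrightarrow> chain_map_upto m (ob F l \<boxtimes> conc (ob A l)) (coend F A) (coend_incl F A l)"
  using chain_map_upto_comp[OF target_incl_chain_map coend_proj_chain_map]
  by (simp add: coend_incl_def[abs_def])

lemma source_incl_carrier:
  assumes "0 \<le> l" "l \<le> l'" "x \<in> carrier (grp (ob F l \<boxtimes> conc (ob A l')) n)"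
  shows "dsum_incl le_pairs (\<lambda>(l, l'). ob F l \<boxtimes> conc (ob A l')) (l, l') n x \<in> carrier (grp (coend_source F A) n)"
  using chain_map_uptoD(3)[OF dsum_incl_chain_map[of le_pairs "\<lambda>(l, l'). ob F l \<boxtimes> conc (ob A l')" "(l, l')",
      OF additive_cpx_source_summand] order_refl] assms
  by (simp add: coend_source_def)

lemma coend_incl_relation:
  assumes "0 \<le> l" "l \<le> l'" "x \<in> carrier (grp (ob F l \<boxtimes> conc (ob A l')) n)"
  shows "coend_incl F A l' n (tensor_cpx_map (ob F l') (conc (ob A l')) (arr F l l') (\<lambda>_ y. y) n x) =
    coend_incl F A l n
      (tensor_cpx_map (ob F l) (conc (ob A l)) (\<lambda>_ y. y) (conc_map (ob A l) (arr A l l')) n x)"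
  using coequaliser_relation[OF additive_cpx_coend_source additive_cpx_coend_target coend_left_chain_map coend_right_chain_map
      source_incl_carrier[OF assms]]
  by (simp add: coend_incl_def coend_left_incl[OF assms] coend_right_incl[OF assms])

text \<open>The coend relation on pure tensors. It moves \<open>c\<close> from \<open>l\<close> to \<open>l'\<close> whenever its coefficient
  extends along \<open>A(l \<le> l')\<close>.\<close>

lemma coend_incl_tensor_with:
  assumes l: "0 \<le> l" "l \<le> l'" and c: "c \<in> carrier (grp (ob F l) n)" and a: "a \<in> carrier (ob A l')"
  shows "coend_incl F A l' n (tensor_with (ob F l') (ob A l') a n (arr F l l' n c)) =
    coend_incl F A l n (tensor_with (ob F l) (ob A l) (arr A l l' a) n c)"
proof -
  have l': "0 \<le> l'" using l by simp
  let ?x = "tensor_with (ob F l) (ob A l') a n c"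
  have x: "?x \<in> carrier (grp (ob F l \<boxtimes> conc (ob A l')) n)"
    by (rule chain_map_uptoD(3)[OF tensor_with_chain_map[OF FD(1)[OF l(1)] AD(1)[OF l'] a] order_refl c])
  have "tensor_cpx_map (ob F l') (conc (ob A l')) (arr F l l') (\<lambda>_ y. y) n ?x
      = tensor_with (ob F l') (ob A l') a n (arr F l l' n c)"
    by (rule tensor_cpx_map_tensor_with[OF FD(1)[OF l(1)] AD(1)[OF l'] FD(1)[OF l']
          AD(1)[OF l'] FD(2)[OF l] id_hom order_refl _ _ c a]) simp_all
  moreover have "tensor_cpx_map (ob F l) (conc (ob A l)) (\<lambda>_ y. y) (conc_map (ob A l) (arr A l l')) n ?x
      = tensor_with (ob F l) (ob A l) (arr A l l' a) n c"
    by (rule tensor_cpx_map_tensor_with[OF FD(1)[OF l(1)] AD(1)[OF l'] FD(1)[OF l(1)]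
          AD(1)[OF l(1)] chain_map_upto_id AD(3)[OF l] order_refl _ _ c a])
      (simp_all add: conc_map_def)
  ultimately show ?thesis
    using coend_incl_relation[OF l x] by simp
qed

text \<open>The universal property. The two composites out of the source of the coequaliser are compared on
  its summands, where they are the two sides of the assumed relation.\<close>

lemma
  assumes D: "additive_cpx D" and h: "\<And>l m. 0 \<le> l \<Longrightarrow> chain_map_upto m (ob F l \<boxtimes> conc (ob A l)) D (h l)"
    and rel: "\<And>l l' n x. 0 \<le> l \<Longrightarrow> l \<le> l' \<Longrightarrow> x \<in> carrier (grp (ob F l \<boxtimes> conc (ob A l')) n) \<Longrightarrow>
      h l' n (tensor_cpx_map (ob F l') (conc (ob A l')) (arr F l l') (\<lambda>_ y. y) n x) =
      h l n (tensor_cpx_map (ob F l) (conc (ob A l)) (\<lambda>_ y. y) (conc_map (ob A l) (arr A l l')) n x)"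
  shows coend_lift_chain_map: "chain_map_upto m (coend F A) D (coend_lift D h)"
    and coend_lift_incl: "0 \<le> l \<Longrightarrow> x \<in> carrier (grp (ob F l \<boxtimes> conc (ob A l)) n) \<Longrightarrow>
      coend_lift D h n (coend_incl F A l n x) = h l n x"
proof -
  have h': "l \<in> {0..} \<Longrightarrow> chain_map_upto m (ob F l \<boxtimes> conc (ob A l)) D (h l)" for l m
    using h by simp
  have cop: "chain_map_upto m (coend_target F A) D (dsum_copair {0..} D h)" for m
    unfolding coend_target_def by (rule dsum_copair_chain_map[OF additive_cpx_target_summand D h'])
  have copi: "dsum_copair {0..} D h n (dsum_incl {0..} (\<lambda>l. ob F l \<boxtimes> conc (ob A l)) l n x) = h l n x"
    if "0 \<le> l" "x \<in> carrier (grp (ob F l \<boxtimes> conc (ob A l)) n)" for l n x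
    using that by (intro dsum_copair_incl[OF additive_cpx_target_summand D h' order_refl]) simp_all
  have eq: "dsum_copair {0..} D h n (coend_left F A n x) = dsum_copair {0..} D h n (coend_right F A n x)"
    if x: "x \<in> carrier (grp (coend_source F A) n)" for n x
  proof -
    note homs = hom_compose[OF chain_map_uptoD(1)[OF coend_left_chain_map order_refl] chain_map_uptoD(1)[OF cop order_refl]]
      hom_compose[OF chain_map_uptoD(1)[OF coend_right_chain_map order_refl] chain_map_uptoD(1)[OF cop order_refl]]
    have "(dsum_copair {0..} D h n \<circ> coend_left F A n) x = (dsum_copair {0..} D h n \<circ> coend_right F A n) x"
    proof (rule dsum_ext[OF additive_cpx_source_summand additive_cpxD(2)[OF D] homs[unfolded coend_source_def] _
          x[unfolded coend_source_def]])
      fix p c assume p: "p \<in> le_pairs" and c: "c \<in> carrier (grp (case p of (l, l') \<Rightarrow> ob F l \<boxtimes> conc (ob A l')) n)"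
      then obtain l l' where l: "p = (l, l')" "0 \<le> l" "l \<le> l'" and c: "c \<in> carrier (grp (ob F l \<boxtimes> conc (ob A l')) n)"
        by auto
      then have l': "0 \<le> l'" by simp
      show "(dsum_copair {0..} D h n \<circ> coend_left F A n) (dsum_incl le_pairs (\<lambda>(l, l'). ob F l \<boxtimes> conc (ob A l')) p n c)
        = (dsum_copair {0..} D h n \<circ> coend_right F A n) (dsum_incl le_pairs (\<lambda>(l, l'). ob F l \<boxtimes> conc (ob A l')) p n c)"
        using copi[OF l' chain_map_uptoD(3)[OF left_component_chain_map[OF l(2,3)] order_refl c]]
          copi[OF l(2) chain_map_uptoD(3)[OF right_component_chain_map[OF l(2,3)] order_refl c]]
        by (simp add: l(1) coend_left_incl[OF l(2,3) c] coend_right_incl[OF l(2,3) c] rel[OF l(2,3) c])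
    qed
    then show ?thesis by simp
  qed
  note coeq = additive_cpx_coend_source additive_cpx_coend_target coend_left_chain_map coend_right_chain_map D cop
  show "chain_map_upto m (coend F A) D (coend_lift D h)"
    unfolding coend_def coend_lift_def[abs_def] by (rule coequaliser_lift_chain_map[OF coeq, OF eq])
  show "coend_lift D h n (coend_incl F A l n x) = h l n x"
    if "0 \<le> l" "x \<in> carrier (grp (ob F l \<boxtimes> conc (ob A l)) n)"
    using that copi[OF that] chain_map_uptoD(3)[OF target_incl_chain_map order_refl]
    by (simp add: coend_lift_def coend_incl_def coequaliser_lift_proj[OF coeq, OF eq])
qed

end

text \<open>The componentwise map of direct sums commutes with the left maps because \<open>\<alpha>\<close> acts on the other
  tensor factor, and with the right maps because \<open>\<alpha>\<close> is natural.\<close>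

lemma
  assumes F: "ch_diagram F" and A: "coefficients A" and B: "coefficients B" and \<alpha>: "coefficient_map A B \<alpha>"
  shows coend_map_chain_map: "chain_map_upto m (coend F A) (coend F B) (coend_map F B \<alpha>)"
    and coend_map_incl: "0 \<le> l \<Longrightarrow> x \<in> carrier (grp (ob F l \<boxtimes> conc (ob A l)) n) \<Longrightarrow>
      coend_map F B \<alpha> n (coend_incl F A l n x) =
        coend_incl F B l n (tensor_cpx_map (ob F l) (conc (ob B l)) (\<lambda>_ y. y) (conc_map (ob B l) (\<alpha> l)) n x)"
proof -
  note FD = ch_diagramD[OF F]
  note AD = coefficientsD[OF A] and BD = coefficientsD[OF B]
  have \<alpha>h: "0 \<le> l \<Longrightarrow> \<alpha> l \<in> hom (ob A l) (ob B l)" for l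
    using \<alpha> by (simp add: coefficient_map_def)
  have \<alpha>n: "0 \<le> l \<Longrightarrow> l \<le> l' \<Longrightarrow> a \<in> carrier (ob A l') \<Longrightarrow> arr B l l' (\<alpha> l' a) = \<alpha> l (arr A l l' a)" for l l' a
    using \<alpha> by (simp add: coefficient_map_def)
  have \<alpha>c: "0 \<le> l \<Longrightarrow> chain_map_upto m (conc (ob A l)) (conc (ob B l)) (conc_map (ob B l) (\<alpha> l))" for l m
    by (intro conc_map_chain_map AD BD \<alpha>h)
  define t where "t l l' = tensor_cpx_map (ob F l) (conc (ob B l')) (\<lambda>_ y. y) (conc_map (ob B l') (\<alpha> l'))" for l l'
  have tc: "0 \<le> l \<Longrightarrow> 0 \<le> l' \<Longrightarrow> chain_map_upto m (ob F l \<boxtimes> conc (ob A l')) (ob F l \<boxtimes> conc (ob B l')) (t l l')" for l l' m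
    unfolding t_def by (intro tensor_cpx_map_chain_map FD additive_cpx_conc AD BD chain_map_upto_id \<alpha>c)
  define h where "h = dsum_map {0..} (\<lambda>l. t l l)"
  define e where "e = dsum_map le_pairs (\<lambda>(l, l'). t l l')"
  have tc1: "l \<in> {0..} \<Longrightarrow> chain_map_upto m (ob F l \<boxtimes> conc (ob A l)) (ob F l \<boxtimes> conc (ob B l)) (t l l)" for l m
    using tc by simp
  have tc2: "p \<in> le_pairs \<Longrightarrow> chain_map_upto m (case p of (l, l') \<Rightarrow> ob F l \<boxtimes> conc (ob A l'))
      (case p of (l, l') \<Rightarrow> ob F l \<boxtimes> conc (ob B l')) (case p of (l, l') \<Rightarrow> t l l')" for p m
    using tc by (auto split: prod.split)
  have hc: "chain_map_upto m (coend_target F A) (coend_target F B) h" for m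
    unfolding h_def coend_target_def
    by (rule dsum_map_chain_map[OF additive_cpx_target_summand[OF F A] additive_cpx_target_summand[OF F B] tc1])
  have ec: "chain_map_upto m (coend_source F A) (coend_source F B) e" for m
    unfolding e_def coend_source_def
    by (rule dsum_map_chain_map[OF additive_cpx_source_summand[OF F A] additive_cpx_source_summand[OF F B] tc2])
  have hi: "h n (dsum_incl {0..} (\<lambda>l. ob F l \<boxtimes> conc (ob A l)) l n x) = dsum_incl {0..} (\<lambda>l. ob F l \<boxtimes> conc (ob B l)) l n (t l l n x)" for l n x
    unfolding h_def by (rule dsum_map_incl[OF additive_cpx_target_summand[OF F A] additive_cpx_target_summand[OF F B] tc1 order_refl])
  have ei: "e n (dsum_incl le_pairs (\<lambda>(l, l'). ob F l \<boxtimes> conc (ob A l')) (l, l') n x)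
      = dsum_incl le_pairs (\<lambda>(l, l'). ob F l \<boxtimes> conc (ob B l')) (l, l') n (t l l' n x)" for l l' n x
    unfolding e_def
    by (subst dsum_map_incl[OF additive_cpx_source_summand[OF F A] additive_cpx_source_summand[OF F B] tc2 order_refl]) simp_all
  have sq: "t l' l' n (tensor_cpx_map (ob F l') (conc (ob A l')) (arr F l l') (\<lambda>_ y. y) n x)
      = tensor_cpx_map (ob F l') (conc (ob B l')) (arr F l l') (\<lambda>_ y. y) n (t l l' n x)"
    "t l l n (tensor_cpx_map (ob F l) (conc (ob A l)) (\<lambda>_ y. y) (conc_map (ob A l) (arr A l l')) n x)
      = tensor_cpx_map (ob F l) (conc (ob B l)) (\<lambda>_ y. y) (conc_map (ob B l) (arr B l l')) n (t l l' n x)"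
    if l: "0 \<le> l" "l \<le> l'" and x: "x \<in> carrier (grp (ob F l \<boxtimes> conc (ob A l')) n)" for l l' n x
  proof -
    have l': "0 \<le> l'" using l by simp
    note cA = additive_cpx_conc[OF AD(1)] and cB = additive_cpx_conc[OF BD(1)]
    show "t l' l' n (tensor_cpx_map (ob F l') (conc (ob A l')) (arr F l l') (\<lambda>_ y. y) n x)
        = tensor_cpx_map (ob F l') (conc (ob B l')) (arr F l l') (\<lambda>_ y. y) n (t l l' n x)"
      unfolding t_def
      by (rule tensor_cpx_map_square[OF FD(1)[OF l(1)] cA[OF l'] FD(1)[OF l'] cA[OF l'] FD(1)[OF l(1)] cB[OF l']
            FD(1)[OF l'] cB[OF l'] FD(2)[OF l] chain_map_upto_id chain_map_upto_id \<alpha>c[OF l'] chain_map_upto_id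
            \<alpha>c[OF l'] FD(2)[OF l] chain_map_upto_id _ _ order_refl x]) simp_all
    have nat: "conc_map (ob B l) (\<alpha> l) j (conc_map (ob A l) (arr A l l') j y)
        = conc_map (ob B l) (arr B l l') j (conc_map (ob B l') (\<alpha> l') j y)"
      if "y \<in> carrier (grp (conc (ob A l')) j)" for j y
      using that \<alpha>n[OF l] by (cases j) (simp_all add: conc_map_def)
    show "t l l n (tensor_cpx_map (ob F l) (conc (ob A l)) (\<lambda>_ y. y) (conc_map (ob A l) (arr A l l')) n x)
      = tensor_cpx_map (ob F l) (conc (ob B l)) (\<lambda>_ y. y) (conc_map (ob B l) (arr B l l')) n (t l l' n x)"
      unfolding t_def
      by (rule tensor_cpx_map_square[OF FD(1)[OF l(1)] cA[OF l'] FD(1)[OF l(1)] cA[OF l(1)] FD(1)[OF l(1)] cB[OF l']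
            FD(1)[OF l(1)] cB[OF l(1)] chain_map_upto_id conc_map_chain_map[OF AD(2)[OF l'] AD(2)[OF l(1)] AD(3)[OF l]]
            chain_map_upto_id \<alpha>c[OF l(1)] chain_map_upto_id \<alpha>c[OF l'] chain_map_upto_id
            conc_map_chain_map[OF BD(2)[OF l'] BD(2)[OF l(1)] BD(3)[OF l]] _ nat order_refl x]) simp_all
  qed
  note cl = coend_left_chain_map[OF F] and cr = coend_right_chain_map[OF F]
  have he: "h n (coend_left F A n x) = coend_left F B n (e n x)" "h n (coend_right F A n x) = coend_right F B n (e n x)"
    if x: "x \<in> carrier (grp (coend_source F A) n)" for n x
  proof -
    note hA = hom_compose[OF chain_map_uptoD(1)[OF cl[OF A] order_refl[of n]] chain_map_uptoD(1)[OF hc order_refl[of n]]]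
      hom_compose[OF chain_map_uptoD(1)[OF cr[OF A] order_refl[of n]] chain_map_uptoD(1)[OF hc order_refl[of n]]]
    note hB = hom_compose[OF chain_map_uptoD(1)[OF ec order_refl[of n]] chain_map_uptoD(1)[OF cl[OF B] order_refl[of n]]]
      hom_compose[OF chain_map_uptoD(1)[OF ec order_refl[of n]] chain_map_uptoD(1)[OF cr[OF B] order_refl[of n]]]
    note ext = dsum_ext[OF additive_cpx_source_summand[OF F A] additive_cpxD(2)[OF additive_cpx_coend_target[OF F B]] _ _ _
        x[unfolded coend_source_def]]
    have gen: "h n (coend_left F A n (dsum_incl le_pairs (\<lambda>(l, l'). ob F l \<boxtimes> conc (ob A l')) p n c))
        = coend_left F B n (e n (dsum_incl le_pairs (\<lambda>(l, l'). ob F l \<boxtimes> conc (ob A l')) p n c))"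
      "h n (coend_right F A n (dsum_incl le_pairs (\<lambda>(l, l'). ob F l \<boxtimes> conc (ob A l')) p n c))
        = coend_right F B n (e n (dsum_incl le_pairs (\<lambda>(l, l'). ob F l \<boxtimes> conc (ob A l')) p n c))"
      if p: "p \<in> le_pairs" and c: "c \<in> carrier (grp (case p of (l, l') \<Rightarrow> ob F l \<boxtimes> conc (ob A l')) n)" for p c
    proof -
      obtain l l' where l: "p = (l, l')" "0 \<le> l" "l \<le> l'" and c: "c \<in> carrier (grp (ob F l \<boxtimes> conc (ob A l')) n)"
        using p c by auto
      then have l': "0 \<le> l'" by simp
      have tcc: "t l l' n c \<in> carrier (grp (ob F l \<boxtimes> conc (ob B l')) n)"
        by (rule chain_map_uptoD(3)[OF tc[OF l(2) l'] order_refl c])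
      show "h n (coend_left F A n (dsum_incl le_pairs (\<lambda>(l, l'). ob F l \<boxtimes> conc (ob A l')) p n c))
        = coend_left F B n (e n (dsum_incl le_pairs (\<lambda>(l, l'). ob F l \<boxtimes> conc (ob A l')) p n c))"
        by (simp only: l(1) coend_left_incl[OF F A l(2,3) c] ei coend_left_incl[OF F B l(2,3) tcc] hi sq(1)[OF l(2,3) c])
      show "h n (coend_right F A n (dsum_incl le_pairs (\<lambda>(l, l'). ob F l \<boxtimes> conc (ob A l')) p n c))
        = coend_right F B n (e n (dsum_incl le_pairs (\<lambda>(l, l'). ob F l \<boxtimes> conc (ob A l')) p n c))"
        by (simp only: l(1) coend_right_incl[OF F A l(2,3) c] ei coend_right_incl[OF F B l(2,3) tcc] hi sq(2)[OF l(2,3) c])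
    qed
    show "h n (coend_left F A n x) = coend_left F B n (e n x)"
    proof -
      have "(h n \<circ> coend_left F A n) x = (coend_left F B n \<circ> e n) x"
        by (rule ext[OF _ hA(1)[unfolded coend_source_def[of F A]] hB(1)[unfolded coend_source_def[of F A]]])
          (simp_all only: comp_def gen)
      then show ?thesis by simp
    qed
    show "h n (coend_right F A n x) = coend_right F B n (e n x)"
    proof -
      have "(h n \<circ> coend_right F A n) x = (coend_right F B n \<circ> e n) x"
        by (rule ext[OF _ hA(2)[unfolded coend_source_def[of F A]] hB(2)[unfolded coend_source_def[of F A]]])
          (simp_all only: comp_def gen)
      then show ?thesis by simp
    qed
  qed
  have cm: "coend_map F B \<alpha> = (\<lambda>n. coset_map (grp (coend_target F B) n)
       (diff_image (coend_source F B) (coend_target F B) (coend_left F B) (coend_right F B) n) (h n))"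
    by (simp add: fun_eq_iff coend_map_def h_def t_def)
  note coeq = additive_cpx_coend_source[OF F A] additive_cpx_coend_target[OF F A] cl[OF A] cr[OF A]
    additive_cpx_coend_source[OF F B] additive_cpx_coend_target[OF F B] cl[OF B] cr[OF B] ec hc _ _
    subgroup_diff_image[OF additive_cpx_coend_source[OF F B] additive_cpx_coend_target[OF F B] cl[OF B] cr[OF B]]
    coequaliser_proj_chain_map[OF additive_cpx_coend_source[OF F B] additive_cpx_coend_target[OF F B] cl[OF B] cr[OF B]]
  show "chain_map_upto m (coend F A) (coend F B) (coend_map F B \<alpha>)"
    unfolding coend_def cm by (rule coequaliser_map_chain_map[OF coeq]) (simp_all add: he)
  show "coend_map F B \<alpha> n (coend_incl F A l n x) =
        coend_incl F B l n (tensor_cpx_map (ob F l) (conc (ob B l)) (\<lambda>_ y. y) (conc_map (ob B l) (\<alpha> l)) n x)"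
    if "0 \<le> l" "x \<in> carrier (grp (ob F l \<boxtimes> conc (ob A l)) n)"
    using coequaliser_map_proj[OF coeq, OF he chain_map_uptoD(3)[OF target_incl_chain_map[OF F A that(1)] order_refl that(2)]]
    by (simp add: coend_incl_def cm hi t_def)
qed

lemma coend_map_tensor_with:
  assumes F: "ch_diagram F" and A: "coefficients A" and B: "coefficients B" and \<alpha>: "coefficient_map A B \<alpha>"
    and l: "0 \<le> l" and c: "c \<in> carrier (grp (ob F l) n)" and a: "a \<in> carrier (ob A l)"
  shows "coend_map F B \<alpha> n (coend_incl F A l n (tensor_with (ob F l) (ob A l) a n c)) =
    coend_incl F B l n (tensor_with (ob F l) (ob B l) (\<alpha> l a) n c)"
proof -
  note FD = ch_diagramD(1)[OF F l] and AD = coefficientsD(1)[OF A l] and BD = coefficientsD(1)[OF B l]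
  have \<alpha>l: "\<alpha> l \<in> hom (ob A l) (ob B l)"
    using \<alpha> l by (simp add: coefficient_map_def)
  have "tensor_with (ob F l) (ob A l) a n c \<in> carrier (grp (ob F l \<boxtimes> conc (ob A l)) n)"
    by (rule chain_map_uptoD(3)[OF tensor_with_chain_map[OF FD AD a] order_refl c])
  then show ?thesis
    using tensor_cpx_map_tensor_with[OF FD AD FD BD chain_map_upto_id \<alpha>l order_refl[of n], where h = "conc_map (ob B l) (\<alpha> l)" and c = c and a = a] c a
    by (simp add: coend_map_incl[OF F A B \<alpha> l] conc_map_def)
qed

text \<open>A class is represented in the direct sum, where the induced map acts on each summand by
  \<open>c \<otimes> a \<mapsto> c \<otimes> 0 = 0\<close>.\<close>

lemma coend_map_zero:
  assumes F: "ch_diagram F" and A: "coefficients A" and B: "coefficients B"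
    and \<alpha>: "\<And>l. 0 \<le> l \<Longrightarrow> \<alpha> l = (\<lambda>_. \<one>\<^bsub>ob B l\<^esub>)"
    and u: "u \<in> carrier (grp (coend F A) n)"
  shows "coend_map F B \<alpha> n u = \<one>\<^bsub>grp (coend F B) n\<^esub>"
proof -
  let ?N = "\<lambda>A. diff_image (coend_source F A) (coend_target F A) (coend_left F A) (coend_right F A) n"
  note NA = subgroup_diff_image[OF additive_cpx_coend_source[OF F A] additive_cpx_coend_target[OF F A]
      coend_left_chain_map[OF F A] coend_right_chain_map[OF F A]]
  note NB = subgroup_diff_image[OF additive_cpx_coend_source[OF F B] additive_cpx_coend_target[OF F B]
      coend_left_chain_map[OF F B] coend_right_chain_map[OF F B]]
  have "coend_map F B \<alpha> n u = ?N B"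
    unfolding coend_map_def
  proof (rule coset_map_eq_one[OF additive_cpxD(2)[OF additive_cpx_coend_target[OF F A]]
        additive_cpxD(2)[OF additive_cpx_coend_target[OF F B]] NA NB])
    show "u \<in> carrier (grp (coend_target F A) n Mod ?N A)"
      using u by (simp add: coend_def coequaliser_def)
    fix x assume x: "x \<in> carrier (grp (coend_target F A) n)"
    have "tensor_cpx_map (ob F l) (conc (ob B l)) (\<lambda>_ y. y) (conc_map (ob B l) (\<alpha> l)) n (x l)
        = \<one>\<^bsub>grp (ob F l \<boxtimes> conc (ob B l)) n\<^esub>" if l: "0 \<le> l" for l
    proof -
      note grps = additive_cpxD(2)[OF ch_diagramD(1)[OF F l]] additive_cpxD(2)[OF additive_cpx_conc[OF coefficientsD(1)[OF A l]]]
        additive_cpxD(2)[OF ch_diagramD(1)[OF F l]] additive_cpxD(2)[OF additive_cpx_conc[OF coefficientsD(1)[OF B l]]]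
      have xl: "x l \<in> carrier (grp (ob F l \<boxtimes> conc (ob A l)) n)"
        using dsum_component_carrier[of "{0..}" "\<lambda>l. ob F l \<boxtimes> conc (ob A l)", OF additive_cpx_target_summand[OF F A]] x l
        by (simp add: coend_target_def)
      have "tensor_hom (grp (ob F l) i) (grp (conc (ob B l)) j) (\<lambda>y. y) (conc_map (ob B l) (\<alpha> l) j) (x l (i, j))
          = \<one>\<^bsub>tensor_group (grp (ob F l) i) (grp (conc (ob B l)) j)\<^esub>" if "i + j = n" for i j
        using tensor_hom_one_right[OF grps id_hom tensor_cpx_component[OF ch_diagramD(1)[OF F l]
              additive_cpx_conc[OF coefficientsD(1)[OF A l]] xl that]]
        by (simp add: conc_map_def \<alpha>[OF l])
      then show ?thesis
        by (auto simp: tensor_cpx_map_def grp_tensor intro!: restrict_ext)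
    qed
    then have "dsum_map {0..} (\<lambda>l. tensor_cpx_map (ob F l) (conc (ob B l)) (\<lambda>_ y. y) (conc_map (ob B l) (\<alpha> l))) n x
        = \<one>\<^bsub>grp (coend_target F B) n\<^esub>"
      by (auto simp: dsum_map_def coend_target_def grp_dsum intro!: restrict_ext)
    then show "dsum_map {0..} (\<lambda>l. tensor_cpx_map (ob F l) (conc (ob B l)) (\<lambda>_ y. y) (conc_map (ob B l) (\<alpha> l))) n x \<in> ?N B"
      using subgroup.one_closed[OF NB] by simp
  qed
  then show ?thesis
    by (simp add: coend_def coequaliser_def)
qed

section \<open>Chains on tuples of points\<close>

lemma grp_chains [simp]: "grp (chains S) n = free_Abelian_group (simplices S n)"
  by (simp add: chains_def)

lemma additive_cpx_chains:
  assumes "\<And>n x i. x \<in> simplices S (Suc n) \<Longrightarrow> i \<le> Suc n \<Longrightarrow> face S (Suc n) i x \<in> simplices S n"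
  shows "additive_cpx (chains S)"
proof -
  have "Poly_Mapping.keys (\<Sum>i\<le>Suc n. frag_cmul ((-1) ^ i) (frag_of (face S (Suc n) i x))) \<subseteq> simplices S n"
    if "x \<in> simplices S (Suc n)" for n x
    using order_trans[OF keys_cmul, of "frag_of _"] assms that
    by (intro order_trans[OF keys_sum] UN_least) (auto simp del: minus_frag_cmul)
  then have "bd (chains S) n \<in> hom (grp (chains S) (Suc n)) (grp (chains S) n)" for n
    unfolding grp_chains by (simp only: chains_def chain_cpx.simps) (rule frag_extend_hom)
  then show ?thesis
    by (simp add: additive_cpx_def abelian_free_Abelian_group)
qed

lemma chains_incl_chain_map:
  assumes "face S = face S'" "\<And>n. n \<le> m \<Longrightarrow> simplices S n \<subseteq> simplices S' n"
  shows "chain_map_upto m (chains S) (chains S') (\<lambda>_ c. c)"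
  unfolding chain_map_upto_def
proof (intro conjI allI impI ballI)
  show "(\<lambda>c. c) \<in> hom (grp (chains S) n) (grp (chains S') n)" if "n \<le> m" for n
    using assms(2)[OF that] by (intro homI) auto
qed (simp add: chains_def assms(1))

lemma chains_map_id: "chains_map (\<lambda>_ x. x) = (\<lambda>_ c. c)"
  by (simp add: chains_map_def fun_eq_iff flip: frag_expansion)

definition path_length :: "('a \<Rightarrow> 'a \<Rightarrow> real) \<Rightarrow> 'a list \<Rightarrow> real" where
  "path_length d x = (\<Sum>i<length x - 1. d (x ! i) (x ! Suc i))"

lemma path_length_simps [simp]:
  "path_length d [] = 0" "path_length d [a] = 0"
  "path_length d (a # b # x) = d a b + path_length d (b # x)"
  by (simp_all add: path_length_def sum.lessThan_Suc_shift del: sum.lessThan_Suc)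

lemma simplices_nerve: "simplices (nerve X d \<epsilon>) n = {x. length x = Suc n \<and> set x \<subseteq> X \<and> path_length d x \<le> \<epsilon>}"
  by (auto simp: nerve_def tuple_sset_def path_length_def)

lemma simplices_vietoris:
  "simplices (vietoris X d \<epsilon>) n = {x. length x = Suc n \<and> set x \<subseteq> X \<and> (\<forall>p\<in>set x. \<forall>q\<in>set x. d p q \<le> \<epsilon>)}"
  by (auto simp: vietoris_def tuple_sset_def all_set_conv_all_nth less_Suc_eq_le)

lemma face_nerve: "face (nerve X d \<epsilon>) = (\<lambda>n i x. take i x @ drop (Suc i) x)"
  and face_vietoris: "face (vietoris X d \<epsilon>) = (\<lambda>n i x. take i x @ drop (Suc i) x)"
  by (simp_all add: nerve_def vietoris_def tuple_sset_def)

lemma set_delete_subset: "set (take i x @ drop (Suc i) x) \<subseteq> set x"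
  by (auto dest: in_set_takeD in_set_dropD)

context Metric_space
begin

lemma path_length_nonneg: "0 \<le> path_length d x"
  by (simp add: path_length_def sum_nonneg)

text \<open>Deleting an end point loses a step. Deleting an inner point replaces two steps by one, which is
  not longer by the triangle inequality.\<close>

lemma path_length_delete:
  assumes "set x \<subseteq> M"
  shows "path_length d (take i x @ drop (Suc i) x) \<le> path_length d x"
  using assms
proof (induction x arbitrary: i)
  case Nil
  then show ?case by simp
next
  case (Cons a x)
  show ?case
  proof (cases x)
    case Nil
    then show ?thesis by (cases i) simp_all
  next
    case x: (Cons b y)
    show ?thesis
    proof (cases i)
      case 0
      then show ?thesis by (simp add: x)
    next
      case (Suc j)
      show ?thesis
      proof (cases j)
        case 0
        then show ?thesis
          using Cons.prems triangle[of a b "hd y"] Suc x by (cases y) simp_all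
      next
        case j: (Suc k)
        then show ?thesis
          using Cons.IH[of j] Cons.prems Suc x by simp
      qed
    qed
  qed
qed

lemma dist_hd_le_path_length:
  "set (a # x) \<subseteq> M \<Longrightarrow> q \<in> set (a # x) \<Longrightarrow> d a q \<le> path_length d (a # x)"
proof (induction x arbitrary: a)
  case Nil
  then show ?case by simp
next
  case (Cons b x)
  show ?case
  proof (cases "q = a")
    case True
    then show ?thesis
      using Cons.prems path_length_nonneg[of "a # b # x"] by simp
  next
    case False
    then have q: "q \<in> set (b # x)" using Cons.prems by simp
    then have "d a q \<le> d a b + d b q"
      using Cons.prems by (intro triangle) auto
    then show ?thesis
      using Cons.IH[of b] q Cons.prems by simp
  qed
qed

text \<open>The part of the path between \<open>p\<close> and \<open>q\<close> is at least as long as their distance.\<close>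

lemma dist_le_path_length:
  "set x \<subseteq> M \<Longrightarrow> p \<in> set x \<Longrightarrow> q \<in> set x \<Longrightarrow> d p q \<le> path_length d x"
proof (induction x)
  case Nil
  then show ?case by simp
next
  case (Cons a x)
  show ?case
  proof (cases "p = a \<or> q = a")
    case True
    then show ?thesis
      using Cons.prems dist_hd_le_path_length[of a x p] dist_hd_le_path_length[of a x q]
      by (auto simp: commute)
  next
    case False
    then have "d p q \<le> path_length d x"
      using Cons by auto
    also have "\<dots> \<le> path_length d (a # x)"
      by (cases x) simp_all
    finally show ?thesis .
  qed
qed

lemma nerve_subset_vietoris: "l \<le> \<epsilon> \<Longrightarrow> simplices (nerve M d l) n \<subseteq> simplices (vietoris M d \<epsilon>) n"
  using dist_le_path_length by (force simp: simplices_nerve simplices_vietoris)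

lemma vietoris_subset_nerve:
  assumes "n * \<delta> \<le> \<epsilon>"
  shows "simplices (vietoris M d \<delta>) n \<subseteq> simplices (nerve M d \<epsilon>) n"
proof
  fix x assume x: "x \<in> simplices (vietoris M d \<delta>) n"
  then have "path_length d x \<le> of_nat (card {..<n}) * \<delta>"
    unfolding path_length_def by (simp only: simplices_vietoris mem_Collect_eq diff_Suc_1)
      (rule sum_bounded_above, simp)
  then show "x \<in> simplices (nerve M d \<epsilon>) n"
    using x assms by (simp add: simplices_nerve simplices_vietoris)
qed

lemma additive_cpx_nerve: "additive_cpx (chains (nerve M d \<epsilon>))"
proof (rule additive_cpx_chains)
  fix n x i assume x: "x \<in> simplices (nerve M d \<epsilon>) (Suc n)" and i: "i \<le> Suc n"
  then show "face (nerve M d \<epsilon>) (Suc n) i x \<in> simplices (nerve M d \<epsilon>) n"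
    using path_length_delete[of x i] set_delete_subset[of i x]
    by (auto simp: simplices_nerve face_nerve)
qed

lemma additive_cpx_vietoris: "additive_cpx (chains (vietoris M d \<epsilon>))"
proof (rule additive_cpx_chains)
  fix n x i assume x: "x \<in> simplices (vietoris M d \<epsilon>) (Suc n)" and i: "i \<le> Suc n"
  then show "face (vietoris M d \<epsilon>) (Suc n) i x \<in> simplices (vietoris M d \<epsilon>) n"
    using subsetD[OF set_delete_subset[of i x]]
    by (auto simp: simplices_vietoris face_vietoris simp del: set_append)
qed

lemma vietoris_incl_chain_map:
  "\<epsilon> \<le> \<epsilon>' \<Longrightarrow> chain_map_upto m (chains (vietoris M d \<epsilon>)) (chains (vietoris M d \<epsilon>')) (\<lambda>_ c. c)"
  by (rule chains_incl_chain_map) (force simp: simplices_vietoris face_vietoris)+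

text \<open>A simplex of dimension at most \<open>k + 1\<close> has at most \<open>k + 1\<close> steps, each of length at most
  \<open>\<epsilon>/(k + 1)\<close>. In higher degrees the inclusion can fail.\<close>

lemma vietoris_nerve_chain_map:
  assumes "0 < \<epsilon>"
  shows "chain_map_upto (Suc k) (chains (vietoris M d (\<epsilon> / real (Suc k)))) (chains (nerve M d \<epsilon>)) (\<lambda>_ c. c)"
proof (rule chains_incl_chain_map)
  fix n assume "n \<le> Suc k"
  then have "real n * (\<epsilon> / real (Suc k)) \<le> real (Suc k) * (\<epsilon> / real (Suc k))"
    using assms by (intro mult_right_mono) simp_all
  then show "simplices (vietoris M d (\<epsilon> / real (Suc k))) n \<subseteq> simplices (nerve M d \<epsilon>) n"
    by (intro vietoris_subset_nerve) simp
qed (simp add: face_nerve face_vietoris)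

lemma ch_diagram_CN: "ch_diagram (CN M d)"
  unfolding ch_diagram_def
proof (intro conjI allI impI)
  show "additive_cpx (ob (CN M d) l)" for l
    by (simp add: CN_def additive_cpx_nerve)
  show "chain_map_upto m (ob (CN M d) l) (ob (CN M d) l') (arr (CN M d) l l')" if "0 \<le> l \<and> l \<le> l'" for l l' m
    unfolding CN_def chains_map_id line_functor.simps
    by (rule chains_incl_chain_map) (use that in \<open>auto simp: simplices_nerve face_nerve\<close>)
qed

end

section \<open>Point and interval coefficients\<close>

lemma coefficients_A_point: "coefficients (A_point \<epsilon>)"
  by (auto simp: coefficients_def A_point_def hom_def abelian_integer_group)

lemma coefficients_A_interval: "coefficients (A_interval \<epsilon>)"
  by (auto simp: coefficients_def A_interval_def hom_def abelian_integer_group)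

lemma coefficient_map_A_interval_trans:
  "s \<le> t \<Longrightarrow> coefficient_map (A_interval s) (A_interval t) (A_interval_trans s t)"
  by (auto simp: coefficient_map_def A_interval_def A_interval_trans_def hom_def)

text \<open>The two sides agree on pure tensors. This is the condition for the evaluation to descend to a
  coend.\<close>

lemma tensor_eval_balanced:
  assumes C: "additive_cpx C" and C': "additive_cpx C'" and A: "comm_group A" and A': "comm_group A'"
    and f: "chain_map_upto m C C' f" and g: "g \<in> hom A' A"
    and b: "bilinear (grp C n) A (free_Abelian_group T) b" and b': "bilinear (grp C' n) A' (free_Abelian_group T) b"
    and eq: "\<And>c a. c \<in> carrier (grp C n) \<Longrightarrow> a \<in> carrier A' \<Longrightarrow> b (f n c) a = b c (g a)"
    and n: "n \<le> m" and x: "x \<in> carrier (grp (C \<boxtimes> conc A') n)"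
  shows "tensor_eval b n (tensor_cpx_map C' (conc A') f (\<lambda>_ y. y) n x) =
    tensor_eval b n (tensor_cpx_map C (conc A) (\<lambda>_ y. y) (conc_map A g) n x)"
proof -
  note gC = additive_cpxD(2)[OF C] and gC' = additive_cpxD(2)[OF C']
    and gA = comm_group.axioms(2)[OF A] and gA' = comm_group.axioms(2)[OF A']
  note fn = chain_map_uptoD(1)[OF f n]
  have t: "x (n, 0) \<in> carrier (tensor_group (grp C n) A')"
    using tensor_cpx_component[OF C additive_cpx_conc[OF A'] x, of n 0] by simp
  note h1 = hom_compose[OF tensor_hom_hom[OF gC gA' gC' gA' fn id_hom] tensor_lift_hom[OF gC' gA' b']]
  note h2 = hom_compose[OF tensor_hom_hom[OF gC gA' gC gA id_hom g] tensor_lift_hom[OF gC gA b]]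
  have "(tensor_lift b \<circ> tensor_hom (grp C' n) A' (f n) (\<lambda>y. y)) (x (n, 0))
      = (tensor_lift b \<circ> tensor_hom (grp C n) A (\<lambda>y. y) g) (x (n, 0))"
  proof (rule tensor_hom_ext[OF gC gA' group_free_Abelian_group h1 h2 _ t])
    fix c a assume ca: "c \<in> carrier (grp C n)" "a \<in> carrier A'"
    show "(tensor_lift b \<circ> tensor_hom (grp C' n) A' (f n) (\<lambda>y. y)) (pure_tensor (grp C n) A' c a)
        = (tensor_lift b \<circ> tensor_hom (grp C n) A (\<lambda>y. y) g) (pure_tensor (grp C n) A' c a)"
      using tensor_lift_pure[OF gC' gA' b' hom_in_carrier[OF fn ca(1)] ca(2)]
        tensor_lift_pure[OF gC gA b ca(1) hom_in_carrier[OF g ca(2)]] eq[OF ca]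
      by (simp add: tensor_hom_pure[OF gC gA' gC' gA' fn id_hom ca] tensor_hom_pure[OF gC gA' gC gA id_hom g ca])
  qed
  then show ?thesis
    by (simp add: tensor_eval_def tensor_cpx_map_def conc_map_def)
qed

context Metric_space
begin

text \<open>The chain \<open>c \<otimes> 1\<close> is placed at the right end \<open>\<epsilon>\<close> of the interval, where \<open>CN(X)(\<epsilon>)\<close> is the
  largest of the complexes with nonzero coefficient.\<close>

definition nerve_to_coend where
  "nerve_to_coend \<epsilon> n c = coend_incl (CN M d) (A_interval \<epsilon>) \<epsilon> n
     (tensor_with (chains (nerve M d \<epsilon>)) integer_group 1 n c)"

definition coend_to_vietoris where
  "coend_to_vietoris \<epsilon> = coend_lift (chains (vietoris M d \<epsilon>)) (\<lambda>l. tensor_eval (\<lambda>c a. frag_cmul a c))"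

lemma additive_cpx_blurred: "additive_cpx (coend (CN M d) (A_interval \<epsilon>))"
  by (rule additive_cpx_coend[OF ch_diagram_CN coefficients_A_interval])

lemma ob_CN: "ob (CN M d) \<epsilon> = chains (nerve M d \<epsilon>)"
  and arr_CN: "arr (CN M d) \<epsilon> \<epsilon>' = (\<lambda>_ c. c)"
  by (simp_all add: CN_def chains_map_id)

lemma ob_A_interval: "0 \<le> l \<Longrightarrow> l \<le> \<epsilon> \<Longrightarrow> ob (A_interval \<epsilon>) l = integer_group"
  by (simp add: A_interval_def)

lemma nerve_to_coend_chain_map:
  assumes "0 \<le> \<epsilon>"
  shows "chain_map_upto m (chains (nerve M d \<epsilon>)) (coend (CN M d) (A_interval \<epsilon>)) (nerve_to_coend \<epsilon>)"
proof -
  have "chain_map_upto m (chains (nerve M d \<epsilon>)) (chains (nerve M d \<epsilon>) \<boxtimes> conc integer_group)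
      (tensor_with (chains (nerve M d \<epsilon>)) integer_group 1)"
    by (rule tensor_with_chain_map[OF additive_cpx_nerve abelian_integer_group]) simp
  moreover have "chain_map_upto m (chains (nerve M d \<epsilon>) \<boxtimes> conc integer_group) (coend (CN M d) (A_interval \<epsilon>))
      (coend_incl (CN M d) (A_interval \<epsilon>) \<epsilon>)"
    using coend_incl_chain_map[OF ch_diagram_CN coefficients_A_interval assms, of m \<epsilon>] assms
    by (simp add: ob_CN ob_A_interval)
  ultimately show ?thesis
    unfolding nerve_to_coend_def[abs_def] by (rule chain_map_upto_comp)
qed

text \<open>The chain \<open>c \<otimes> 1\<close> sits at \<open>s\<close> on one side and at \<open>t\<close> on the other. With coefficients in
  \<open>A\<^bsub>[0,t]\<^esub>\<close> the coend relation identifies the two, since \<open>1\<close> extends from \<open>s\<close> to \<open>t\<close>.\<close>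

lemma nerve_to_coend_natural:
  assumes st: "0 \<le> s" "s \<le> t" and c: "c \<in> carrier (grp (chains (nerve M d s)) n)"
  shows "coend_map (CN M d) (A_interval t) (A_interval_trans s t) n (nerve_to_coend s n c) = nerve_to_coend t n c"
proof -
  have c': "c \<in> carrier (grp (ob (CN M d) s) n)"
    using c by (simp add: ob_CN)
  have "coend_map (CN M d) (A_interval t) (A_interval_trans s t) n (nerve_to_coend s n c)
      = coend_incl (CN M d) (A_interval t) s n (tensor_with (chains (nerve M d s)) integer_group 1 n c)"
    using coend_map_tensor_with[OF ch_diagram_CN coefficients_A_interval coefficients_A_interval
        coefficient_map_A_interval_trans[OF st(2)] st(1) c', of 1] st
    by (simp add: nerve_to_coend_def ob_CN ob_A_interval A_interval_trans_def)
  also have "\<dots> = nerve_to_coend t n c"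
    using coend_incl_tensor_with[OF ch_diagram_CN coefficients_A_interval st c', of 1 t] st
    by (simp add: nerve_to_coend_def ob_CN arr_CN ob_A_interval A_interval_def)
  finally show ?thesis .
qed

text \<open>For \<open>l > \<epsilon>\<close> the nerve may contain tuples that are not simplices of the Vietoris complex, but then
  the only coefficient is \<open>0\<close>.\<close>

lemma scalar_bilinear:
  "bilinear (grp (chains (nerve M d l)) n) (ob (A_interval \<epsilon>) l)
    (free_Abelian_group (simplices (vietoris M d \<epsilon>) n)) (\<lambda>c a. frag_cmul a c)"
proof -
  have "Poly_Mapping.keys (frag_cmul a c) \<subseteq> simplices (vietoris M d \<epsilon>) n"
    if c: "Poly_Mapping.keys c \<subseteq> simplices (nerve M d l) n" and a: "a \<in> carrier (ob (A_interval \<epsilon>) l)" for a c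
  proof (cases "l \<le> \<epsilon>")
    case True
    then show ?thesis
      using order_trans[OF keys_cmul order_trans[OF c nerve_subset_vietoris]] by blast
  next
    case False
    then show ?thesis using a by (simp add: A_interval_def)
  qed
  then show ?thesis
    by (auto simp: bilinear_def frag_cmul_distrib frag_cmul_distrib2 A_interval_def)
qed

text \<open>The evaluation is balanced because a transition map of the coefficients is either the identity
  or starts from the zero group. On \<open>c \<otimes> 1\<close> it gives back \<open>c\<close>, now as a chain of the Vietoris complex.\<close>

lemma
  shows coend_to_vietoris_chain_map:
      "chain_map_upto m (coend (CN M d) (A_interval \<epsilon>)) (chains (vietoris M d \<epsilon>)) (coend_to_vietoris \<epsilon>)"
    and coend_to_vietoris_nerve_to_coend: "0 \<le> \<epsilon> \<Longrightarrow> c \<in> carrier (grp (chains (nerve M d \<epsilon>)) n) \<Longrightarrow>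
      coend_to_vietoris \<epsilon> n (nerve_to_coend \<epsilon> n c) = c"
proof -
  let ?b = "\<lambda>c a. frag_cmul a c"
  have cA: "comm_group (ob (A_interval \<epsilon>) l)" if "0 \<le> l" for l
    by (rule coefficientsD(1)[OF coefficients_A_interval that])
  have ev: "chain_map_upto m (ob (CN M d) l \<boxtimes> conc (ob (A_interval \<epsilon>) l)) (chains (vietoris M d \<epsilon>)) (tensor_eval ?b)"
    if "0 \<le> l" for l m
    unfolding ob_CN
  proof (rule tensor_eval_chain_map[OF additive_cpx_nerve cA[OF that] additive_cpx_vietoris grp_chains])
    show "bilinear (grp (chains (nerve M d l)) n) (ob (A_interval \<epsilon>) l) (grp (chains (vietoris M d \<epsilon>)) n) ?b" for n
      using scalar_bilinear by simp
  qed (simp add: chains_def frag_extend_cmul face_nerve face_vietoris)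
  have rel: "tensor_eval ?b n (tensor_cpx_map (ob (CN M d) l') (conc (ob (A_interval \<epsilon>) l')) (arr (CN M d) l l') (\<lambda>_ y. y) n x) =
      tensor_eval ?b n (tensor_cpx_map (ob (CN M d) l) (conc (ob (A_interval \<epsilon>) l)) (\<lambda>_ y. y)
        (conc_map (ob (A_interval \<epsilon>) l) (arr (A_interval \<epsilon>) l l')) n x)"
    if l: "0 \<le> l" "l \<le> l'" and x: "x \<in> carrier (grp (ob (CN M d) l \<boxtimes> conc (ob (A_interval \<epsilon>) l')) n)" for l l' n x
  proof -
    have l': "0 \<le> l'" using l by simp
    have "chain_map_upto n (chains (nerve M d l)) (chains (nerve M d l')) (\<lambda>_ c. c)"
      using ch_diagramD(2)[OF ch_diagram_CN l, of n] by (simp add: ob_CN arr_CN)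
    then show ?thesis
      unfolding ob_CN arr_CN
      by (rule tensor_eval_balanced[OF additive_cpx_nerve additive_cpx_nerve cA[OF l(1)] cA[OF l'] _
            coefficientsD(3)[OF coefficients_A_interval l] scalar_bilinear scalar_bilinear _ order_refl x[unfolded ob_CN]])
        (use l in \<open>auto simp: A_interval_def split: if_splits\<close>)
  qed
  show "chain_map_upto m (coend (CN M d) (A_interval \<epsilon>)) (chains (vietoris M d \<epsilon>)) (coend_to_vietoris \<epsilon>)"
    unfolding coend_to_vietoris_def
    by (rule coend_lift_chain_map[OF ch_diagram_CN coefficients_A_interval additive_cpx_vietoris ev rel])
  show "coend_to_vietoris \<epsilon> n (nerve_to_coend \<epsilon> n c) = c"
    if e: "0 \<le> \<epsilon>" and c: "c \<in> carrier (grp (chains (nerve M d \<epsilon>)) n)"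
  proof -
    let ?x = "tensor_with (chains (nerve M d \<epsilon>)) integer_group 1 n c"
    have x: "?x \<in> carrier (grp (ob (CN M d) \<epsilon> \<boxtimes> conc (ob (A_interval \<epsilon>) \<epsilon>)) n)"
      using chain_map_uptoD(3)[OF tensor_with_chain_map[OF additive_cpx_nerve abelian_integer_group, of 1] order_refl c] e
      by (simp add: ob_CN ob_A_interval)
    have "coend_to_vietoris \<epsilon> n (nerve_to_coend \<epsilon> n c) = tensor_eval ?b n ?x"
      unfolding coend_to_vietoris_def nerve_to_coend_def
      by (rule coend_lift_incl[OF ch_diagram_CN coefficients_A_interval additive_cpx_vietoris ev rel e x])
    also have "\<dots> = c"
      using tensor_eval_tensor_with[OF additive_cpx_nerve abelian_integer_group _ c, of _ ?b 1] scalar_bilinear[of \<epsilon> n \<epsilon>] e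
      by (simp add: ob_A_interval)
    finally show ?thesis .
  qed
qed

section \<open>The limits\<close>

lemma carrier_lim_pos: "x \<in> carrier (lim_pos G) \<longleftrightarrow>
    x \<in> (\<Pi>\<^sub>E t\<in>{0<..}. carrier (ob G t)) \<and> (\<forall>s t. 0 < s \<and> s \<le> t \<longrightarrow> arr G s t (x s) = x t)"
  by (simp add: lim_pos_def)

lemma carrier_lim_vietoris: "x \<in> carrier (vietoris_homology k M d) \<longleftrightarrow>
    x \<in> (\<Pi>\<^sub>E t\<in>{0<..}. carrier (homology k (chains (vietoris M d t)))) \<and>
    (\<forall>s t. 0 < s \<and> s \<le> t \<longrightarrow> homology_map k (chains (vietoris M d t)) (\<lambda>_ c. c) (x s) = x t)"
  by (simp add: vietoris_homology_def carrier_lim_pos homology_functor_def CV_def chains_map_id)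

lemma carrier_lim_blurred: "x \<in> carrier (lim_pos (blurred_magnitude_homology k M d)) \<longleftrightarrow>
    x \<in> (\<Pi>\<^sub>E t\<in>{0<..}. carrier (homology k (coend (CN M d) (A_interval t)))) \<and>
    (\<forall>s t. 0 < s \<and> s \<le> t \<longrightarrow>
      homology_map k (coend (CN M d) (A_interval t)) (coend_map (CN M d) (A_interval t) (A_interval_trans s t)) (x s) = x t)"
  by (simp add: blurred_magnitude_homology_def carrier_lim_pos homology_functor_def coend_functor_def)

text \<open>The transition maps from \<open>A\<^sub>s\<close> to \<open>A\<^sub>t\<close> vanish for \<open>s < t\<close>, so each component of a compatible
  family, being the image of an earlier one, is zero.\<close>

lemma lim_magnitude_subset:
  "carrier (lim_pos (magnitude_homology k M d)) \<subseteq> {\<lambda>t\<in>{0<..}. boundaries (coend (CN M d) (A_point t)) k}"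
proof
  fix x assume "x \<in> carrier (lim_pos (magnitude_homology k M d))"
  then have x: "x \<in> (\<Pi>\<^sub>E t\<in>{0<..}. carrier (homology k (coend (CN M d) (A_point t))))"
    and compat: "\<And>s t. 0 < s \<Longrightarrow> s \<le> t \<Longrightarrow>
      homology_map k (coend (CN M d) (A_point t)) (coend_map (CN M d) (A_point t) (A_point_trans s t)) (x s) = x t"
    by (simp_all add: magnitude_homology_def carrier_lim_pos homology_functor_def coend_functor_def)
  have "x t = boundaries (coend (CN M d) (A_point t)) k" if t: "0 < t" for t
  proof -
    note cpx = additive_cpx_coend[OF ch_diagram_CN coefficients_A_point]
    \<comment> \<open>a positive parameter strictly below \<open>t\<close>, so that the transition map vanishes\<close>
    have "homology_map k (coend (CN M d) (A_point t)) (coend_map (CN M d) (A_point t) (A_point_trans (t / 2) t)) (x (t / 2))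
        = boundaries (coend (CN M d) (A_point t)) k"
    proof (rule homology_map_trivial[OF cpx cpx])
      show "x (t / 2) \<in> carrier (homology k (coend (CN M d) (A_point (t / 2))))"
        using x t by auto
      show "coend_map (CN M d) (A_point t) (A_point_trans (t / 2) t) k z = \<one>\<^bsub>grp (coend (CN M d) (A_point t)) k\<^esub>"
        if "z \<in> carrier (grp (coend (CN M d) (A_point (t / 2))) k)" for z
        by (rule coend_map_zero[OF ch_diagram_CN coefficients_A_point coefficients_A_point _ that])
          (use t in \<open>auto simp: A_point_trans_def A_point_def\<close>)
    qed
    then show ?thesis
      using compat[of "t / 2" t] t by simp
  qed
  then have "x = (\<lambda>t\<in>{0<..}. boundaries (coend (CN M d) (A_point t)) k)"
    using x by (auto simp: PiE_iff extensional_def fun_eq_iff)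
  then show "x \<in> {\<lambda>t\<in>{0<..}. boundaries (coend (CN M d) (A_point t)) k}" by simp
qed

text \<open>The component at \<open>t\<close> of the image of \<open>x\<close> is made from the component of \<open>x\<close> at \<open>t/(k + 1)\<close>, whose
  chains up to degree \<open>k + 1\<close> lie in the nerve at \<open>t\<close>. Mapping it on to the Vietoris complex at \<open>t\<close>
  is the transition map from \<open>t/(k + 1)\<close> to \<open>t\<close>, which by compatibility recovers \<open>x t\<close>.\<close>

lemma lim_vietoris_to_blurred:
  obtains J where "J ` carrier (vietoris_homology k M d) \<subseteq> carrier (lim_pos (blurred_magnitude_homology k M d))"
    "inj_on J (carrier (vietoris_homology k M d))"
proof -
  let ?V = "\<lambda>t. chains (vietoris M d t)" and ?B = "\<lambda>t. coend (CN M d) (A_interval t)"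
  define r where "r t = t / real (Suc k)" for t :: real
  have r: "0 < r t" "r t \<le> t" if "0 < t" for t
    using that by (auto simp: r_def field_simps)
  have r_mono: "r s \<le> r t" if "s \<le> t" for s t
    using that by (simp add: r_def divide_right_mono)
  have incl: "chain_map_upto (Suc k) (?V (r t)) (chains (nerve M d t)) (\<lambda>_ c. c)" if "0 < t" for t
    unfolding r_def by (rule vietoris_nerve_chain_map[OF that])
  have nc: "chain_map_upto (Suc k) (?V (r t)) (?B t) (nerve_to_coend t)" if "0 < t" for t
    using chain_map_upto_comp[OF incl[OF that] nerve_to_coend_chain_map] that by simp
  have in_nerve: "z \<in> carrier (grp (chains (nerve M d t)) k)" if "0 < t" "z \<in> carrier (grp (?V (r t)) k)" for t z
    using chain_map_uptoD(3)[OF incl[OF that(1)] le_SucI[OF order_refl] that(2)] .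
  define J where "J x = (\<lambda>t\<in>{0<..}. homology_map k (?B t) (nerve_to_coend t) (x (r t)))" for x
  have J_in: "J x \<in> carrier (lim_pos (blurred_magnitude_homology k M d))"
    and J_recover: "0 < t \<Longrightarrow> homology_map k (?V t) (coend_to_vietoris t) (J x t) = x t"
    if "x \<in> carrier (vietoris_homology k M d)" for x t
  proof -
    have xc: "x t \<in> carrier (homology k (?V t))" if "0 < t" for t
      using that \<open>x \<in> _\<close> by (auto simp: carrier_lim_vietoris)
    have xr: "x (r t) \<in> carrier (homology k (?V (r t)))" if "0 < t" for t
      using xc r(1)[OF that] .
    have compat: "homology_map k (?V t) (\<lambda>_ c. c) (x s) = x t" if "0 < s" "s \<le> t" for s t
      using that \<open>x \<in> _\<close> by (auto simp: carrier_lim_vietoris)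
    have "J x \<in> (\<Pi>\<^sub>E t\<in>{0<..}. carrier (homology k (?B t)))"
      using homology_map_carrier[OF additive_cpx_vietoris additive_cpx_blurred nc xr] by (auto simp: J_def)
    moreover have "homology_map k (?B t) (coend_map (CN M d) (A_interval t) (A_interval_trans s t)) (J x s) = J x t"
      if st: "0 < s" "s \<le> t" for s t
    proof -
      have t: "0 < t" using st by simp
      have "homology_map k (?B t) (coend_map (CN M d) (A_interval t) (A_interval_trans s t)) (J x s)
          = homology_map k (?B t) (nerve_to_coend t) (x (r s))"
        unfolding J_def using st
        by (simp, intro homology_map_comp[OF additive_cpx_vietoris additive_cpx_blurred additive_cpx_blurred nc
              coend_map_chain_map[OF ch_diagram_CN coefficients_A_interval coefficients_A_interval
                coefficient_map_A_interval_trans] xr] nerve_to_coend_natural[symmetric] in_nerve) simp_all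
      also have "\<dots> = homology_map k (?B t) (nerve_to_coend t) (homology_map k (?V (r t)) (\<lambda>_ c. c) (x (r s)))"
        by (rule homology_map_comp[symmetric, OF additive_cpx_vietoris additive_cpx_vietoris additive_cpx_blurred
              vietoris_incl_chain_map[OF r_mono[OF st(2)]] nc[OF t] xr[OF st(1)]]) simp
      also have "\<dots> = J x t"
        using t compat[OF r(1)[OF st(1)] r_mono[OF st(2)]] by (simp add: J_def)
      finally show ?thesis .
    qed
    ultimately show "J x \<in> carrier (lim_pos (blurred_magnitude_homology k M d))"
      by (simp add: carrier_lim_blurred)
    show "homology_map k (?V t) (coend_to_vietoris t) (J x t) = x t" if t: "0 < t"
    proof -
      have "homology_map k (?V t) (coend_to_vietoris t) (J x t) = homology_map k (?V t) (\<lambda>_ c. c) (x (r t))"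
        unfolding J_def using t
        by (simp, intro homology_map_comp[OF additive_cpx_vietoris additive_cpx_blurred additive_cpx_vietoris nc[OF t]
              coend_to_vietoris_chain_map xr[OF t]] coend_to_vietoris_nerve_to_coend[symmetric] in_nerve) simp_all
      then show ?thesis
        using compat[OF r[OF t]] by simp
    qed
  qed
  show thesis
  proof (rule that)
    show "J ` carrier (vietoris_homology k M d) \<subseteq> carrier (lim_pos (blurred_magnitude_homology k M d))"
      using J_in by blast
    show "inj_on J (carrier (vietoris_homology k M d))"
    proof (rule inj_onI)
      fix x y assume x: "x \<in> carrier (vietoris_homology k M d)" and y: "y \<in> carrier (vietoris_homology k M d)"
        and eq: "J x = J y"
      have "x t = y t" if "0 < t" for t
        using J_recover[OF x that] J_recover[OF y that] eq by simp
      moreover have "x \<in> (\<Pi>\<^sub>E t\<in>{0<..}. carrier (homology k (?V t)))"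
        "y \<in> (\<Pi>\<^sub>E t\<in>{0<..}. carrier (homology k (?V t)))"
        using x y by (simp_all add: carrier_lim_vietoris)
      ultimately show "x = y"
        by (intro PiE_ext) auto
    qed
  qed
qed

lemma singleton_bij_betw: "bij_betw h A B \<Longrightarrow> A \<subseteq> {z} \<Longrightarrow> a \<in> B \<Longrightarrow> b \<in> B \<Longrightarrow> a = b"
  by (auto simp: bij_betw_def)

text \<open>An isomorphism is a bijection, so the blurred limit has at most one element, and the Vietoris
  limit embeds into it.\<close>

lemma iso_imp_lim_vietoris_unique:
  assumes iso: "lim_pos (magnitude_homology k M d) \<cong> lim_pos (blurred_magnitude_homology k M d)"
    and x: "x \<in> carrier (vietoris_homology k M d)" and y: "y \<in> carrier (vietoris_homology k M d)"
  shows "x = y"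
proof -
  obtain h where h: "bij_betw h (carrier (lim_pos (magnitude_homology k M d)))
      (carrier (lim_pos (blurred_magnitude_homology k M d)))"
    using iso by (auto simp: is_iso_def iso_def)
  note one = singleton_bij_betw[OF h lim_magnitude_subset]
  obtain J where "J ` carrier (vietoris_homology k M d) \<subseteq> carrier (lim_pos (blurred_magnitude_homology k M d))"
    "inj_on J (carrier (vietoris_homology k M d))"
    by (rule lim_vietoris_to_blurred)
  then show ?thesis
    using one[of "J x" "J y"] x y by (auto dest: inj_onD)
qed

lemma zero_in_lim_vietoris:
  "(\<lambda>t\<in>{0<..}. boundaries (chains (vietoris M d t)) k) \<in> carrier (vietoris_homology k M d)"
  using homology_map_boundaries[OF additive_cpx_vietoris additive_cpx_vietoris vietoris_incl_chain_map, of _ _ k]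
  by (simp add: carrier_lim_vietoris boundaries_in_homology[OF additive_cpx_vietoris])

text \<open>The two faces of a \<open>1\<close>-simplex enter its boundary with opposite signs, and each has
  augmentation \<open>1\<close>.\<close>

lemma boundaries_augmentation:
  assumes "b \<in> boundaries (chains (vietoris M d t)) 0"
  shows "frag_extend (\<lambda>_. frag_of ()) b = 0"
proof -
  obtain c where b: "b = bd (chains (vietoris M d t)) 0 c"
    using assms by (auto simp: boundaries_def)
  show ?thesis
    unfolding b by (induction c rule: frag_induction[OF subset_UNIV])
      (simp_all add: chains_def frag_extend_diff frag_extend_add frag_extend_minus)
qed

text \<open>The two elements are the class of \<open>p\<close> and zero; the augmentation tells them apart.\<close>

lemma lim_vietoris_0_not_unique:
  assumes "p \<in> M"
  obtains x y where "x \<in> carrier (vietoris_homology 0 M d)" "y \<in> carrier (vietoris_homology 0 M d)" "x \<noteq> y"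
proof
  let ?V = "\<lambda>t. chains (vietoris M d t)"
  let ?x = "\<lambda>t\<in>{0<..}. boundaries (?V t) 0 #>\<^bsub>grp (?V t) 0\<^esub> frag_of [p]"
  have cyc: "frag_of [p] \<in> cycles (?V t) 0" if "0 < t" for t
    using assms that by (simp add: cycles_def simplices_vietoris)
  have "homology_map 0 (?V t) (\<lambda>_ c. c) (?x s) = ?x t" if st: "0 < s" "s \<le> t" for s t
    using homology_map_class[OF additive_cpx_vietoris additive_cpx_vietoris vietoris_incl_chain_map[OF st(2)] cyc[OF st(1)]] st
    by simp
  then show "?x \<in> carrier (vietoris_homology 0 M d)"
    using cyc by (auto simp: carrier_lim_vietoris carrier_homology)
  show "(\<lambda>t\<in>{0<..}. boundaries (?V t) 0) \<in> carrier (vietoris_homology 0 M d)"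
    by (rule zero_in_lim_vietoris)
  show "?x \<noteq> (\<lambda>t\<in>{0<..}. boundaries (?V t) 0)"
  proof
    assume "?x = (\<lambda>t\<in>{0<..}. boundaries (?V t) 0)"
    then have "boundaries (?V 1) 0 #>\<^bsub>grp (?V 1) 0\<^esub> frag_of [p] = boundaries (?V 1) 0"
      by (auto dest: fun_cong[of _ _ 1])
    moreover have "frag_of [p] \<in> boundaries (?V 1) 0 #>\<^bsub>grp (?V 1) 0\<^esub> frag_of [p]"
      by (rule group.rcos_self[OF additive_cpxD(2)[OF additive_cpx_vietoris] _ subgroup_boundaries[OF additive_cpx_vietoris]])
        (use assms in \<open>simp add: simplices_vietoris\<close>)
    ultimately show False
      using boundaries_augmentation[of "frag_of [p]" 1] by simp
  qed
qed

lemma lim_vietoris_trivial: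
  assumes "\<And>x y. x \<in> carrier (vietoris_homology k M d) \<Longrightarrow> y \<in> carrier (vietoris_homology k M d) \<Longrightarrow> x = y"
  shows "vietoris_homology k M d \<cong> singleton_group (0 :: int)"
proof (rule is_isoI)
  obtain z where z: "carrier (vietoris_homology k M d) = {z}"
    using zero_in_lim_vietoris[of k] assms by blast
  show "(\<lambda>_. 0) \<in> iso (vietoris_homology k M d) (singleton_group (0 :: int))"
    by (auto simp: iso_def hom_def z bij_betw_def)
qed

end

theorem corollary34:
  fixes X :: "'a set" and d :: "'a \<Rightarrow> 'a \<Rightarrow> real"
  assumes "Metric_space X d"
  shows "(\<forall>k. \<not> vietoris_homology k X d \<cong> singleton_group (0::int) \<longrightarrow>
            \<not> lim_pos (magnitude_homology k X d) \<cong> lim_pos (blurred_magnitude_homology k X d)) \<and>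
         (finite X \<and> X \<noteq> {} \<longrightarrow>
            \<not> lim_pos (magnitude_homology 0 X d) \<cong> lim_pos (blurred_magnitude_homology 0 X d))"
proof (intro conjI allI impI notI)
  interpret Metric_space X d by fact
  show False if "\<not> vietoris_homology k X d \<cong> singleton_group (0::int)"
    "lim_pos (magnitude_homology k X d) \<cong> lim_pos (blurred_magnitude_homology k X d)" for k
    using that lim_vietoris_trivial[OF iso_imp_lim_vietoris_unique[OF that(2)]] by blast
  show False if X: "finite X \<and> X \<noteq> {}"
    "lim_pos (magnitude_homology 0 X d) \<cong> lim_pos (blurred_magnitude_homology 0 X d)"
  proof -
    obtain p where "p \<in> X" using X by blast
    then show False
      using lim_vietoris_0_not_unique iso_imp_lim_vietoris_unique[OF that(2)] by metis
  qed
qed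

end
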